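(* Assume $r\ne0$ and let $\alpha\in k$ with $\alpha\notin-\mathbb N-\mathbb N\cdot 2r$. Then for every $\lambda\in\Lambda$ the following formula holds: $$\frac{R_\lambda(-\underline\alpha-z)}{R_\lambda(-\rho_\alpha)}=\sum_{\mu\in\Lambda}(-1)^{|\mu|_{\rm odd}}\,\frac{R_\mu(\rho+\lambda)}{R_\mu(\rho+\mu)}\,\frac{R_\mu(z)}{R_\mu(-\rho_\alpha)} .$$
   Context: Let $k$ be a field of characteristic zero, $n\ge 1$, $\mathcal P=k[z_1,\dots,z_n]$, and let $W\subseteq S_n$ be the group of permutations $\pi$ with $\pi(i)\equiv i \bmod 2$ for all $i$, acting by permuting variables. $\mathbb N$ contains $0$. $\Lambda$ is the set of integer tuples $\lambda=(\lambda_1\ge\dots\ge\lambda_n\ge 0)$ and $|\lambda|_{\rm odd}=\sum_{i\text{ odd}}\lambda_i$. Fix $r\in k$ which is not a negative rational number and put $\rho=((n-1)r,(n-2)r,\dots,r,0)$. For $\lambda\in\Lambda$ let $[\lambda]_m=\lambda_m-\lambda_{m+1}+\dots+(-1)^{n-m}\lambda_n$. $R_\lambda(z)=R_\lambda(z;r)\in\mathcal P^W$ is the unique $W$-invariant polynomial of degree $|\lambda|_{\rm odd}$ which satisfies $R_\lambda(\rho+\mu)=0$ for all $\mu\in\Lambda$ with $|\mu|_{\rm odd}\le|\lambda|_{\rm odd}$, $\mu\ne\lambda$, and in which the monomial $z^{[\lambda]}$ has coefficient $1$ (it is known that this exists and is unique, and that $R_\lambda(\rho+\lambda)\neq0$).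 For $\alpha\in k$ put $\underline\alpha=(\alpha,\dots,\alpha)\in k^n$ and $\rho_\alpha=\rho+\underline\alpha$. Under the stated assumptions on $r,\alpha$ one has $R_\mu(-\rho_\alpha)\ne0$ for all $\mu\in\Lambda$, and only finitely many summands on the right-hand side are nonzero because $R_\mu(\rho+\lambda)=0$ unless $\mu_i\le\lambda_i$ for all $i$. *)

theory Defs
  imports Complex_Main "HOL-Library.Poly_Mapping" "HOL-Combinatorics.Permutations"
begin

text \<open>Polynomials over \<^typ>\<open>'k\<close> in variables indexed by natural numbers: a monomial is a finitely
  supported exponent function, multiplication is the convolution of \<^theory>\<open>HOL-Library.Poly_Mapping\<close>.
  The ring in the variables \<open>z\<^sub>1, \<dots>, z\<^sub>n\<close> is the subset \<open>polys n\<close> below.\<close>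

type_synonym 'k mpoly = "(nat \<Rightarrow>\<^sub>0 nat) \<Rightarrow>\<^sub>0 'k"

definition Const :: "'k \<Rightarrow> 'k::comm_ring_1 mpoly" where
  "Const c = Poly_Mapping.single 0 c"

definition Var :: "nat \<Rightarrow> 'k::comm_ring_1 mpoly" where
  "Var i = Poly_Mapping.single (Poly_Mapping.single i 1) 1"

definition polys :: "nat \<Rightarrow> 'k::comm_ring_1 mpoly set" where
  "polys n = {p. \<forall>m\<in>Poly_Mapping.keys p. Poly_Mapping.keys m \<subseteq> {1..n}}"

definition monom_deg :: "(nat \<Rightarrow>\<^sub>0 nat) \<Rightarrow> nat" where
  "monom_deg m = (\<Sum>i\<in>Poly_Mapping.keys m. Poly_Mapping.lookup m i)"

text \<open>Total degree; the zero polynomial gets degree 0.\<close>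

definition total_deg :: "'k::comm_ring_1 mpoly \<Rightarrow> nat" where
  "total_deg p = Max (insert 0 (monom_deg ` Poly_Mapping.keys p))"

definition eval :: "(nat \<Rightarrow> 'k) \<Rightarrow> 'k::comm_ring_1 mpoly \<Rightarrow> 'k" where
  "eval x p = (\<Sum>m\<in>Poly_Mapping.keys p.
     Poly_Mapping.lookup p m * (\<Prod>i\<in>Poly_Mapping.keys m. x i ^ Poly_Mapping.lookup m i))"

definition subst :: "(nat \<Rightarrow> 'k mpoly) \<Rightarrow> 'k::comm_ring_1 mpoly \<Rightarrow> 'k mpoly" where
  "subst f p = (\<Sum>m\<in>Poly_Mapping.keys p.
     Const (Poly_Mapping.lookup p m) * (\<Prod>i\<in>Poly_Mapping.keys m. f i ^ Poly_Mapping.lookup m i))"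

definition W :: "nat \<Rightarrow> (nat \<Rightarrow> nat) set" where
  "W n = {\<pi>. \<pi> permutes {1..n} \<and> (\<forall>i\<in>{1..n}. \<pi> i mod 2 = i mod 2)}"

definition W_invariant :: "nat \<Rightarrow> 'k::comm_ring_1 mpoly \<Rightarrow> bool" where
  "W_invariant n p \<longleftrightarrow> (\<forall>\<pi>\<in>W n. subst (\<lambda>i. Var (\<pi> i)) p = p)"

text \<open>Tuples are functions on the indices \<open>1, \<dots>, n\<close>, normalised to be 0 elsewhere so that
  equality of functions is equality of tuples.\<close>

definition Lam :: "nat \<Rightarrow> (nat \<Rightarrow> nat) set" where
  "Lam n = {l. (\<forall>i j. 1 \<le> i \<and> i \<le> j \<and> j \<le> n \<longrightarrow> l j \<le> l i) \<and> (\<forall>i. i \<notin> {1..n} \<longrightarrow> l i = 0)}"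

definition odd_size :: "nat \<Rightarrow> (nat \<Rightarrow> nat) \<Rightarrow> nat" where
  "odd_size n l = (\<Sum>i | i \<in> {1..n} \<and> odd i. l i)"

text \<open>The exponent vector \<open>[\<lambda>]\<close>. The alternating sums are computed in the integers; for
  \<open>\<lambda> \<in> \<Lambda>\<close> they are nonnegative, so \<^const>\<open>nat\<close> loses nothing.\<close>

definition alt_exp :: "nat \<Rightarrow> (nat \<Rightarrow> nat) \<Rightarrow> (nat \<Rightarrow>\<^sub>0 nat)" where
  "alt_exp n l =
     (\<Sum>m\<in>{1..n}. Poly_Mapping.single m (nat (\<Sum>j\<in>{m..n}. (- 1) ^ (j - m) * int (l j))))"

text \<open>Only the values at indices \<open>1, \<dots>, n\<close> of this and other points of \<open>k\<^sup>n\<close> are relevant.\<close>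

definition rho :: "nat \<Rightarrow> 'k::comm_ring_1 \<Rightarrow> nat \<Rightarrow> 'k" where
  "rho n r i = of_nat (n - i) * r"

definition rho_plus :: "nat \<Rightarrow> 'k::comm_ring_1 \<Rightarrow> (nat \<Rightarrow> nat) \<Rightarrow> nat \<Rightarrow> 'k" where
  "rho_plus n r l i = rho n r i + of_nat (l i)"

definition is_R :: "nat \<Rightarrow> 'k::comm_ring_1 \<Rightarrow> (nat \<Rightarrow> nat) \<Rightarrow> 'k mpoly \<Rightarrow> bool" where
  "is_R n r l p \<longleftrightarrow>
     p \<in> polys n \<and> W_invariant n p \<and> total_deg p = odd_size n l \<and>
     (\<forall>u\<in>Lam n. odd_size n u \<le> odd_size n l \<and> u \<noteq> l \<longrightarrow> eval (rho_plus n r u) p = 0) \<and>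
     Poly_Mapping.lookup p (alt_exp n l) = 1"

text \<open>For \<open>\<lambda> \<in> \<Lambda>\<close> and \<open>r\<close> not a negative rational, there is exactly one such polynomial.\<close>

definition R :: "nat \<Rightarrow> 'k::comm_ring_1 \<Rightarrow> (nat \<Rightarrow> nat) \<Rightarrow> 'k mpoly" where
  "R n r l = (THE p. is_R n r l p)"

definition neg_rho_shift :: "nat \<Rightarrow> 'k::comm_ring_1 \<Rightarrow> 'k \<Rightarrow> nat \<Rightarrow> 'k" where
  "neg_rho_shift n r \<alpha> i = - (rho n r i + \<alpha>)"

end

theory Submission
  imports Defs "Jordan_Normal_Form.Determinant"
begin

text \<open>Write \<open>\<psi>\<^sub>\<lambda>(z) = R\<^sub>\<lambda>(-\<alpha> - z) / R\<^sub>\<lambda>(-\<rho>\<^sub>\<alpha>)\<close>. The \<open>R\<^sub>\<lambda>\<close> are joint eigenfunctions of difference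
  operators which preserve the degree because, up to a Vandermonde product, they are given by a
  determinant in which leading terms cancel; their coefficients vanish whenever a shift leaves
  \<open>\<rho> + \<Lambda>\<close> or \<open>-\<rho>\<^sub>\<alpha> - \<Lambda>\<close>. Evaluated at the points \<open>-\<rho>\<^sub>\<alpha> - \<nu>\<close>, the eigenvalue equations form a recursion
  in \<open>\<nu>\<close>, from which \<open>\<psi>\<^sub>\<lambda>(\<rho> + \<nu>)\<close> is, for fixed \<open>\<nu>\<close>, a \<open>W\<close>-invariant polynomial of degree at most
  \<open>|\<nu>|\<^sub>o\<^sub>d\<^sub>d\<close> in \<open>\<rho> + \<lambda>\<close>; it also follows that \<open>R\<^sub>\<lambda>(-\<rho>\<^sub>\<alpha>) \<noteq> 0\<close>. The right-hand side at \<open>z = \<rho> + \<nu>\<close> has the same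
  property, being symmetric in \<open>\<lambda>\<close> and \<open>\<nu>\<close>. Since a polynomial of degree \<open>N\<close> is determined by its values at the
  \<open>\<rho> + \<mu>\<close> with \<open>|\<mu>|\<^sub>o\<^sub>d\<^sub>d \<le> N\<close>, and the leading terms of both sides agree, induction on \<open>|\<lambda>|\<^sub>o\<^sub>d\<^sub>d\<close> proves
  the formula.\<close>

section \<open>Polynomial functions\<close>

text \<open>The size |lambda|_odd sees only half of the components, so the operators come in two
  families, one for each parity class \<open>b\<close>. A coefficient belongs to an index set K, the
  shift, and its determinant vanishes unless K has equally many odd and even elements or, for
  \<open>b = True\<close>, possibly one odd element more. The sets {1..m} are of this kind for
  \<open>b = odd m\<close>, so every tuple can be built by adding such columns. Inside the
  determinant the even variables are shifted by r or -r. In rho + lambda, two equal neighbouring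
  components mean z_a = z_(a+1) + r, and the shifts turn this into an equality of two rows: this is
  why coefficients vanish at the walls of Lambda. The last wall, lambda_n = 0, is handled by a
  monomial weight in the variables whose index has the parity of n. At the points -rho_alpha - v its
  factors are -alpha - 2 q r - v_a, which the hypothesis on alpha keeps away from 0.\<close>

definition mval :: "(nat \<Rightarrow>\<^sub>0 nat) \<Rightarrow> (nat \<Rightarrow> 'k) \<Rightarrow> 'k::comm_ring_1" where
  "mval m x = (\<Prod>i\<in>Poly_Mapping.keys m. x i ^ Poly_Mapping.lookup m i)"

lemma mval_superset:
  assumes "finite A" "Poly_Mapping.keys m \<subseteq> A"
  shows "mval m x = (\<Prod>i\<in>A. x i ^ Poly_Mapping.lookup m i)"
  unfolding mval_def using assms
  by (intro prod.mono_neutral_left) (auto simp: in_keys_iff)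

lemma mval_0 [simp]: "mval 0 x = 1"
  by (simp add: mval_def)

lemma mval_add: "mval (m + m') x = mval m x * mval m' x"
proof -
  let ?A = "Poly_Mapping.keys m \<union> Poly_Mapping.keys m'"
  have "Poly_Mapping.keys (m + m') \<subseteq> ?A"
    by (rule Poly_Mapping.keys_add)
  then show ?thesis
    by (simp add: mval_superset[of ?A] lookup_add power_add prod.distrib)
qed

lemma mval_single: "mval (Poly_Mapping.single i k) x = x i ^ k"
  by (simp add: mval_superset[of "{i}"])

lemma mval_cong: "(\<And>i. i \<in> Poly_Mapping.keys m \<Longrightarrow> x i = y i) \<Longrightarrow> mval m x = mval m y"
  by (simp add: mval_def)

lemma eval_altdef: "eval x p = (\<Sum>m\<in>Poly_Mapping.keys p. Poly_Mapping.lookup p m * mval m x)"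
  by (simp add: eval_def mval_def)

lemma eval_superset:
  assumes "finite A" "Poly_Mapping.keys p \<subseteq> A"
  shows "eval x p = (\<Sum>m\<in>A. Poly_Mapping.lookup p m * mval m x)"
  unfolding eval_altdef using assms
  by (intro sum.mono_neutral_left) (auto simp: in_keys_iff)

lemma eval_0 [simp]: "eval x 0 = 0"
  by (simp add: eval_altdef)

lemma eval_add [simp]: "eval x (p + q) = eval x p + eval x q"
proof -
  let ?A = "Poly_Mapping.keys p \<union> Poly_Mapping.keys q"
  have "Poly_Mapping.keys (p + q) \<subseteq> ?A"
    by (rule Poly_Mapping.keys_add)
  then show ?thesis
    by (simp add: eval_superset[of ?A] lookup_add algebra_simps sum.distrib)
qed

lemma eval_uminus [simp]: "eval x (- p) = - eval x p"
  by (simp add: eval_altdef sum_negf)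

lemma eval_diff [simp]: "eval x (p - q) = eval x p - eval x q"
  using eval_add[of x p "- q"] by simp

lemma eval_sum: "eval x (\<Sum>i\<in>A. f i) = (\<Sum>i\<in>A. eval x (f i))"
  by (induction A rule: infinite_finite_induct) auto

lemma eval_single: "eval x (Poly_Mapping.single m c) = c * mval m x"
  by (simp add: eval_superset[of "{m}"])

lemma sum_single_keys:
  "p = (\<Sum>m\<in>Poly_Mapping.keys p. Poly_Mapping.single m (Poly_Mapping.lookup p m))"
  by (rule poly_mapping_eqI)
    (auto simp: lookup_sum lookup_single when_def in_keys_iff sum.delta')

lemma eval_mult [simp]: "eval x (p * q) = eval x p * eval x q"
proof -
  have "p * q = (\<Sum>m\<in>Poly_Mapping.keys p. \<Sum>m'\<in>Poly_Mapping.keys q.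
      Poly_Mapping.single (m + m') (Poly_Mapping.lookup p m * Poly_Mapping.lookup q m'))"
    by (subst sum_single_keys[of p], subst sum_single_keys[of q])
      (simp add: sum_product mult_single)
  then have "eval x (p * q) = (\<Sum>m\<in>Poly_Mapping.keys p. \<Sum>m'\<in>Poly_Mapping.keys q.
      Poly_Mapping.lookup p m * Poly_Mapping.lookup q m' * mval (m + m') x)"
    by (simp add: eval_sum eval_single)
  also have "\<dots> = eval x p * eval x q"
    unfolding eval_altdef sum_product by (intro sum.cong) (simp_all add: mval_add mult_ac)
  finally show ?thesis .
qed

lemma eval_Const [simp]: "eval x (Const c) = c"
  by (simp add: Const_def eval_single)

lemma eval_Var [simp]: "eval x (Var i) = x i"
  by (simp add: Var_def eval_single mval_single)

lemma eval_1 [simp]: "eval x 1 = 1"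
  using eval_Const[of x 1] by (simp add: Const_def)

lemma eval_power [simp]: "eval x (p ^ k) = eval x p ^ k"
  by (induction k) auto

lemma eval_prod: "eval x (\<Prod>i\<in>A. f i) = (\<Prod>i\<in>A. eval x (f i))"
  by (induction A rule: infinite_finite_induct) auto

lemma eval_subst [simp]: "eval x (subst f p) = eval (\<lambda>i. eval x (f i)) p"
  by (simp add: subst_def eval_sum eval_prod eval_altdef[of _ p] mval_def)

lemma two_power_inject: "(2::'k::field_char_0) ^ a = 2 ^ b \<longleftrightarrow> a = b"
proof -
  have "(2::'k) ^ a = 2 ^ b \<longleftrightarrow> of_nat (2 ^ a) = (of_nat (2 ^ b) :: 'k)" by simp
  also have "\<dots> \<longleftrightarrow> a = b" unfolding of_nat_eq_iff by simp
  finally show ?thesis .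
qed

text \<open>Monomials are separated by the rescalings \<open>x\<^sub>i \<mapsto> 2 x\<^sub>i\<close>, as in Dedekind's
  proof of the independence of characters.\<close>

lemma mval_independent:
  fixes c :: "(nat \<Rightarrow>\<^sub>0 nat) \<Rightarrow> 'k::field_char_0"
  assumes "finite M" "\<And>x. (\<Sum>m\<in>M. c m * mval m x) = 0" "m \<in> M"
  shows "c m = 0"
  using assms
proof (induction M arbitrary: c m rule: finite_induct)
  case (insert m0 M)
  have scale: "mval m (x(i := 2 * x i)) = 2 ^ Poly_Mapping.lookup m i * mval m x"
    for m i and x :: "nat \<Rightarrow> 'k"
  proof -
    let ?A = "insert i (Poly_Mapping.keys m)"
    have "mval m (x(i := 2 * x i)) = (\<Prod>j\<in>?A. (if j = i then 2 ^ Poly_Mapping.lookup m j else 1)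
        * x j ^ Poly_Mapping.lookup m j)"
      by (subst mval_superset[of ?A]) (auto simp: power_mult_distrib intro!: prod.cong)
    also have "\<dots> = 2 ^ Poly_Mapping.lookup m i * mval m x"
      by (subst prod.distrib, subst mval_superset[of ?A]) (auto simp: prod.delta)
    finally show ?thesis .
  qed
  have other: "c m = 0" if "m \<in> M" for m
  proof -
    have "m \<noteq> m0" using insert that by auto
    then obtain i where i: "Poly_Mapping.lookup m i \<noteq> Poly_Mapping.lookup m0 i"
      by (metis poly_mapping_eqI)
    let ?e = "\<lambda>m. (2::'k) ^ Poly_Mapping.lookup m i"
    have "(\<Sum>m\<in>M. (c m * (?e m - ?e m0)) * mval m x) = 0" for x
    proof -
      have "(\<Sum>m\<in>insert m0 M. c m * mval m (x(i := 2 * x i))) -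
          ?e m0 * (\<Sum>m\<in>insert m0 M. c m * mval m x) = 0"
        using insert.prems(1) by simp
      then show ?thesis
        using insert.hyps by (simp only: scale sum.insert) (simp add: sum_distrib_left algebra_simps sum_subtractf)
    qed
    from insert.IH[OF this that] show ?thesis
      using i by (simp add: two_power_inject)
  qed
  have "c m0 = 0"
    using insert.prems(1)[of "\<lambda>_. 1"] insert.hyps other by (simp add: mval_def)
  with other insert.prems(2) show ?case by auto
qed auto

lemma eval_inject:
  fixes p q :: "'k::field_char_0 mpoly"
  assumes "\<And>x. eval x p = eval x q"
  shows "p = q"
proof -
  have "Poly_Mapping.lookup (p - q) m = 0" for m
  proof (cases "m \<in> Poly_Mapping.keys (p - q)")
    case True
    have "(\<Sum>m\<in>Poly_Mapping.keys (p - q). Poly_Mapping.lookup (p - q) m * mval m x) = 0" for x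
      using assms[of x] unfolding eval_altdef[symmetric] by simp
    from mval_independent[OF _ this True] show ?thesis by simp
  qed (simp add: in_keys_iff)
  then have "p - q = 0" by (intro poly_mapping_eqI) simp
  then show ?thesis by simp
qed

lemma W_invariant_iff:
  fixes p :: "'k::field_char_0 mpoly"
  shows "W_invariant n p \<longleftrightarrow> (\<forall>\<pi>\<in>W n. \<forall>x. eval (\<lambda>i. x (\<pi> i)) p = eval x p)"
proof -
  have "subst (\<lambda>i. Var (\<pi> i)) p = p \<longleftrightarrow> (\<forall>x. eval (\<lambda>i. x (\<pi> i)) p = eval x p)" for \<pi>
  proof
    assume "subst (\<lambda>i. Var (\<pi> i)) p = p"
    then show "\<forall>x. eval (\<lambda>i. x (\<pi> i)) p = eval x p"
      by (metis (no_types, lifting) eval_Var eval_subst ext)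
  qed (auto intro!: eval_inject)
  then show ?thesis by (simp add: W_invariant_def)
qed

section \<open>Degrees, and spans of monomials as sets of functions\<close>

lemma monom_deg_superset:
  assumes "finite A" "Poly_Mapping.keys m \<subseteq> A"
  shows "monom_deg m = (\<Sum>i\<in>A. Poly_Mapping.lookup m i)"
  unfolding monom_deg_def using assms
  by (intro sum.mono_neutral_left) (auto simp: in_keys_iff)

lemma monom_deg_0 [simp]: "monom_deg 0 = 0"
  by (simp add: monom_deg_def)

lemma monom_deg_add [simp]: "monom_deg (m + m') = monom_deg m + monom_deg m'"
proof -
  let ?A = "Poly_Mapping.keys m \<union> Poly_Mapping.keys m'"
  have "Poly_Mapping.keys (m + m') \<subseteq> ?A"
    by (rule Poly_Mapping.keys_add)
  then show ?thesis
    by (simp add: monom_deg_superset[of ?A] lookup_add sum.distrib)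
qed

lemma monom_deg_single [simp]: "monom_deg (Poly_Mapping.single i k) = k"
  by (simp add: monom_deg_superset[of "{i}"])

text \<open>Linear combinations of monomials from M, kept as functions. An arbitrary set M can
  record more than a degree bound: the interpolation theorem needs spans from which single monomials
  of top degree are removed.\<close>

inductive mspan :: "(nat \<Rightarrow>\<^sub>0 nat) set \<Rightarrow> ((nat \<Rightarrow> 'k) \<Rightarrow> 'k::comm_ring_1) \<Rightarrow> bool" for M where
  mspan_zero: "mspan M (\<lambda>_. 0)"
| mspan_step: "mspan M F \<Longrightarrow> m \<in> M \<Longrightarrow> mspan M (\<lambda>x. F x + c * mval m x)"

lemma mspan_mon: "m \<in> M \<Longrightarrow> mspan M (\<lambda>x. c * mval m x)"
  using mspan_step[OF mspan_zero, of m M c] by simp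

lemma mspan_mon1: "m \<in> M \<Longrightarrow> mspan M (mval m)"
  using mspan_mon[of m M 1] by simp

lemma mspan_add: "mspan M F \<Longrightarrow> mspan M G \<Longrightarrow> mspan M (\<lambda>x. F x + G x)"
proof (induction rule: mspan.induct)
  case (mspan_step F m c)
  then have "mspan M (\<lambda>x. (F x + G x) + c * mval m x)"
    by (intro mspan.mspan_step) auto
  then show ?case by (simp add: add_ac)
qed simp

lemma mspan_scale: "mspan M F \<Longrightarrow> mspan M (\<lambda>x. c * F x)"
proof (induction rule: mspan.induct)
  case (mspan_step F m d)
  then have "mspan M (\<lambda>x. c * F x + (c * d) * mval m x)"
    by (intro mspan.mspan_step) auto
  then show ?case by (simp add: algebra_simps)
qed (simp add: mspan_zero)

lemma mspan_uminus: "mspan M F \<Longrightarrow> mspan M (\<lambda>x. - F x)"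
  using mspan_scale[of M F "-1"] by simp

lemma mspan_diff: "mspan M F \<Longrightarrow> mspan M G \<Longrightarrow> mspan M (\<lambda>x. F x - G x)"
  using mspan_add[OF _ mspan_uminus, of M F G] by simp

lemma mspan_sum: "(\<And>i. i \<in> A \<Longrightarrow> mspan M (F i)) \<Longrightarrow> mspan M (\<lambda>x. \<Sum>i\<in>A. F i x)"
  by (induction A rule: infinite_finite_induct) (auto intro: mspan_zero mspan_add)

lemma mspan_mono: "mspan M F \<Longrightarrow> M \<subseteq> M' \<Longrightarrow> mspan M' F"
  by (induction rule: mspan.induct) (auto intro: mspan.intros)

lemma mspan_lift:
  assumes "mspan M F" "\<And>m. m \<in> M \<Longrightarrow> mspan M' (\<lambda>x. mval m (\<phi> x))"
  shows "mspan M' (\<lambda>x. F (\<phi> x))"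
  using assms(1)
proof induction
  case (mspan_step F m c)
  then show ?case by (intro mspan_add[of M' "\<lambda>x. F (\<phi> x)"] mspan_scale[of M' _ c] assms(2))
qed (rule mspan_zero)

lemma mspan_eval: "Poly_Mapping.keys p \<subseteq> M \<Longrightarrow> mspan M (\<lambda>x. eval x p)"
  unfolding eval_altdef by (intro mspan_sum mspan_mon) auto

lemma mspan_cong:
  assumes "mspan M F" "\<And>m i. m \<in> M \<Longrightarrow> i \<in> Poly_Mapping.keys m \<Longrightarrow> x i = y i"
  shows "F x = F y"
  using assms(1)
proof induction
  case (mspan_step F m c)
  then show ?case using mval_cong[of m x y] assms(2) by auto
qed simp

text \<open>With an integer bound, d - 1 is meaningful for d = 0, and for negative d only the zero
  function is left.\<close>

definition Pol :: "nat \<Rightarrow> int \<Rightarrow> ((nat \<Rightarrow> 'k) \<Rightarrow> 'k::comm_ring_1) \<Rightarrow> bool" where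
  "Pol n d = mspan {m. Poly_Mapping.keys m \<subseteq> {1..n} \<and> int (monom_deg m) \<le> d}"

lemma Pol_zero [simp]: "Pol n d (\<lambda>_. 0)"
  and Pol_add: "Pol n d F \<Longrightarrow> Pol n d G \<Longrightarrow> Pol n d (\<lambda>x. F x + G x)"
  and Pol_diff: "Pol n d F \<Longrightarrow> Pol n d G \<Longrightarrow> Pol n d (\<lambda>x. F x - G x)"
  and Pol_scale: "Pol n d F \<Longrightarrow> Pol n d (\<lambda>x. c * F x)"
  and Pol_sum: "(\<And>i. i \<in> A \<Longrightarrow> Pol n d (H i)) \<Longrightarrow> Pol n d (\<lambda>x. \<Sum>i\<in>A. H i x)"
  unfolding Pol_def by (auto intro: mspan_zero mspan_add mspan_diff mspan_uminus mspan_scale mspan_sum)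

lemma Pol_mono: "Pol n d F \<Longrightarrow> d \<le> d' \<Longrightarrow> Pol n d' F"
  unfolding Pol_def by (erule mspan_mono) auto

lemma Pol_neg:
  assumes "Pol n d F" "d < 0"
  shows "F x = 0"
proof -
  have "{m. Poly_Mapping.keys m \<subseteq> {1..n} \<and> int (monom_deg m) \<le> d} = {}" using assms by auto
  then have "mspan {} F" using assms unfolding Pol_def by simp
  then show ?thesis by induction auto
qed

lemma Pol_const: "0 \<le> d \<Longrightarrow> Pol n d (\<lambda>_. c)"
  unfolding Pol_def using mspan_mon[of 0 _ c] by simp

lemma Pol_Var: "1 \<le> d \<Longrightarrow> i \<in> {1..n} \<Longrightarrow> Pol n d (\<lambda>x. x i)"
  using mspan_mon[of "Poly_Mapping.single i 1" "{m. Poly_Mapping.keys m \<subseteq> {1..n} \<and> int (monom_deg m) \<le> d}" 1]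
  unfolding Pol_def by (auto simp: mval_single)

lemma Pol_mult:
  assumes "Pol n d F" "Pol n e G"
  shows "Pol n (d + e) (\<lambda>x. F x * G x)"
  using assms(1) unfolding Pol_def
proof induction
  case (mspan_step F m c)
  have "mspan {m. Poly_Mapping.keys m \<subseteq> {1..n} \<and> int (monom_deg m) \<le> d + e} (\<lambda>x. mval m x * G x)"
    using assms(2) unfolding Pol_def
  proof induction
    case (mspan_step G m' c')
    have "Poly_Mapping.keys (m + m') \<subseteq> {1..n}"
      using Poly_Mapping.keys_add[of m m'] mspan_step \<open>m \<in> _\<close> by blast
    then have "mspan {m. Poly_Mapping.keys m \<subseteq> {1..n} \<and> int (monom_deg m) \<le> d + e}
        (\<lambda>x. mval m x * G x + c' * mval (m + m') x)"
      using mspan_step \<open>m \<in> _\<close> by (intro mspan.mspan_step) auto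
    then show ?case by (simp add: algebra_simps mval_add)
  qed (auto intro: mspan_zero)
  from mspan_add[OF mspan_step.IH mspan_scale[OF this, of c]] show ?case
    by (simp add: algebra_simps)
qed (auto intro: mspan_zero)

lemma Pol_mult': "Pol n d F \<Longrightarrow> Pol n e G \<Longrightarrow> d + e \<le> f \<Longrightarrow> Pol n f (\<lambda>x. F x * G x)"
  using Pol_mult Pol_mono by blast

lemma Pol_prod:
  "finite A \<Longrightarrow> (\<And>i. i \<in> A \<Longrightarrow> Pol n (d i) (F i)) \<Longrightarrow> Pol n (\<Sum>i\<in>A. d i) (\<lambda>x. \<Prod>i\<in>A. F i x)"
  by (induction A rule: finite_induct) (auto intro: Pol_const Pol_mult)

lemma Pol_power: "Pol n d F \<Longrightarrow> Pol n (int k * d) (\<lambda>x. F x ^ k)"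
  by (induction k) (auto intro!: Pol_const Pol_mult' simp: algebra_simps)

lemma Pol_mon: "Poly_Mapping.keys m \<subseteq> {1..n} \<Longrightarrow> int (monom_deg m) \<le> d \<Longrightarrow> Pol n d (mval m)"
  unfolding Pol_def by (intro mspan_mon1) auto

lemma Pol_eval:
  assumes "p \<in> polys n" "int (total_deg p) \<le> d"
  shows "Pol n d (\<lambda>x. eval x p)"
proof -
  have "monom_deg m \<le> total_deg p" if "m \<in> Poly_Mapping.keys p" for m
    unfolding total_deg_def using that by (intro Max_ge) auto
  then show ?thesis
    unfolding Pol_def using assms by (intro mspan_eval) (force simp: polys_def)
qed

lemma Pol_cong: "Pol n d F \<Longrightarrow> (\<And>i. i \<in> {1..n} \<Longrightarrow> x i = y i) \<Longrightarrow> F x = F y"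
  unfolding Pol_def by (erule mspan_cong) auto

text \<open>F has degree at most d and the same part of degree d as H. Through
  \<open>same_lead_diff\<close>, the cancellation of leading terms becomes a drop of the
  degree.\<close>

definition same_lead :: "nat \<Rightarrow> int \<Rightarrow> ((nat \<Rightarrow> 'k) \<Rightarrow> 'k::comm_ring_1) \<Rightarrow> ((nat \<Rightarrow> 'k) \<Rightarrow> 'k) \<Rightarrow> bool" where
  "same_lead n d F H \<longleftrightarrow> Pol n d H \<and> Pol n (d - 1) (\<lambda>x. F x - H x)"

lemma same_lead_mult:
  assumes "same_lead n d F H" "same_lead n e G K"
  shows "same_lead n (d + e) (\<lambda>x. F x * G x) (\<lambda>x. H x * K x)"
proof -
  have G: "Pol n e G"
    using assms(2) Pol_add[of n e "\<lambda>x. G x - K x" K]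
      Pol_mono[of n "e - 1" "\<lambda>x. G x - K x" e] unfolding same_lead_def by auto
  have "Pol n (d + e - 1) (\<lambda>x. (F x - H x) * G x + H x * (G x - K x))"
    using assms G unfolding same_lead_def by (intro Pol_add) (auto intro: Pol_mult')
  then show ?thesis using assms unfolding same_lead_def
    by (auto intro: Pol_mult simp: algebra_simps)
qed

lemma same_lead_refl: "Pol n d H \<Longrightarrow> same_lead n d H H"
  by (simp add: same_lead_def)

lemma same_lead_power: "same_lead n d F H \<Longrightarrow> same_lead n (int k * d) (\<lambda>x. F x ^ k) (\<lambda>x. H x ^ k)"
proof (induction k)
  case 0
  then show ?case by (auto intro!: same_lead_refl Pol_const)
next
  case (Suc k)
  from same_lead_mult[OF Suc.prems Suc.IH[OF Suc.prems]] show ?case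
    by (simp add: algebra_simps)
qed

lemma same_lead_prod:
  "finite A \<Longrightarrow> (\<And>i. i \<in> A \<Longrightarrow> same_lead n (d i) (F i) (H i)) \<Longrightarrow>
    same_lead n (\<Sum>i\<in>A. d i) (\<lambda>x. \<Prod>i\<in>A. F i x) (\<lambda>x. \<Prod>i\<in>A. H i x)"
  by (induction A rule: finite_induct) (auto intro: same_lead_mult same_lead_refl Pol_const)

lemma same_lead_diff: "same_lead n d F H \<Longrightarrow> same_lead n d G H \<Longrightarrow> Pol n (d - 1) (\<lambda>x. F x - G x)"
  unfolding same_lead_def using Pol_diff[of n "d - 1" "\<lambda>x. F x - H x" "\<lambda>x. G x - H x"] by simp

lemma same_lead_Var: "i \<in> {1..n} \<Longrightarrow> same_lead n 1 (\<lambda>x. x i + b) (\<lambda>x. x i)"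
  unfolding same_lead_def by (auto intro: Pol_Var Pol_const)

lemma same_lead_mon_shift:
  assumes "Poly_Mapping.keys m \<subseteq> {1..n}"
  shows "same_lead n (int (monom_deg m)) (\<lambda>x. mval m (\<lambda>i. s * x i + b i)) (\<lambda>x. s ^ monom_deg m * mval m x)"
proof -
  let ?K = "Poly_Mapping.keys m"
  have 1: "same_lead n 1 (\<lambda>x. s * x i + b i) (\<lambda>x. s * x i)" if "i \<in> {1..n}" for i
    using that Pol_scale[OF Pol_Var[OF order.refl that], of s]
    unfolding same_lead_def by (auto intro: Pol_const)
  have "same_lead n (\<Sum>i\<in>?K. int (Poly_Mapping.lookup m i) * 1)
      (\<lambda>x. \<Prod>i\<in>?K. (s * x i + b i) ^ Poly_Mapping.lookup m i)
      (\<lambda>x. \<Prod>i\<in>?K. (s * x i) ^ Poly_Mapping.lookup m i)"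
    using assms by (intro same_lead_prod same_lead_power 1) auto
  then show ?thesis
    by (simp add: mval_def monom_deg_def power_mult_distrib prod.distrib power_sum)
qed

text \<open>A monomial m goes to a multiple of itself plus terms of degree below that of m. These
  are also below d, hence cannot be among the excluded monomials, which have degree at least
  d.\<close>

lemma mspan_affine_top:
  assumes "mspan {m. Poly_Mapping.keys m \<subseteq> {1..n} \<and> int (monom_deg m) \<le> d \<and> m \<notin> X} F"
    and "\<And>m. m \<in> X \<Longrightarrow> int (monom_deg m) \<ge> d"
  shows "mspan {m. Poly_Mapping.keys m \<subseteq> {1..n} \<and> int (monom_deg m) \<le> d \<and> m \<notin> X} (\<lambda>x. F (\<lambda>i. s * x i + b i))"
    (is "mspan ?M _")
proof (rule mspan_lift[OF assms(1)])
  fix m assume m: "m \<in> ?M"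
  have "mspan ?M (\<lambda>x. mval m (\<lambda>i. s * x i + b i) - s ^ monom_deg m * mval m x)"
  proof (rule mspan_mono)
    show "mspan {m'. Poly_Mapping.keys m' \<subseteq> {1..n} \<and> int (monom_deg m') \<le> int (monom_deg m) - 1}
        (\<lambda>x. mval m (\<lambda>i. s * x i + b i) - s ^ monom_deg m * mval m x)"
      using same_lead_mon_shift[of m n s b] m unfolding same_lead_def Pol_def by auto
  qed (use m assms(2) in force)
  from mspan_add[OF this mspan_mon[OF m, of "s ^ monom_deg m"]]
  show "mspan ?M (\<lambda>x. mval m (\<lambda>i. s * x i + b i))" by simp
qed

lemma Pol_affine: "Pol n d F \<Longrightarrow> Pol n d (\<lambda>x. F (\<lambda>i. s * x i + b i))"
  unfolding Pol_def using mspan_affine_top[of n d "{}" F s b] by simp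

text \<open>Modulo lower degree only the terms of degree exactly d survive, each scaled by s^d. For
  s = -1 this is the source of the signs in the binomial formula.\<close>

lemma Pol_affine_same_lead:
  assumes "Pol n (int d) F"
  shows "Pol n (int d - 1) (\<lambda>x. F (\<lambda>i. s * x i + b i) - s ^ d * F x)"
  using assms unfolding Pol_def
proof (induction)
  case (mspan_step F m c)
  have "Pol n (int d - 1) (\<lambda>x. mval m (\<lambda>i. s * x i + b i) - s ^ d * mval m x)"
  proof (cases "monom_deg m = d")
    case True
    then show ?thesis using same_lead_mon_shift[of m n s b] mspan_step unfolding same_lead_def by auto
  next
    case False
    with mspan_step have "int (monom_deg m) \<le> int d - 1" "Poly_Mapping.keys m \<subseteq> {1..n}" by auto
    then show ?thesis
      by (intro Pol_diff Pol_scale Pol_affine Pol_mon)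
  qed
  from Pol_add[OF mspan_step.IH[folded Pol_def] Pol_scale[OF this, of c]] show ?case
    unfolding Pol_def[symmetric] by (simp add: algebra_simps)
qed (auto intro: mspan_zero)

lemma Pol_permute:
  assumes "Pol n d F" "\<pi> permutes {1..n}"
  shows "Pol n d (\<lambda>x. F (\<lambda>i. x (\<pi> i)))"
  using assms(1) unfolding Pol_def
proof (rule mspan_lift)
  fix m assume m: "m \<in> {m. Poly_Mapping.keys m \<subseteq> {1..n} \<and> int (monom_deg m) \<le> d}"
  have "Pol n (\<Sum>i\<in>Poly_Mapping.keys m. int (Poly_Mapping.lookup m i) * 1)
      (\<lambda>x. \<Prod>i\<in>Poly_Mapping.keys m. x (\<pi> i) ^ Poly_Mapping.lookup m i)"
    using m permutes_in_image[OF assms(2)] by (intro Pol_prod Pol_power Pol_Var) auto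
  then show "mspan {m. Poly_Mapping.keys m \<subseteq> {1..n} \<and> int (monom_deg m) \<le> d} (\<lambda>x. mval m (\<lambda>i. x (\<pi> i)))"
    unfolding Pol_def[symmetric] mval_def using m by (auto simp: monom_deg_def intro: Pol_mono)
qed

lemma Pol_line:
  fixes F :: "(nat \<Rightarrow> 'k::field_char_0) \<Rightarrow> 'k"
  assumes "Pol n d F"
  obtains P where "\<And>s. F (\<lambda>i. x i + s * (y i - x i)) = poly P s"
proof -
  have "\<exists>P. \<forall>s. F (\<lambda>i. x i + s * (y i - x i)) = poly P s"
    using assms unfolding Pol_def
  proof induction
    case mspan_zero
    show ?case by (intro exI[of _ 0]) auto
  next
    case (mspan_step F m c)
    then obtain P where P: "\<And>s. F (\<lambda>i. x i + s * (y i - x i)) = poly P s" by blast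
    show ?case
      by (intro exI[of _ "P + Polynomial.smult c (\<Prod>i\<in>Poly_Mapping.keys m. [:x i, y i - x i:] ^ Poly_Mapping.lookup m i)"])
        (simp add: P mval_def poly_prod poly_power)
  qed
  with that show ?thesis by blast
qed

text \<open>The complement of the zeros of G is Zariski dense: on the line from x to the point y
  with G y nonzero, F and G become univariate polynomials with product zero, and the second one is
  not zero.\<close>

lemma Pol_density:
  fixes F G :: "(nat \<Rightarrow> 'k::field_char_0) \<Rightarrow> 'k"
  assumes "Pol n d F" "Pol n e G" "\<And>x. G x \<noteq> 0 \<Longrightarrow> F x = 0" "G y \<noteq> 0"
  shows "F x = 0"
proof -
  obtain P where P: "\<And>s. F (\<lambda>i. x i + s * (y i - x i)) = poly P s"
    using Pol_line[OF assms(1)] by blast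
  obtain Q where Q: "\<And>s. G (\<lambda>i. x i + s * (y i - x i)) = poly Q s"
    using Pol_line[OF assms(2)] by blast
  have "poly (P * Q) s = 0" for s
    using assms(3)[of "\<lambda>i. x i + s * (y i - x i)"] P[of s] Q[of s] by auto
  then have "P * Q = 0" using poly_all_0_iff_0 by blast
  moreover have "Q \<noteq> 0" using Q[of 1] assms(4) by auto
  ultimately have "P = 0" by simp
  with P[of 0] show ?thesis by simp
qed

section \<open>Division by linear factors with control of the degree\<close>

lemma Pol_difference_quotient:
  fixes F :: "(nat \<Rightarrow> 'k::comm_ring_1) \<Rightarrow> 'k"
  assumes "Pol n d F" and ij: "i \<in> {1..n}" "j \<in> {1..n}" "i \<noteq> j"
  shows "\<exists>G. Pol n (d - 1) G \<and> (\<forall>x. F x - F (x(i := x j)) = (x i - x j) * G x)"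
  using assms(1) unfolding Pol_def
proof induction
  case mspan_zero
  show ?case by (intro exI[of _ "\<lambda>_. 0"]) (auto intro: mspan.mspan_zero)
next
  case (mspan_step F m c)
  then obtain G where G: "Pol n (d - 1) G"
    "\<And>x. F x - F (x(i := x j)) = (x i - x j) * G x" unfolding Pol_def by blast
  let ?k = "Poly_Mapping.lookup m i" and ?A = "Poly_Mapping.keys m - {i}"
  let ?r = "\<lambda>x. \<Prod>l\<in>?A. x l ^ Poly_Mapping.lookup m l"
  \<comment> \<open>The cofactor of x_i - x_j in x_i^k - x_j^k; the remaining variables
    \<open>?r\<close> are not touched by the substitution.\<close>
  let ?q = "\<lambda>x. \<Sum>l<?k. x j ^ (?k - Suc l) * x i ^ l"
  have mval: "mval m x = x i ^ ?k * ?r x" for x :: "nat \<Rightarrow> 'k"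
    by (subst mval_superset[of "insert i ?A"]) (auto simp del: insert_Diff_single)
  have r_eq: "?r (x(i := x j)) = ?r x" for x :: "nat \<Rightarrow> 'k" by (rule prod.cong) auto
  then have eq: "mval m x - mval m (x(i := x j)) = (x i - x j) * (?q x * ?r x)" for x :: "nat \<Rightarrow> 'k"
  proof -
    have "mval m x - mval m (x(i := x j)) = (x i ^ ?k - x j ^ ?k) * ?r x"
      unfolding mval r_eq by (simp add: left_diff_distrib)
    then show ?thesis unfolding power_diff_sumr2 by (simp only: mult.assoc)
  qed
  have deg: "monom_deg m = ?k + (\<Sum>l\<in>?A. Poly_Mapping.lookup m l)"
    by (subst monom_deg_superset[of "insert i ?A"]) (auto simp del: insert_Diff_single)
  have r: "Pol n (\<Sum>l\<in>?A. int (Poly_Mapping.lookup m l) * 1) ?r"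
    using mspan_step by (intro Pol_prod Pol_power Pol_Var) auto
  have q: "Pol n (int ?k - 1) ?q"
  proof (rule Pol_sum)
    fix l assume "l \<in> {..<?k}"
    then have "int (?k - Suc l) * 1 + int l * 1 \<le> int ?k - 1" by auto
    then show "Pol n (int ?k - 1) (\<lambda>x. x j ^ (?k - Suc l) * x i ^ l)"
      using ij by (intro Pol_mult'[OF Pol_power[OF Pol_Var] Pol_power[OF Pol_Var]]) auto
  qed
  have "Pol n (d - 1) (\<lambda>x. ?q x * ?r x)"
    using deg mspan_step.hyps by (intro Pol_mult'[OF q r]) auto
  then have "Pol n (d - 1) (\<lambda>x. G x + c * (?q x * ?r x))"
    using G by (intro Pol_add Pol_scale) auto
  moreover have "(F x + c * mval m x) - (F (x(i := x j)) + c * mval m (x(i := x j)))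
      = (x i - x j) * (G x + c * (?q x * ?r x))" for x
  proof -
    have "(F x + c * mval m x) - (F (x(i := x j)) + c * mval m (x(i := x j)))
        = (F x - F (x(i := x j))) + c * (mval m x - mval m (x(i := x j)))"
      by (simp add: algebra_simps)
    then show ?thesis unfolding G(2) eq by (simp add: distrib_left mult.left_commute)
  qed
  ultimately show ?case unfolding Pol_def by blast
qed

lemma Pol_divide_linear:
  fixes F :: "(nat \<Rightarrow> 'k::comm_ring_1) \<Rightarrow> 'k"
  assumes "Pol n d F" "i \<in> {1..n}" "j \<in> {1..n}" "i \<noteq> j"
    and "\<And>x. x i = x j \<Longrightarrow> F x = 0"
  obtains G where "Pol n (d - 1) G" "\<And>x. F x = (x i - x j) * G x"
proof -
  from Pol_difference_quotient[OF assms(1-4)] obtain G where G: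
    "Pol n (d - 1) G" "\<And>x. F x - F (x(i := x j)) = (x i - x j) * G x" by blast
  have "F (x(i := x j)) = 0" for x using assms(4) by (intro assms(5)) auto
  with G show ?thesis using that[of G] by auto
qed

lemma Pol_set_equal:
  fixes F :: "(nat \<Rightarrow> 'k::comm_ring_1) \<Rightarrow> 'k"
  assumes "Pol n d F" "i \<in> {1..n}" "j \<in> {1..n}"
  shows "Pol n d (\<lambda>x. F (x(i := x j)))"
proof (cases "i = j")
  case False
  from Pol_difference_quotient[OF assms(1-3) this] obtain G where G:
    "Pol n (d - 1) G" "\<And>x. F x - F (x(i := x j)) = (x i - x j) * G x" by blast
  have "Pol n d (\<lambda>x. F x - (x i - x j) * G x)"
    using G(1) assms by (intro Pol_diff assms(1) Pol_mult'[of n 1 _ "d - 1"] Pol_Var) auto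
  then show ?thesis by (simp flip: G(2))
qed (use assms in auto)

text \<open>The factors are split off one at a time. A new factor divides the quotient reached so
  far, because the product of the earlier factors is not identically zero on the hyperplane x_k =
  x_l and density applies there.\<close>

lemma Pol_divide_vandermonde:
  fixes F :: "(nat \<Rightarrow> 'k::field_char_0) \<Rightarrow> 'k"
  assumes "finite T" "T \<subseteq> {(i, j). 1 \<le> i \<and> i < j \<and> j \<le> n}" "Pol n d F"
    and "\<And>i j x. (i, j) \<in> T \<Longrightarrow> x i = x j \<Longrightarrow> F x = 0"
  shows "\<exists>G. Pol n (d - int (card T)) G \<and> (\<forall>x. F x = (\<Prod>(i,j)\<in>T. x i - x j) * G x)"
  using assms
proof (induction T rule: finite_induct)
  case (insert t T)
  obtain k l where t: "t = (k, l)" by (cases t)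
  from insert t have kl: "1 \<le> k" "k < l" "l \<le> n" by auto
  from insert obtain G where G: "Pol n (d - int (card T)) G"
    "\<And>x. F x = (\<Prod>(i,j)\<in>T. x i - x j) * G x" by auto
  let ?V = "\<lambda>x. \<Prod>(i,j)\<in>T. x i - (x j :: 'k)"
  have V: "Pol n (\<Sum>t\<in>T. 1) ?V"
    using insert.prems(1) insert.hyps unfolding case_prod_beta
    by (intro Pol_prod Pol_diff Pol_Var) auto
  have zero: "G (x(k := x l)) = 0" for x
  proof (rule Pol_density[of n "d - int (card T)" "\<lambda>x. G (x(k := x l))" _ "\<lambda>x. ?V (x(k := x l))"])
    show "Pol n (d - int (card T)) (\<lambda>x. G (x(k := x l)))"
      using G(1) kl by (intro Pol_set_equal) auto
    show "Pol n (\<Sum>t\<in>T. 1) (\<lambda>x. ?V (x(k := x l)))"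
      using kl by (intro Pol_set_equal[OF V]) auto
    fix x :: "nat \<Rightarrow> 'k" assume "?V (x(k := x l)) \<noteq> 0"
    moreover have "F (x(k := x l)) = 0"
      using kl by (intro insert.prems(3)[of k l]) (auto simp: t)
    ultimately show "G (x(k := x l)) = 0" using G(2)[of "x(k := x l)"] by auto
  next
    \<comment> \<open>After the update only the coordinates k and l agree, and the pair (k, l) is
      not in T.\<close>
    let ?y = "of_nat :: nat \<Rightarrow> 'k"
    have "((?y(k := ?y l)) i - (?y(k := ?y l)) j \<noteq> 0)" if "(i, j) \<in> T" for i j
    proof -
      have "(i, j) \<noteq> (k, l)" "i < j" using that insert t by auto
      then show ?thesis using kl by (auto split: if_splits)
    qed
    then show "?V (?y(k := ?y l)) \<noteq> 0"
      using insert.hyps by (auto simp: prod_zero_iff)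
  qed
  have "G x = 0" if "x k = x l" for x
  proof -
    have "x(k := x l) = x" using that by auto
    with zero[of x] show ?thesis by simp
  qed
  with G(1) kl obtain G' where G': "Pol n (d - int (card T) - 1) G'" "\<And>x. G x = (x k - x l) * G' x"
    using Pol_divide_linear[of n _ G k l] by auto
  have "F x = (\<Prod>(i,j)\<in>insert t T. x i - x j) * G' x" for x
    unfolding G(2) G'(2) using insert.hyps t by simp
  with G'(1) show ?case using insert.hyps by (intro exI[of _ G']) (auto simp: algebra_simps)
qed auto

text \<open>Unlike a bound on the degree, this keeps track of the monomials that occur, as needed
  for spans with excluded monomials: those of G arise from M by removing one x_i.\<close>

lemma mspan_split_var:
  fixes F :: "(nat \<Rightarrow> 'k::comm_ring_1) \<Rightarrow> 'k"
  assumes "mspan M F"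
  obtains F0 G where "mspan {m \<in> M. Poly_Mapping.lookup m i = 0} F0"
    "mspan {m. m + Poly_Mapping.single i 1 \<in> M} G" "\<And>x. F x = F0 x + x i * G x"
    "\<And>x. F (x(i := 0)) = F0 x"
proof -
  have "\<exists>F0 G. mspan {m \<in> M. Poly_Mapping.lookup m i = 0} F0 \<and>
    mspan {m. m + Poly_Mapping.single i 1 \<in> M} G \<and> (\<forall>x. F x = F0 x + x i * G x)"
    using assms
  proof induction
    case mspan_zero
    show ?case by (intro exI[of _ "\<lambda>_. 0"]) (auto intro: mspan.mspan_zero)
  next
    case (mspan_step F m c)
    then obtain F0 G where FG: "mspan {m \<in> M. Poly_Mapping.lookup m i = 0} F0"
      "mspan {m. m + Poly_Mapping.single i 1 \<in> M} G" "\<And>x. F x = F0 x + x i * G x" by blast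
    show ?case
    proof (cases "Poly_Mapping.lookup m i = 0")
      case True
      then have "mspan {m \<in> M. Poly_Mapping.lookup m i = 0} (\<lambda>x. F0 x + c * mval m x)"
        using mspan_step FG by (intro mspan.mspan_step) auto
      with FG show ?thesis
        by (intro exI[of _ "\<lambda>x. F0 x + c * mval m x"] exI[of _ G]) auto
    next
      case False
      define m' where "m' = m - Poly_Mapping.single i 1"
      have m': "m' + Poly_Mapping.single i 1 = m"
        unfolding m'_def using False
        by (intro poly_mapping_eqI) (auto simp: lookup_add lookup_minus lookup_single when_def)
      have "mspan {m. m + Poly_Mapping.single i 1 \<in> M} (\<lambda>x. G x + c * mval m' x)"
        using mspan_step FG m' by (intro mspan.mspan_step) auto
      moreover have "mval m x = x i * mval m' x" for x :: "nat \<Rightarrow> 'k"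
        by (simp flip: m' add: mval_add mval_single)
      ultimately show ?thesis using FG
        by (intro exI[of _ F0] exI[of _ "\<lambda>x. G x + c * mval m' x"]) (auto simp: algebra_simps)
    qed
  qed
  then obtain F0 G where FG: "mspan {m \<in> M. Poly_Mapping.lookup m i = 0} F0"
    "mspan {m. m + Poly_Mapping.single i 1 \<in> M} G" "\<And>x. F x = F0 x + x i * G x" by blast
  have "F (x(i := 0)) = F0 x" for x
  proof -
    have "F0 (x(i := 0)) = F0 x"
      by (rule mspan_cong[OF FG(1)]) (auto simp: in_keys_iff)
    with FG(3)[of "x(i := 0)"] show ?thesis by simp
  qed
  with FG that show ?thesis by blast
qed

lemma mspan_divide_vars:
  fixes F :: "(nat \<Rightarrow> 'k::field_char_0) \<Rightarrow> 'k"
  assumes "finite T" "T \<subseteq> {1..n}" "mspan M F"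
    and M: "\<And>m. m \<in> M \<Longrightarrow> Poly_Mapping.keys m \<subseteq> {1..n} \<and> int (monom_deg m) \<le> d"
    and "\<And>i x. i \<in> T \<Longrightarrow> x i = 0 \<Longrightarrow> F x = 0"
  shows "\<exists>G. mspan {m. m + (\<Sum>i\<in>T. Poly_Mapping.single i 1) \<in> M} G \<and> (\<forall>x. F x = (\<Prod>i\<in>T. x i) * G x)"
  using assms
proof (induction T rule: finite_induct)
  case (insert k T)
  let ?M = "{m. m + (\<Sum>i\<in>T. Poly_Mapping.single i 1) \<in> M}"
  have "\<exists>G. mspan ?M G \<and> (\<forall>x. F x = (\<Prod>i\<in>T. x i) * G x)"
    by (rule insert.IH) (use insert.prems in blast)+
  then obtain G where G: "mspan ?M G" "\<And>x. F x = (\<Prod>i\<in>T. x i) * G x" by blast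
  have M': "Poly_Mapping.keys m \<subseteq> {1..n} \<and> int (monom_deg m) \<le> d" if "m \<in> ?M" for m
  proof -
    have "Poly_Mapping.keys m \<subseteq> Poly_Mapping.keys (m + (\<Sum>i\<in>T. Poly_Mapping.single i 1))"
      by (auto simp: in_keys_iff lookup_add)
    then show ?thesis using insert.prems(3)[of "m + (\<Sum>i\<in>T. Poly_Mapping.single i 1)"] that by auto
  qed
  obtain G0 G1 where G01: "mspan {m \<in> ?M. Poly_Mapping.lookup m k = 0} G0"
    "mspan {m. m + Poly_Mapping.single k 1 \<in> ?M} G1" "\<And>x. G x = G0 x + x k * G1 x"
    "\<And>x. G (x(k := 0)) = G0 x"
    by (rule mspan_split_var[OF G(1), of k]) blast
  have "G0 x = 0" for x
  proof (rule Pol_density[of n d G0 "\<Sum>i\<in>T. 1" "\<lambda>x. \<Prod>i\<in>T. x i" "\<lambda>_. 1"])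
    show "Pol n d G0" unfolding Pol_def by (rule mspan_mono[OF G01(1)]) (use M' in auto)
    show "Pol n (\<Sum>i\<in>T. 1) (\<lambda>x. \<Prod>i\<in>T. x i)"
      using insert by (intro Pol_prod Pol_Var) auto
    fix x :: "nat \<Rightarrow> 'k" assume *: "(\<Prod>i\<in>T. x i) \<noteq> 0"
    have "(\<Prod>i\<in>T. (x(k := 0)) i) = (\<Prod>i\<in>T. x i)"
      using insert.hyps by (intro prod.cong) auto
    moreover have "F (x(k := 0)) = 0" by (rule insert.prems(4)[of k]) auto
    ultimately show "G0 x = 0" using * G(2)[of "x(k := 0)"] by (simp add: G01(4))
  next
    show "(\<Prod>i\<in>T. 1) \<noteq> (0::'k)" by simp
  qed
  then have "F x = (\<Prod>i\<in>insert k T. x i) * G1 x" for x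
    using G(2)[of x] G01(3)[of x] insert.hyps by simp
  moreover have "{m. m + Poly_Mapping.single k 1 \<in> ?M} =
      {m. m + (\<Sum>i\<in>insert k T. Poly_Mapping.single i 1) \<in> M}"
    using insert.hyps by (simp add: add_ac)
  ultimately show ?case using G01(2) by auto
qed auto

section \<open>Interpolation\<close>

declare One_nat_def [simp del]

text \<open>Plain \<open>inv\<close> is the group inverse of HOL-Algebra here.\<close>

abbreviation pinv :: "(nat \<Rightarrow> nat) \<Rightarrow> nat \<Rightarrow> nat" where
  "pinv \<equiv> inv_into UNIV"

definition Winv :: "nat \<Rightarrow> ((nat \<Rightarrow> 'k) \<Rightarrow> 'k::comm_ring_1) \<Rightarrow> bool" where
  "Winv n F \<longleftrightarrow> (\<forall>\<pi>\<in>W n. \<forall>x. F (\<lambda>i. x (\<pi> i)) = F x)"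

text \<open>For n \<ge> 1 this is the orbit of the index n under W, so that the product of these
  variables is invariant.\<close>

definition near :: "nat \<Rightarrow> nat set" where
  "near n = {a \<in> {1..n}. even (n + a)}"

definition ind :: "nat set \<Rightarrow> nat \<Rightarrow> nat" where
  "ind K i = of_bool (i \<in> K)"

lemma finite_near [simp]: "finite (near n)"
  by (simp add: near_def)

lemma W_permutes: "\<pi> \<in> W n \<Longrightarrow> \<pi> permutes {1..n}"
  by (simp add: W_def)

lemma W_parity: "\<pi> \<in> W n \<Longrightarrow> even (\<pi> i) \<longleftrightarrow> even i"
proof (cases "i \<in> {1..n}")
  case True
  moreover assume "\<pi> \<in> W n"
  ultimately have "\<pi> i mod 2 = i mod 2" by (simp add: W_def)
  then show ?thesis by presburger
next
  case False
  moreover assume "\<pi> \<in> W n"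
  ultimately show ?thesis by (metis W_permutes permutes_not_in)
qed

lemma W_I: "\<pi> permutes {1..n} \<Longrightarrow> (\<And>i. even (\<pi> i) \<longleftrightarrow> even i) \<Longrightarrow> \<pi> \<in> W n"
  by (simp add: W_def mod2_eq_if)

lemma W_mono:
  assumes "\<pi> \<in> W n" "n \<le> n'"
  shows "\<pi> \<in> W n'"
proof (rule W_I)
  show "\<pi> permutes {1..n'}"
    by (rule permutes_subset[OF W_permutes[OF assms(1)]]) (use assms in auto)
qed (rule W_parity[OF assms(1)])

lemma W_comp: "\<sigma> \<in> W n \<Longrightarrow> \<pi> \<in> W n \<Longrightarrow> \<sigma> \<circ> \<pi> \<in> W n"
  using permutes_compose[OF W_permutes W_permutes] W_parity[of \<sigma> n] W_parity[of \<pi> n]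
  by (intro W_I) auto

lemma W_inv: 
  assumes "\<sigma> \<in> W n"
  shows "pinv \<sigma> \<in> W n"
proof (rule W_I)
  show "pinv \<sigma> permutes {1..n}" by (rule permutes_inv[OF W_permutes[OF assms]])
  show "even (pinv \<sigma> i) \<longleftrightarrow> even i" for i
    using W_parity[OF assms, of "pinv \<sigma> i"] permutes_inverses[OF W_permutes[OF assms]] by simp
qed

lemma id_in_W: "id \<in> W n"
  by (simp add: W_def permutes_id)

lemma transpose_in_W:
  assumes "a \<in> {1..n}" "b \<in> {1..n}" "even (a + b)"
  shows "Transposition.transpose a b \<in> W n"
proof -
  have "a mod 2 = b mod 2" using assms(3) by presburger
  then show ?thesis
    using permutes_swap_id[OF assms(1,2)] by (auto simp: W_def Transposition.transpose_def)
qed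

lemma finite_W [simp]: "finite (W n)"
  by (rule finite_subset[OF _ finite_permutations[of "{1..n}"]]) (auto simp: W_def)

lemma bij_W_comp:
  assumes "\<sigma> \<in> W n"
  shows "bij_betw (\<lambda>\<pi>. \<sigma> \<circ> \<pi>) (W n) (W n)"
  using permutes_inverses[OF W_permutes[OF assms]]
  by (intro bij_betwI[where g = "\<lambda>\<pi>. pinv \<sigma> \<circ> \<pi>"])
    (auto simp: fun_eq_iff intro: W_comp assms W_inv)

lemma Lam_antimono: "l \<in> Lam n \<Longrightarrow> 1 \<le> i \<Longrightarrow> i \<le> j \<Longrightarrow> l j \<le> l i"
  by (cases "j \<le> n") (auto simp: Lam_def)

lemma Lam_outside: "l \<in> Lam n \<Longrightarrow> i \<notin> {1..n} \<Longrightarrow> l i = 0"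
  by (simp add: Lam_def)

lemma zero_in_Lam [simp]: "(\<lambda>_. 0) \<in> Lam n"
  by (simp add: Lam_def)

lemma Lam_add: "l \<in> Lam n \<Longrightarrow> k \<in> Lam n \<Longrightarrow> (\<lambda>i. l i + k i) \<in> Lam n"
  by (auto simp: Lam_def intro: add_mono)

lemma ind_in_Lam: "m \<le> n \<Longrightarrow> ind {1..m} \<in> Lam n"
  by (auto simp: Lam_def ind_def)

lemma Lam_Suc_iff: "l \<in> Lam n \<longleftrightarrow> l \<in> Lam (Suc n) \<and> l (Suc n) = 0"
proof
  assume "l \<in> Lam n"
  then show "l \<in> Lam (Suc n) \<and> l (Suc n) = 0"
    by (auto simp: Lam_def le_Suc_eq)
next
  assume "l \<in> Lam (Suc n) \<and> l (Suc n) = 0"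
  then show "l \<in> Lam n"
    unfolding Lam_def by (auto simp: le_Suc_eq dest: spec[of _ "Suc n"])
qed

lemma odd_size_add: "odd_size n (\<lambda>i. l i + k i) = odd_size n l + odd_size n k"
  by (simp add: odd_size_def sum.distrib)

lemma odd_size_zero [simp]: "odd_size n (\<lambda>_. 0) = 0"
  by (simp add: odd_size_def)

lemma odd_size_Suc: "l (Suc n) = 0 \<Longrightarrow> odd_size (Suc n) l = odd_size n l"
  unfolding odd_size_def by (rule sum.mono_neutral_right) (auto simp: le_Suc_eq)

lemma finite_Lam_le: "finite {l \<in> Lam n. odd_size n l \<le> N}"
proof (rule finite_subset)
  show "finite {l. \<forall>i. (i \<in> {1..n} \<longrightarrow> l i \<in> {..N}) \<and> (i \<notin> {1..n} \<longrightarrow> l i = 0)}"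
    by (rule finite_set_of_finite_funs) simp_all
  show "{l \<in> Lam n. odd_size n l \<le> N} \<subseteq> {l. \<forall>i. (i \<in> {1..n} \<longrightarrow> l i \<in> {..N}) \<and> (i \<notin> {1..n} \<longrightarrow> l i = 0)}"
  proof
    fix l assume "l \<in> {l \<in> Lam n. odd_size n l \<le> N}"
    then have l: "l \<in> Lam n" "odd_size n l \<le> N" by auto
    have "l i \<le> N" if i: "i \<in> {1..n}" for i
    proof -
      have "l i \<le> l 1" using i by (intro Lam_antimono[OF l(1)]) auto
      also have "l 1 \<le> odd_size n l"
        unfolding odd_size_def using i by (intro member_le_sum[of 1 _ l]) auto
      finally show ?thesis using l by simp
    qed
    then show "l \<in> {l. \<forall>i. (i \<in> {1..n} \<longrightarrow> l i \<in> {..N}) \<and> (i \<notin> {1..n} \<longrightarrow> l i = 0)}"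
      using Lam_outside[OF l(1)] by blast
  qed
qed

lemma lookup_alt_exp:
  "Poly_Mapping.lookup (alt_exp n l) i =
    (if i \<in> {1..n} then nat (\<Sum>j\<in>{i..n}. (- 1) ^ (j - i) * int (l j)) else 0)"
proof -
  have "Poly_Mapping.lookup (alt_exp n l) i =
      (\<Sum>m\<in>{1..n}. if m = i then nat (\<Sum>j\<in>{m..n}. (- 1) ^ (j - m) * int (l j)) else 0)"
    unfolding alt_exp_def lookup_sum lookup_single when_def ..
  then show ?thesis by (simp only: sum.delta finite_atLeastAtMost)
qed

lemma keys_alt_exp: "Poly_Mapping.keys (alt_exp n l) \<subseteq> {1..n}"
  by (auto simp: in_keys_iff lookup_alt_exp split: if_splits)

text \<open>Since [l]_i = l_i - [l]_(i+1), downward induction from n + 1 gives 0 \<le> [l]_i \<le>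
  l_i, so nothing is truncated. This recursion replaces the alternating sums from here on; for i = n
  the second summand is 0.\<close>

lemma alt_exp_sum:
  assumes l: "l \<in> Lam n" and i: "i \<in> {1..n}"
  shows "Poly_Mapping.lookup (alt_exp n l) i + Poly_Mapping.lookup (alt_exp n l) (Suc i) = l i"
proof -
  define s where "s i = (\<Sum>j\<in>{i..n}. (- 1) ^ (j - i) * int (l j))" for i
  have rec: "s i = int (l i) - s (Suc i)" if "i \<le> n" for i
  proof -
    have "s i = int (l i) + (\<Sum>j\<in>{Suc i..n}. (- 1) ^ (j - i) * int (l j))"
      unfolding s_def sum.atLeast_Suc_atMost[OF that] by simp
    also have "(\<Sum>j\<in>{Suc i..n}. (- 1) ^ (j - i) * int (l j)) = (\<Sum>j\<in>{Suc i..n}. - ((- 1) ^ (j - Suc i) * int (l j)))"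
    proof (rule sum.cong)
      fix j assume "j \<in> {Suc i..n}"
      then have "j - i = Suc (j - Suc i)" by auto
      then show "(- 1) ^ (j - i) * int (l j) = - ((- 1) ^ (j - Suc i) * int (l j))" by simp
    qed auto
    finally show ?thesis by (simp add: s_def sum_negf)
  qed
  have bnd': "k \<le> n \<Longrightarrow> 0 \<le> s (Suc n - k) \<and> s (Suc n - k) \<le> int (l (Suc n - k))" for k
  proof (induction k)
    case 0
    then show ?case by (simp add: s_def)
  next
    case (Suc k)
    then have eq: "Suc (n - k) = Suc n - k" and "n - k \<le> n" "1 \<le> n - k" by auto
    have "l (Suc n - k) \<le> l (n - k)" by (rule Lam_antimono[OF l]) (use Suc in auto)
    with Suc rec[OF \<open>n - k \<le> n\<close>] show ?case unfolding eq by simp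
  qed
  have bnd: "0 \<le> s i \<and> s i \<le> int (l i)" if "i \<ge> 1" "i \<le> Suc n" for i
  proof -
    have "Suc n - (Suc n - i) = i" "Suc n - i \<le> n" using that by auto
    with bnd'[of "Suc n - i"] show ?thesis by simp
  qed
  have lk: "Poly_Mapping.lookup (alt_exp n l) i = nat (s i)" if "1 \<le> i" for i
    using that by (auto simp: lookup_alt_exp s_def)
  show ?thesis
    using bnd[of i] bnd[of "Suc i"] rec[of i] i by (simp add: lk nat_add_distrib[symmetric])
qed

lemma alt_exp_unique:
  assumes "l \<in> Lam n" "Poly_Mapping.keys e \<subseteq> {1..n}"
    and "\<And>i. i \<in> {1..n} \<Longrightarrow> Poly_Mapping.lookup e i + Poly_Mapping.lookup e (Suc i) = l i"
  shows "alt_exp n l = e"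
proof (rule poly_mapping_eqI)
  fix i
  have zero: "Poly_Mapping.lookup e i = 0" if "i \<notin> {1..n}" for i
    using assms(2) that by (auto simp: in_keys_iff)
  show "Poly_Mapping.lookup (alt_exp n l) i = Poly_Mapping.lookup e i"
  proof (cases "i \<in> {1..n}")
    case True
    then have "i \<le> Suc n" "i \<ge> 1" by auto
    then show ?thesis
    proof (induction rule: inc_induct)
      case base
      then show ?case by (simp add: lookup_alt_exp zero)
    next
      case (step i)
      then show ?case using assms(3)[of i] alt_exp_sum[OF assms(1), of i] by simp
    qed
  qed (auto simp: zero lookup_alt_exp)
qed

lemma inj_alt_exp: "inj_on (alt_exp n) (Lam n)"
proof (rule inj_onI)
  fix l k assume *: "l \<in> Lam n" "k \<in> Lam n" "alt_exp n l = alt_exp n k"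
  have "l i = k i" for i
    using alt_exp_sum[of l n i] alt_exp_sum[of k n i] * Lam_outside[of l n i] Lam_outside[of k n i]
    by (cases "i \<in> {1..n}") auto
  then show "l = k" by auto
qed

text \<open>The sums l_i = [l]_i + [l]_(i+1) over odd i use every exponent once; for odd n the
  surplus exponent at n + 1 is 0.\<close>

lemma monom_deg_alt_exp:
  assumes "l \<in> Lam n"
  shows "monom_deg (alt_exp n l) = odd_size n l"
proof -
  let ?e = "Poly_Mapping.lookup (alt_exp n l)"
  have pair: "(\<Sum>i | i \<in> {1..n} \<and> odd i. e i + e (Suc i)) =
      (\<Sum>i\<in>{1..n}. e i) + (if odd n then e (Suc n) else 0)" for e :: "nat \<Rightarrow> nat" and n
  proof (induction n)
    case (Suc n)
    show ?case
    proof (cases "odd (Suc n)")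
      case True
      then have "{i. i \<in> {1..Suc n} \<and> odd i} = insert (Suc n) {i. i \<in> {1..n} \<and> odd i}"
        by (auto simp: le_Suc_eq)
      with Suc True show ?thesis by simp
    next
      case False
      then have "{i. i \<in> {1..Suc n} \<and> odd i} = {i. i \<in> {1..n} \<and> odd i}"
        by (auto simp: le_Suc_eq)
      with Suc False show ?thesis by simp
    qed
  qed auto
  have "odd_size n l = (\<Sum>i | i \<in> {1..n} \<and> odd i. ?e i + ?e (Suc i))"
    unfolding odd_size_def by (rule sum.cong) (use alt_exp_sum[OF assms] in auto)
  also have "\<dots> = (\<Sum>i\<in>{1..n}. ?e i)"
    unfolding pair by (simp add: lookup_alt_exp)
  finally show ?thesis
    by (simp add: monom_deg_superset[OF _ keys_alt_exp])
qed

lemma alt_exp_Suc: "l \<in> Lam n \<Longrightarrow> alt_exp (Suc n) l = alt_exp n l"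
proof (rule alt_exp_unique)
  assume l: "l \<in> Lam n"
  fix i assume "i \<in> {1..Suc n}"
  then show "Poly_Mapping.lookup (alt_exp n l) i + Poly_Mapping.lookup (alt_exp n l) (Suc i) = l i"
    using alt_exp_sum[OF l, of i] Lam_outside[OF l, of i]
    by (cases "i = Suc n") (auto simp: lookup_alt_exp)
next
  assume "l \<in> Lam n"
  then show "l \<in> Lam (Suc n)" using Lam_Suc_iff by blast
  have "{1..n} \<subseteq> {1..Suc n}" by auto
  with keys_alt_exp[of n l] show "Poly_Mapping.keys (alt_exp n l) \<subseteq> {1..Suc n}" by (rule order.trans)
qed

definition near_mon :: "nat \<Rightarrow> (nat \<Rightarrow>\<^sub>0 nat)" where
  "near_mon n = (\<Sum>i\<in>near n. Poly_Mapping.single i 1)"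

lemma lookup_near_mon: "Poly_Mapping.lookup (near_mon n) i = of_bool (i \<in> near n)"
  by (simp add: near_mon_def lookup_sum lookup_single when_def sum.delta)

lemma near_Suc: "i \<in> {1..n} \<Longrightarrow> of_bool (i \<in> near n) + of_bool (Suc i \<in> near n) = (1::nat)"
  by (cases "i = n") (auto simp: near_def)

text \<open>Adding a column of full length multiplies z^[l] by the product over
  \<open>near n\<close>; this is the counterpart, on exponents, of dividing a polynomial by that
  product.\<close>

lemma alt_exp_add_ones:
  assumes "l \<in> Lam n"
  shows "alt_exp n (\<lambda>i. l i + ind {1..n} i) = alt_exp n l + near_mon n"
proof (rule alt_exp_unique)
  show "(\<lambda>i. l i + ind {1..n} i) \<in> Lam n"
    using assms by (intro Lam_add ind_in_Lam) auto
  have "Poly_Mapping.keys (near_mon n) \<subseteq> {1..n}"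
    by (auto simp: in_keys_iff lookup_near_mon near_def)
  then show "Poly_Mapping.keys (alt_exp n l + near_mon n) \<subseteq> {1..n}"
    using Poly_Mapping.keys_add[of "alt_exp n l" "near_mon n"] keys_alt_exp[of n l] by blast
  fix i assume i: "i \<in> {1..n}"
  then show "Poly_Mapping.lookup (alt_exp n l + near_mon n) i +
      Poly_Mapping.lookup (alt_exp n l + near_mon n) (Suc i) = l i + ind {1..n} i"
    using alt_exp_sum[OF assms i] near_Suc[OF i] unfolding lookup_add lookup_near_mon ind_def
    by (simp add: i del: atLeastAtMost_iff)
qed

lemma monom_deg_near_mon: "monom_deg (near_mon n) = card (near n)"
proof -
  have "monom_deg (\<Sum>i\<in>A. Poly_Mapping.single i 1) = card A" if "finite A" for A :: "nat set"
    using that by (induction A rule: finite_induct) auto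
  then show ?thesis by (simp add: near_mon_def)
qed

lemma odd_size_ones: "odd_size n (ind {1..n}) = card (near n)"
proof -
  have "monom_deg (alt_exp n (\<lambda>i. 0 + ind {1..n} i)) = monom_deg (alt_exp n (\<lambda>_. 0)) + card (near n)"
    using alt_exp_add_ones[of "\<lambda>_. 0" n] by (simp add: monom_deg_near_mon)
  then show ?thesis
    using monom_deg_alt_exp[OF ind_in_Lam[OF order.refl[of n]]] monom_deg_alt_exp[OF zero_in_Lam[of n]] by simp
qed

text \<open>Otherwise r = -b/a would be a negative rational.\<close>

lemma nonneg_combination_nonzero:
  fixes r :: "'k::field_char_0"
  assumes "\<forall>q::rat. q < 0 \<longrightarrow> r \<noteq> of_rat q" "b \<ge> 1"
  shows "of_nat a * r + of_nat b \<noteq> 0"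
proof
  assume *: "of_nat a * r + of_nat b = 0"
  with assms(2) have a: "a \<noteq> 0" by (intro notI) auto
  have "r = of_rat (- (of_nat b / of_nat a))"
    using * a by (simp add: of_rat_minus of_rat_divide field_simps eq_neg_iff_add_eq_0)
  moreover have "- (of_nat b / of_nat a) < (0::rat)" using a assms(2) by simp
  ultimately show False using assms(1) by blast
qed

lemma Winv_permute: "Winv n F \<Longrightarrow> \<pi> \<in> W n \<Longrightarrow> F (\<lambda>i. x (\<pi> i)) = F x"
  by (simp add: Winv_def)

text \<open>For the tuples in \<open>S\<close>, the condition on the value at \<open>\<rho> + \<mu>\<close> is replaced by one on the
  coefficient of \<open>z\<^bsup>[\<mu>]\<^esup>\<close>, which yields both the interpolation property and the normalisation of
  the \<open>R\<^sub>\<lambda>\<close>. Setting \<open>z\<^sub>n = 0\<close> lowers \<open>n\<close>; a polynomial vanishing there is divisible by the product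
  of the \<open>z\<^sub>i\<close> with \<open>i \<equiv> n\<close> modulo 2, and the quotient has lower degree.\<close>

theorem unisolvent:
  fixes r :: "'k::field_char_0"
  assumes r: "\<forall>q::rat. q < 0 \<longrightarrow> r \<noteq> of_rat q"
  shows "S \<subseteq> {l \<in> Lam n. int (odd_size n l) = N} \<Longrightarrow>
    mspan {m. Poly_Mapping.keys m \<subseteq> {1..n} \<and> int (monom_deg m) \<le> N \<and> m \<notin> alt_exp n ` S} F \<Longrightarrow>
    Winv n F \<Longrightarrow>
    (\<And>u. u \<in> Lam n \<Longrightarrow> int (odd_size n u) \<le> N \<Longrightarrow> u \<notin> S \<Longrightarrow> F (rho_plus n r u) = 0) \<Longrightarrow>
    F x = 0"
proof (induction n arbitrary: N S F x)
  case 0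
  let ?M = "{m. Poly_Mapping.keys m \<subseteq> {1..0} \<and> int (monom_deg m) \<le> N \<and> m \<notin> alt_exp 0 ` S}"
  show ?case
  proof (cases "N < 0 \<or> (\<lambda>_. 0) \<in> S")
    case True
    have "?M = {}"
    proof (cases "N < 0")
      case False
      have "alt_exp 0 (\<lambda>_. 0) = 0" by (simp add: alt_exp_def)
      with False True show ?thesis by force
    qed auto
    then have "mspan {} F" using "0.prems"(2) by (simp only:)
    then show ?thesis by induction auto
  next
    case False
    then have "F (rho_plus 0 r (\<lambda>_. 0)) = 0"
      by (intro "0.prems"(4)) auto
    moreover have "F x = F (rho_plus 0 r (\<lambda>_. 0))"
      by (rule mspan_cong[OF "0.prems"(2)]) auto
    ultimately show ?thesis by simp
  qed
next
  case (Suc n)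
  note outer = Suc.IH
  show ?case using Suc.prems
  \<comment> \<open>The summand 1 separates N = 0 from the negative bounds, where F is zero by
    \<open>Pol_neg\<close>.\<close>
  proof (induction "nat (N + 1)" arbitrary: N S F x rule: less_induct)
    case less
    note S = less.prems(1) and PSF = less.prems(2) and inv = less.prems(3) and van = less.prems(4)
    let ?n = "Suc n"
    let ?M = "{m. Poly_Mapping.keys m \<subseteq> {1..?n} \<and> int (monom_deg m) \<le> N \<and> m \<notin> alt_exp ?n ` S}"
    have PolF: "Pol ?n N F" unfolding Pol_def by (rule mspan_mono[OF PSF]) auto
    show ?case
    proof (cases "N < 0")
      case True
      with PolF show ?thesis by (rule Pol_neg)
    next
      case N: False
      obtain F0 where F0: "mspan {m \<in> ?M. Poly_Mapping.lookup m ?n = 0} F0"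
        "\<And>x. F (x(?n := 0)) = F0 x"
        by (rule mspan_split_var[OF PSF, of ?n]) blast
      define S1 where "S1 = S \<inter> Lam n"
      let ?M1 = "{m. Poly_Mapping.keys m \<subseteq> {1..n} \<and> int (monom_deg m) \<le> N \<and> m \<notin> alt_exp n ` S1}"
      have S1: "S1 \<subseteq> {l \<in> Lam n. int (odd_size n l) = N}"
      proof
        fix l assume "l \<in> S1"
        then have "l \<in> S" and l: "l \<in> Lam n" by (auto simp: S1_def)
        then have "int (odd_size ?n l) = N" using S by auto
        moreover have "l ?n = 0" using l by (simp add: Lam_def)
        ultimately show "l \<in> {l \<in> Lam n. int (odd_size n l) = N}"
          using l odd_size_Suc[of l n] by simp
      qed
      have PS1: "mspan ?M1 F0"
      proof (rule mspan_mono[OF F0(1)], safe)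
        fix m i assume m: "Poly_Mapping.keys m \<subseteq> {1..?n}" "Poly_Mapping.lookup m ?n = 0"
          and "i \<in> Poly_Mapping.keys m"
        then have "i \<in> {1..?n}" "i \<noteq> ?n" by (auto simp only: in_keys_iff)
        then show "i \<in> {1..n}" by auto
      next
        fix l assume "alt_exp n l \<notin> alt_exp ?n ` S" "l \<in> S1"
        then show False unfolding S1_def by (metis IntD1 IntD2 alt_exp_Suc imageI)
      qed
      \<comment> \<open>The first n coordinates of rho for n + 1 variables exceed those for n
        variables by r, and the last one is 0. The factor 1 only fits the shape of
        \<open>mspan_affine_top\<close>.\<close>
      define F1 where "F1 x = F0 (\<lambda>i. 1 * x i + r)" for x
      have "F1 x = 0" for x
      proof (rule outer[OF S1, where F = F1])
        have ge: "int (monom_deg m) \<ge> N" if "m \<in> alt_exp n ` S1" for m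
          using S1 that by (auto simp: monom_deg_alt_exp)
        show "mspan ?M1 F1" unfolding F1_def by (rule mspan_affine_top[OF PS1 ge])
        show "Winv n F1"
          unfolding Winv_def
        proof safe
          fix \<pi> :: "nat \<Rightarrow> nat" and x :: "nat \<Rightarrow> 'k" assume \<pi>: "\<pi> \<in> W n"
          let ?y = "(\<lambda>i. x i + r)(?n := 0)"
          have "\<pi> ?n = ?n"
            by (rule permutes_not_in[OF W_permutes[OF \<pi>]]) simp
          then have "\<pi> i = ?n \<longleftrightarrow> i = ?n" for i
            using permutes_inj[OF W_permutes[OF \<pi>]] by (auto dest: injD[of \<pi> i ?n])
          then have "(\<lambda>i. ?y (\<pi> i)) = (\<lambda>i. x (\<pi> i) + r)(?n := 0)" by (auto simp: fun_eq_iff)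
          moreover have "F (\<lambda>i. ?y (\<pi> i)) = F ?y"
            by (rule Winv_permute[OF inv W_mono[OF \<pi>]]) auto
          ultimately show "F1 (\<lambda>i. x (\<pi> i)) = F1 x"
            unfolding F1_def F0(2)[symmetric] by simp
        qed
        fix u assume u: "u \<in> Lam n" "int (odd_size n u) \<le> N" "u \<notin> S1"
        have "F1 (rho_plus n r u) = F ((\<lambda>i. rho_plus n r u i + r)(?n := 0))"
          unfolding F1_def F0(2)[symmetric] by simp
        also have "\<dots> = F (rho_plus ?n r u)"
        proof (rule Pol_cong[OF PolF])
          fix i assume i: "i \<in> {1..?n}"
          show "((\<lambda>i. rho_plus n r u i + r)(?n := 0)) i = rho_plus ?n r u i"
          proof (cases "i = ?n")
            case True
            then show ?thesis using Lam_outside[OF u(1), of ?n] by (simp add: rho_plus_def rho_def)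
          next
            case False
            then have "?n - i = Suc (n - i)" using i by auto
            with False show ?thesis by (simp add: rho_plus_def rho_def algebra_simps)
          qed
        qed
        also have "\<dots> = 0"
        proof (rule van)
          show "u \<in> Lam ?n" using u(1) Lam_Suc_iff by blast
          have "u ?n = 0" using u(1) by (simp add: Lam_def)
          then show "int (odd_size ?n u) \<le> N" using u(2) odd_size_Suc[of u n] by simp
          show "u \<notin> S" using u by (auto simp: S1_def)
        qed
        finally show "F1 (rho_plus n r u) = 0" .
      qed
      from this[of "\<lambda>i. x i - r" for x] have "F0 x = 0" for x
        by (simp add: F1_def)
      then have zero: "F x = 0" if "x ?n = 0" for x
        using F0(2)[of x] that by (metis fun_upd_triv)
      let ?q = "card (near ?n)" and ?P = "\<lambda>x. \<Prod>i\<in>near ?n. x i :: 'k"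
      have n_near: "?n \<in> near ?n" by (simp add: near_def)
      then have q: "?q \<ge> 1" by (metis One_nat_def Suc_leI card_gt_0_iff empty_iff finite_near)
      have "\<exists>G. mspan {m. m + (\<Sum>i\<in>near ?n. Poly_Mapping.single i 1) \<in> ?M} G \<and> (\<forall>x. F x = ?P x * G x)"
      proof (rule mspan_divide_vars[OF _ _ PSF, of _ ?n N])
        fix i and x :: "nat \<Rightarrow> 'k" assume i: "i \<in> near ?n" "x i = 0"
        \<comment> \<open>Swapping i with the last index leads to the hyperplane that has already
          been treated.\<close>
        have "F (\<lambda>j. x (Transposition.transpose i ?n j)) = 0"
          using i by (intro zero) simp
        moreover have "Transposition.transpose i ?n \<in> W ?n"
          using i by (intro transpose_in_W) (auto simp: near_def)
        ultimately show "F x = 0" using Winv_permute[OF inv] by metis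
      qed (auto simp: near_def)
      then obtain G where G: "mspan {m. m + near_mon ?n \<in> ?M} G" "\<And>x. F x = ?P x * G x"
        unfolding near_mon_def by blast
      \<comment> \<open>The tuples that lie in S after a full column is added; removing the divisor
        from the excluded exponents leaves theirs.\<close>
      define S2 where "S2 = {l \<in> Lam ?n. (\<lambda>i. l i + ind {1..?n} i) \<in> S}"
      define N2 where "N2 = N - int ?q"
      let ?M2 = "{m. Poly_Mapping.keys m \<subseteq> {1..?n} \<and> int (monom_deg m) \<le> N2 \<and> m \<notin> alt_exp ?n ` S2}"
      have S2: "S2 \<subseteq> {l \<in> Lam ?n. int (odd_size ?n l) = N2}"
      proof
        fix l assume "l \<in> S2"
        then have "l \<in> Lam ?n" "int (odd_size ?n (\<lambda>i. l i + ind {1..?n} i)) = N"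
          using S by (auto simp: S2_def)
        then show "l \<in> {l \<in> Lam ?n. int (odd_size ?n l) = N2}"
          unfolding odd_size_add odd_size_ones by (simp add: N2_def)
      qed
      have PS2: "mspan ?M2 G"
      proof (rule mspan_mono[OF G(1)], safe)
        fix m i assume "Poly_Mapping.keys (m + near_mon ?n) \<subseteq> {1..?n}" "i \<in> Poly_Mapping.keys m"
        moreover have "Poly_Mapping.keys m \<subseteq> Poly_Mapping.keys (m + near_mon ?n)"
          by (auto simp: in_keys_iff lookup_add)
        ultimately show "i \<in> {1..?n}" by blast
      next
        fix m assume "int (monom_deg (m + near_mon ?n)) \<le> N"
        then show "int (monom_deg m) \<le> N2" by (simp add: N2_def monom_deg_near_mon)
      next
        fix l assume "alt_exp ?n l + near_mon ?n \<notin> alt_exp ?n ` S" "l \<in> S2"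
        then show False using alt_exp_add_ones[of l ?n] by (force simp: S2_def)
      qed
      have PolG: "Pol ?n N2 G" unfolding Pol_def by (rule mspan_mono[OF PS2]) auto
      have PolP: "Pol ?n (\<Sum>i\<in>near ?n. 1) ?P"
        by (intro Pol_prod Pol_Var) (auto simp: near_def)
      have invG: "G (\<lambda>i. x (\<pi> i)) = G x" if \<pi>: "\<pi> \<in> W ?n" for \<pi> x
      proof -
        have "G (\<lambda>i. x (\<pi> i)) - G x = 0"
        proof (rule Pol_density[of ?n N2 "\<lambda>x. G (\<lambda>i. x (\<pi> i)) - G x" _ ?P "\<lambda>_. 1"])
          show "Pol ?n N2 (\<lambda>x. G (\<lambda>i. x (\<pi> i)) - G x)"
            by (intro Pol_diff PolG Pol_permute[OF PolG W_permutes[OF \<pi>]])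
          fix x :: "nat \<Rightarrow> 'k" assume *: "?P x \<noteq> 0"
          have "bij_betw \<pi> (near ?n) (near ?n)"
          proof (rule bij_betw_imageI)
            show "inj_on \<pi> (near ?n)"
              using permutes_inj[OF W_permutes[OF \<pi>]] by (rule inj_on_subset) auto
            have "\<pi> ` near ?n \<subseteq> near ?n"
              using W_parity[OF \<pi>] permutes_in_image[OF W_permutes[OF \<pi>]]
              by (auto simp: near_def)
            then show "\<pi> ` near ?n = near ?n"
              using \<open>inj_on \<pi> (near ?n)\<close> by (intro endo_inj_surj) auto
          qed
          then have "?P (\<lambda>i. x (\<pi> i)) = ?P x"
            by (rule prod.reindex_bij_betw)
          then show "G (\<lambda>i. x (\<pi> i)) - G x = 0"
            using * Winv_permute[OF inv \<pi>, of x] unfolding G(2) by simp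
        qed (use PolP in auto)
        then show ?thesis by simp
      qed
      \<comment> \<open>Moving all coordinates by 1 makes the point of u for H the point of u plus a
        full column for G.\<close>
      define H where "H x = G (\<lambda>i. 1 * x i + 1)" for x
      have "H x = 0" for x
      proof (rule less.hyps[OF _ S2, where F = H])
        show "nat (N2 + 1) < nat (N + 1)" using N q by (simp add: N2_def)
        have ge: "int (monom_deg m) \<ge> N2" if "m \<in> alt_exp ?n ` S2" for m
          using S2 that by (auto simp: monom_deg_alt_exp)
        show "mspan ?M2 H" unfolding H_def by (rule mspan_affine_top[OF PS2 ge])
        show "Winv ?n H"
          unfolding Winv_def H_def using invG[of _ "\<lambda>i. 1 * _ i + 1"] by blast
        fix u assume u: "u \<in> Lam ?n" "int (odd_size ?n u) \<le> N2" "u \<notin> S2"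
        let ?v = "\<lambda>i. u i + ind {1..?n} i"
        have "?P (rho_plus ?n r ?v) * G (rho_plus ?n r ?v) = 0"
          unfolding G(2)[symmetric]
        proof (rule van)
          show "?v \<in> Lam ?n" by (rule Lam_add[OF u(1) ind_in_Lam[OF order.refl]])
          show "int (odd_size ?n ?v) \<le> N"
            unfolding odd_size_add odd_size_ones using u(2) by (simp add: N2_def)
          show "?v \<notin> S" using u by (auto simp: S2_def)
        qed
        moreover have "?P (rho_plus ?n r ?v) \<noteq> 0"
        proof -
          have "rho_plus ?n r ?v i \<noteq> 0" if "i \<in> near ?n" for i
            using nonneg_combination_nonzero[OF r, of "?v i" "?n - i"] that
            unfolding rho_plus_def rho_def by (auto simp: ind_def near_def)
          then show ?thesis by simp
        qed
        ultimately have "G (rho_plus ?n r ?v) = 0" by simp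
        moreover have "H (rho_plus ?n r u) = G (rho_plus ?n r ?v)"
          unfolding H_def by (rule Pol_cong[OF PolG]) (auto simp: rho_plus_def ind_def)
        ultimately show "H (rho_plus ?n r u) = 0" by simp
      qed
      then have "G x = 0"
        using \<open>\<And>x. H x = 0\<close>[of "\<lambda>i. x i - 1"] by (simp add: H_def)
      then show ?thesis by (simp add: G(2))
    qed
  qed
qed

section \<open>Existence and uniqueness of the interpolation polynomials\<close>

lemma homogeneous_system:
  fixes a :: "'b \<Rightarrow> 'c \<Rightarrow> 'k::field"
  assumes "finite B" "finite A" "card B < card A"
  shows "\<exists>c. (\<exists>x\<in>A. c x \<noteq> 0) \<and> (\<forall>b\<in>B. (\<Sum>x\<in>A. a b x * c x) = 0)"
  using assms
proof (induction B arbitrary: A a rule: finite_induct)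
  case empty
  then obtain x where "x \<in> A" by fastforce
  then show ?case by (intro exI[of _ "\<lambda>_. 1"]) auto
next
  case (insert b B)
  show ?case
  proof (cases "\<forall>x\<in>A. a b x = 0")
    case True
    from insert have "card B < card A" by simp
    with insert.IH[OF insert.prems(1)] obtain c where
      "\<exists>x\<in>A. c x \<noteq> 0" "\<forall>b\<in>B. (\<Sum>x\<in>A. a b x * c x) = 0" by blast
    with True show ?thesis by (intro exI[of _ c]) auto
  next
    case False
    then obtain x0 where x0: "x0 \<in> A" "a b x0 \<noteq> 0" by blast
    let ?A = "A - {x0}"
    have "card B < card ?A" using insert x0 by simp
    \<comment> \<open>Gaussian elimination: the equation for b is solved for the unknown x0, and
      multiples of it are subtracted from the other equations.\<close>
    with insert.IH[of ?A "\<lambda>b' x. a b' x - a b' x0 / a b x0 * a b x"] insert.prems(1) obtain c where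
      c: "\<exists>x\<in>?A. c x \<noteq> 0"
      "\<forall>b'\<in>B. (\<Sum>x\<in>?A. (a b' x - a b' x0 / a b x0 * a b x) * c x) = 0" by auto
    define c' where "c' = c(x0 := - (\<Sum>x\<in>?A. a b x * c x) / a b x0)"
    have sum: "(\<Sum>x\<in>A. a b' x * c' x) = a b' x0 * c' x0 + (\<Sum>x\<in>?A. a b' x * c x)" for b'
      using insert.prems(1) x0 by (subst sum.remove[of _ x0]) (auto simp: c'_def intro!: sum.cong)
    have c': "a b x0 * c' x0 = - (\<Sum>x\<in>?A. a b x * c x)"
      using x0 by (simp add: c'_def)
    have "(\<Sum>x\<in>A. a b x * c' x) = 0" unfolding sum c' by simp
    moreover have "(\<Sum>x\<in>A. a b' x * c' x) = 0" if "b' \<in> B" for b'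
    proof -
      have "(\<Sum>x\<in>?A. a b' x * c x) - a b' x0 / a b x0 * (\<Sum>x\<in>?A. a b x * c x) = 0"
        using c(2) that by (simp add: sum_distrib_left left_diff_distrib sum_subtractf mult.assoc)
      moreover have "a b' x0 * c' x0 = - (a b' x0 / a b x0 * (\<Sum>x\<in>?A. a b x * c x))"
        by (simp add: c'_def)
      ultimately show ?thesis unfolding sum by simp
    qed
    moreover have "\<exists>x\<in>A. c' x \<noteq> 0" using c(1) by (auto simp: c'_def)
    ultimately show ?thesis by (intro exI[of _ c']) auto
  qed
qed

lemma mval_permute:
  assumes "\<pi> permutes A"
  shows "mval m (\<lambda>i. x (\<pi> i)) = mval (Poly_Mapping.map_key (pinv \<pi>) m) x"
proof -
  have inj: "inj (pinv \<pi>)" using permutes_inj[OF permutes_inv[OF assms]] .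
  have keys: "Poly_Mapping.keys (Poly_Mapping.map_key (pinv \<pi>) m) = \<pi> ` Poly_Mapping.keys m"
    unfolding keys_map_key[OF inj] using permutes_inverses[OF assms]
    by (auto simp: image_iff vimage_def) metis
  show ?thesis
    unfolding mval_def keys using permutes_inj[OF assms] permutes_inverses[OF assms]
    by (subst prod.reindex) (auto simp: map_key.rep_eq[OF inj] intro: inj_on_subset[OF permutes_inj[OF assms]])
qed

lemma alt_exp_antimono:
  assumes "l \<in> Lam n" "1 \<le> i" "i \<le> j" "even (i + j)"
  shows "Poly_Mapping.lookup (alt_exp n l) j \<le> Poly_Mapping.lookup (alt_exp n l) i"
proof -
  let ?e = "Poly_Mapping.lookup (alt_exp n l)"
  have step: "?e (Suc (Suc i)) \<le> ?e i" if "1 \<le> i" for i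
    using alt_exp_sum[OF assms(1), of i] alt_exp_sum[OF assms(1), of "Suc i"] that
      Lam_antimono[OF assms(1), of i "Suc i"] by (cases "Suc i \<le> n") (auto simp: lookup_alt_exp)
  have "?e (i + 2 * k) \<le> ?e i" for k
  proof (induction k)
    case (Suc k)
    then show ?case using step[of "i + 2 * k"] assms(2) by simp
  qed auto
  moreover obtain k where "j = i + 2 * k"
    using assms(3,4) by (metis dvd_def even_add even_diff_nat le_add_diff_inverse not_less)
  ultimately show ?thesis by simp
qed

text \<open>Along each parity class the exponents [l] decrease weakly, and W permutes within the
  classes; so an orbit contains at most one of them. The two vectors are compared through their
  superlevel sets in a class, which are nested and equally large.\<close>

lemma alt_exp_orbit:
  assumes l: "l \<in> Lam n" "l' \<in> Lam n" and \<pi>: "\<pi> \<in> W n"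
    and eq: "Poly_Mapping.map_key (pinv \<pi>) (alt_exp n l) = alt_exp n l'"
  shows "l = l'"
proof -
  let ?e = "Poly_Mapping.lookup (alt_exp n l)" and ?e' = "Poly_Mapping.lookup (alt_exp n l')"
  note p = W_permutes[OF \<pi>]
  have inj: "inj (pinv \<pi>)" using permutes_inj[OF permutes_inv[OF p]] .
  have e': "?e' (\<pi> i) = ?e i" for i
    using permutes_inverses[OF p] by (simp flip: eq add: map_key.rep_eq[OF inj])
  have "?e i = ?e' i" for i
  proof (cases "i \<in> {1..n}")
    case True
    let ?C = "{j \<in> {1..n}. even (i + j)}"
    have C: "{j \<in> ?C. v \<le> ?e j} = {j \<in> ?C. v \<le> ?e' j}" (is "?A = ?B") for v
    proof -
      have "\<pi> ` ?A = ?B"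
      proof safe
        fix j assume "j \<in> {1..n}" "v \<le> ?e' j" "even (i + j)"
        then show "j \<in> \<pi> ` ?A"
          using e'[of "pinv \<pi> j"] permutes_inverses[OF p] W_parity[OF \<pi>, of "pinv \<pi> j"]
            permutes_in_image[OF permutes_inv[OF p], of j]
          by (intro image_eqI[of _ _ "pinv \<pi> j"]) auto
      qed (use e' W_parity[OF \<pi>] permutes_in_image[OF p] in auto)
      then have card: "card ?A = card ?B"
        using card_image[OF inj_on_subset[OF permutes_inj[OF p] subset_UNIV], of ?A] by simp
      have "?A \<subseteq> ?B \<or> ?B \<subseteq> ?A"
      proof (rule ccontr)
        assume "\<not> (?A \<subseteq> ?B \<or> ?B \<subseteq> ?A)"
        then obtain a b where ab: "a \<in> ?A" "a \<notin> ?B" "b \<in> ?B" "b \<notin> ?A" by blast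
        then have par: "even (a + b)" "even (b + a)" "1 \<le> a" "1 \<le> b" by auto
        from ab have v: "v \<le> ?e a" "\<not> v \<le> ?e' a" "v \<le> ?e' b" "\<not> v \<le> ?e b" by auto
        show False
        proof (cases "a \<le> b")
          case True
          from alt_exp_antimono[OF l(2) par(3) True par(1)] v show False by simp
        next
          case False
          then have "b \<le> a" by simp
          from alt_exp_antimono[OF l(1) par(4) this par(2)] v show False by simp
        qed
      qed
      moreover have "finite ?A" "finite ?B" by auto
      ultimately show ?thesis using card card_subset_eq[of ?B ?A] card_subset_eq[of ?A ?B] by argo
    qed
    have "v \<le> ?e i \<longleftrightarrow> v \<le> ?e' i" for v
    proof -
      have "i \<in> {j \<in> ?C. v \<le> ?e j} \<longleftrightarrow> i \<in> {j \<in> ?C. v \<le> ?e' j}" unfolding C ..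
      with True show ?thesis by simp
    qed
    from this[of "?e i"] this[of "?e' i"] show ?thesis by simp
  next
    case False
    then show ?thesis unfolding lookup_alt_exp by (simp only: if_False)
  qed
  then have "alt_exp n l = alt_exp n l'" by (intro poly_mapping_eqI) simp
  then show ?thesis using inj_onD[OF inj_alt_exp _ l] by blast
qed

lemma total_deg_eqI:
  assumes "\<And>m. m \<in> Poly_Mapping.keys p \<Longrightarrow> monom_deg m \<le> d" "m \<in> Poly_Mapping.keys p" "monom_deg m = d"
  shows "total_deg p = d"
  unfolding total_deg_def using assms by (intro Max_eqI) auto

lemma Winv_eval: "W_invariant n p \<longleftrightarrow> Winv n (\<lambda>x. eval x (p :: 'k::field_char_0 mpoly))"
  by (simp add: W_invariant_iff Winv_def)

text \<open>A sum over the group and not over the orbit: every monomial is counted as often as its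
  stabiliser has elements. This is harmless in characteristic zero and makes invariance a mere
  reindexing.\<close>

definition orbit_sum :: "nat \<Rightarrow> (nat \<Rightarrow> nat) \<Rightarrow> 'k::comm_ring_1 mpoly" where
  "orbit_sum n l = (\<Sum>\<pi>\<in>W n. Poly_Mapping.single (Poly_Mapping.map_key (pinv \<pi>) (alt_exp n l)) 1)"

lemma eval_orbit_sum: "eval x (orbit_sum n l) = (\<Sum>\<pi>\<in>W n. mval (alt_exp n l) (\<lambda>i. x (\<pi> i)))"
  unfolding orbit_sum_def eval_sum eval_single
  by (intro sum.cong) (simp_all add: mval_permute[OF W_permutes])

lemma lookup_orbit_sum:
  assumes "l \<in> Lam n" "l' \<in> Lam n"
  shows "Poly_Mapping.lookup (orbit_sum n l) (alt_exp n l') =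
    (if l = l' then of_nat (card {\<pi> \<in> W n. Poly_Mapping.map_key (pinv \<pi>) (alt_exp n l) = alt_exp n l}) else 0)"
proof (cases "l = l'")
  case True
  then show ?thesis
    unfolding orbit_sum_def lookup_sum lookup_single when_def by (simp add: sum.If_cases Int_def)
next
  case False
  then have "Poly_Mapping.map_key (pinv \<pi>) (alt_exp n l) \<noteq> alt_exp n l'" if "\<pi> \<in> W n" for \<pi>
    using alt_exp_orbit[OF assms that] by blast
  with False show ?thesis
    unfolding orbit_sum_def lookup_sum lookup_single when_def by simp
qed

text \<open>A dimension count: there is one orbit sum more than there are vanishing conditions,
  hence a nonzero solution. By \<open>unisolvent\<close> its coefficient at z^[l] is not zero, so it
  can be normalised.\<close>

lemma is_R_exists:
  fixes r :: "'k::field_char_0"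
  assumes r: "\<forall>q::rat. q < 0 \<longrightarrow> r \<noteq> of_rat q" and l: "l \<in> Lam n"
  shows "\<exists>p. is_R n r l p"
proof -
  define N where "N = odd_size n l"
  define A where "A = {u \<in> Lam n. odd_size n u \<le> N}"
  have A: "finite A" "l \<in> A" unfolding A_def N_def using l by (auto intro: finite_Lam_le)
  then have "card (A - {l}) < card A" by (metis card_Diff1_less)
  with homogeneous_system[of "A - {l}" A "\<lambda>u k. eval (rho_plus n r u) (orbit_sum n k)"] A(1)
  obtain c where c: "\<exists>k\<in>A. c k \<noteq> 0"
    "\<forall>u\<in>A - {l}. (\<Sum>k\<in>A. eval (rho_plus n r u) (orbit_sum n k) * c k) = (0::'k)" by blast
  define p where "p = (\<Sum>k\<in>A. orbit_sum n k * Const (c k))"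
  have eval_p: "eval x p = (\<Sum>k\<in>A. eval x (orbit_sum n k) * c k)" for x
    by (simp add: p_def eval_sum)
  have keys_os: "Poly_Mapping.keys m \<subseteq> {1..n} \<and> monom_deg m = odd_size n k"
    if "k \<in> Lam n" "m \<in> Poly_Mapping.keys (orbit_sum n k :: 'k mpoly)" for k m
  proof -
    have "m \<in> (\<Union>\<pi>\<in>W n. {Poly_Mapping.map_key (pinv \<pi>) (alt_exp n k)})"
      using that(2) Poly_Mapping.keys_sum[of "\<lambda>\<pi>. Poly_Mapping.single (Poly_Mapping.map_key (pinv \<pi>) (alt_exp n k)) (1::'k)" "W n"]
      unfolding orbit_sum_def by auto
    then obtain \<pi> where \<pi>: "\<pi> \<in> W n" and m: "m = Poly_Mapping.map_key (pinv \<pi>) (alt_exp n k)" by blast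
    note p = W_permutes[OF \<pi>]
    have inj: "inj (pinv \<pi>)" using permutes_inj[OF permutes_inv[OF p]] .
    have keys: "Poly_Mapping.keys m \<subseteq> {1..n}"
      unfolding m keys_map_key[OF inj] using keys_alt_exp[of n k] permutes_in_image[OF permutes_inv[OF p]]
      by fastforce
    have "monom_deg m = (\<Sum>i\<in>{1..n}. Poly_Mapping.lookup (alt_exp n k) (pinv \<pi> i))"
      by (subst monom_deg_superset[OF _ keys]) (auto simp: m map_key.rep_eq[OF inj])
    also have "\<dots> = (\<Sum>i\<in>{1..n}. Poly_Mapping.lookup (alt_exp n k) i)"
      by (rule sum.reindex_bij_betw[OF permutes_imp_bij[OF permutes_inv[OF p]]])
    also have "\<dots> = odd_size n k"
      using monom_deg_alt_exp[OF that(1)] monom_deg_superset[OF _ keys_alt_exp] by simp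
    finally show ?thesis using keys by simp
  qed
  have keys_p: "Poly_Mapping.keys m \<subseteq> {1..n} \<and> monom_deg m \<le> N" if "m \<in> Poly_Mapping.keys p" for m
  proof -
    from that have "m \<in> (\<Union>k\<in>A. Poly_Mapping.keys (orbit_sum n k * Const (c k)))"
      unfolding p_def by (rule subsetD[OF Poly_Mapping.keys_sum])
    then obtain k where k: "k \<in> A" "m \<in> Poly_Mapping.keys (orbit_sum n k * Const (c k))"
      by (rule UN_E)
    then have "m \<in> Poly_Mapping.keys (orbit_sum n k :: 'k mpoly)"
      using keys_mult[of "orbit_sum n k" "Const (c k)"] by (auto simp: Const_def split: if_splits)
    with keys_os[of k m] k(1) show ?thesis by (auto simp: A_def)
  qed
  have Const: "Poly_Mapping.lookup (q * Const a) m = Poly_Mapping.lookup q m * a" for q :: "'k mpoly" and a m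
  proof -
    have "q * Const a = (\<Sum>m\<in>Poly_Mapping.keys q. Poly_Mapping.single m (Poly_Mapping.lookup q m * a))"
      by (subst (1) sum_single_keys[of q]) (simp only: sum_distrib_right Const_def mult_single add_0_right)
    then show ?thesis
      by (auto simp: lookup_sum lookup_single when_def sum.delta in_keys_iff)
  qed
  have lookup_p: "Poly_Mapping.lookup p (alt_exp n k) =
      of_nat (card {\<pi> \<in> W n. Poly_Mapping.map_key (pinv \<pi>) (alt_exp n k) = alt_exp n k}) * c k" if "k \<in> A" for k
  proof -
    have "Poly_Mapping.lookup p (alt_exp n k) =
        (\<Sum>k'\<in>A. Poly_Mapping.lookup (orbit_sum n k') (alt_exp n k) * c k')"
      by (simp add: p_def lookup_sum Const)
    also have "\<dots> = (\<Sum>k'\<in>A. if k = k' then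
        of_nat (card {\<pi> \<in> W n. Poly_Mapping.map_key (pinv \<pi>) (alt_exp n k) = alt_exp n k}) * c k else 0)"
      using that by (intro sum.cong) (auto simp: lookup_orbit_sum A_def)
    finally show ?thesis using A(1) that by simp
  qed
  have stab: "card {\<pi> \<in> W n. Poly_Mapping.map_key (pinv \<pi>) (alt_exp n k) = alt_exp n k} \<noteq> 0" for k
  proof -
    have "id \<in> {\<pi> \<in> W n. Poly_Mapping.map_key (pinv \<pi>) (alt_exp n k) = alt_exp n k}"
      using id_in_W by (auto intro!: poly_mapping_eqI simp: map_key.rep_eq)
    then show ?thesis using finite_W[of n] by (auto simp: card_eq_0_iff)
  qed
  have "p \<noteq> 0"
  proof
    assume "p = 0"
    then have "c k = 0" if "k \<in> A" for k using lookup_p[OF that] stab by simp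
    with c(1) show False by blast
  qed
  have inv: "Winv n (\<lambda>x. eval x p)"
    unfolding Winv_def
  proof safe
    fix \<sigma> :: "nat \<Rightarrow> nat" and x :: "nat \<Rightarrow> 'k" assume \<sigma>: "\<sigma> \<in> W n"
    have "eval (\<lambda>i. x (\<sigma> i)) (orbit_sum n k) = eval x (orbit_sum n k)" for k
      using sum.reindex_bij_betw[OF bij_W_comp[OF \<sigma>], of "\<lambda>\<pi>. mval (alt_exp n k) (\<lambda>i. x (\<pi> i))"]
      by (simp add: eval_orbit_sum)
    then show "eval (\<lambda>i. x (\<sigma> i)) p = eval x p" by (simp add: eval_p)
  qed
  have van: "eval (rho_plus n r u) p = 0" if "u \<in> Lam n" "odd_size n u \<le> N" "u \<noteq> l" for u
    using c(2) that by (simp add: eval_p A_def)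
  define a where "a = Poly_Mapping.lookup p (alt_exp n l)"
  have "a \<noteq> 0"
  proof
    assume "a = 0"
    then have "alt_exp n l \<notin> Poly_Mapping.keys p" by (simp add: a_def in_keys_iff)
    \<comment> \<open>The missing monomial takes the place of the missing vanishing condition at
      l.\<close>
    have "eval x p = 0" for x
    proof (rule unisolvent[OF r, where S = "{l}" and n = n and N = "int N" and F = "\<lambda>x. eval x p"])
      show "mspan {m. Poly_Mapping.keys m \<subseteq> {1..n} \<and> int (monom_deg m) \<le> int N \<and> m \<notin> alt_exp n ` {l}} (\<lambda>x. eval x p)"
        using keys_p \<open>alt_exp n l \<notin> _\<close> by (intro mspan_eval) auto
    qed (use l inv van in \<open>auto simp: N_def\<close>)
    then have "p = 0" by (intro eval_inject) simp
    with \<open>p \<noteq> 0\<close> show False by simp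
  qed
  define q where "q = p * Const (1 / a)"
  have keys_q: "Poly_Mapping.keys q \<subseteq> Poly_Mapping.keys p"
    by (auto simp: in_keys_iff q_def Const)
  have "is_R n r l q"
    unfolding is_R_def
  proof (intro conjI ballI impI)
    show "q \<in> polys n" using keys_q keys_p by (auto simp: polys_def)
    show "W_invariant n q" using inv by (simp add: Winv_eval q_def Winv_def)
    show 1: "Poly_Mapping.lookup q (alt_exp n l) = 1"
      using \<open>a \<noteq> 0\<close> by (simp add: q_def Const a_def)
    show "total_deg q = odd_size n l"
      using keys_q keys_p 1 l by (intro total_deg_eqI[of _ _ "alt_exp n l"])
        (auto simp: N_def monom_deg_alt_exp in_keys_iff)
  qed (use van in \<open>auto simp: N_def q_def\<close>)
  then show ?thesis by blast
qed

lemma monom_deg_le_total_deg: "m \<in> Poly_Mapping.keys p \<Longrightarrow> monom_deg m \<le> total_deg p"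
  unfolding total_deg_def by (intro Max_ge) auto

text \<open>The normalisation removes z^[l] from p - q, so \<open>unisolvent\<close> applies with S
  = {l}.\<close>

lemma is_R_unique:
  fixes r :: "'k::field_char_0"
  assumes r: "\<forall>q::rat. q < 0 \<longrightarrow> r \<noteq> of_rat q" and l: "l \<in> Lam n"
    and p: "is_R n r l p" and q: "is_R n r l q"
  shows "p = q"
proof -
  have keys: "Poly_Mapping.keys (p - q) \<subseteq> Poly_Mapping.keys p \<union> Poly_Mapping.keys q"
    by (auto simp: in_keys_iff lookup_minus)
  have "eval x (p - q) = 0" for x
  proof (rule unisolvent[OF r, where S = "{l}" and n = n and N = "int (odd_size n l)" and F = "\<lambda>x. eval x (p - q)"])
    show "mspan {m. Poly_Mapping.keys m \<subseteq> {1..n} \<and> int (monom_deg m) \<le> int (odd_size n l) \<and> m \<notin> alt_exp n ` {l}}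
        (\<lambda>x. eval x (p - q))"
    proof (rule mspan_eval, safe)
      fix m i assume "m \<in> Poly_Mapping.keys (p - q)" "i \<in> Poly_Mapping.keys m"
      moreover have "p \<in> polys n" "q \<in> polys n" using p q by (simp_all add: is_R_def)
      ultimately show "i \<in> {1..n}" using keys unfolding polys_def by blast
    next
      fix m assume "m \<in> Poly_Mapping.keys (p - q)"
      then show "int (monom_deg m) \<le> int (odd_size n l)"
        using keys p q monom_deg_le_total_deg[of m p] monom_deg_le_total_deg[of m q]
        unfolding is_R_def by auto
    next
      assume "alt_exp n l \<in> Poly_Mapping.keys (p - q)"
      then show False using p q by (simp add: in_keys_iff lookup_minus is_R_def)
    qed
    show "Winv n (\<lambda>x. eval x (p - q))"
      using p q by (auto simp: is_R_def Winv_eval Winv_def)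
  qed (use l p q in \<open>auto simp: is_R_def\<close>)
  then show "p = q" by (intro eval_inject) simp
qed

lemma is_R_R:
  fixes r :: "'k::field_char_0"
  assumes "\<forall>q::rat. q < 0 \<longrightarrow> r \<noteq> of_rat q" "l \<in> Lam n"
  shows "is_R n r l (R n r l)"
  unfolding R_def using is_R_exists[OF assms] is_R_unique[OF assms] by (metis the_equality)

locale semisym =
  fixes n :: nat and r :: "'k::field_char_0"
  assumes r_neg: "\<forall>q::rat. q < 0 \<longrightarrow> r \<noteq> of_rat q"
begin

definition Rf :: "(nat \<Rightarrow> nat) \<Rightarrow> (nat \<Rightarrow> 'k) \<Rightarrow> 'k" where
  "Rf l x = eval x (R n r l)"

abbreviation "pt \<equiv> rho_plus n r"
abbreviation "sz \<equiv> odd_size n"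

lemma vanishing_imp_zero:
  assumes "Pol n N F" "Winv n F"
    and "\<And>u. u \<in> Lam n \<Longrightarrow> int (sz u) \<le> N \<Longrightarrow> F (pt u) = 0"
  shows "F x = 0"
  by (rule unisolvent[OF r_neg, where S = "{}" and n = n and N = N and F = F])
    (use assms in \<open>auto simp: Pol_def\<close>)

context
  fixes l assumes l: "l \<in> Lam n"
begin

lemma Pol_Rf: "Pol n (int (sz l)) (Rf l)"
  and Winv_Rf: "Winv n (Rf l)"
  and Rf_vanish: "u \<in> Lam n \<Longrightarrow> sz u \<le> sz l \<Longrightarrow> u \<noteq> l \<Longrightarrow> Rf l (pt u) = 0"
  using is_R_R[OF r_neg l] Pol_eval[of "R n r l" n] unfolding is_R_def Winv_eval Rf_def by auto

lemma Rf_nonzero: "Rf l (pt l) \<noteq> 0"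
proof
  assume "Rf l (pt l) = 0"
  have "Rf l x = 0" for x
  proof (rule vanishing_imp_zero[OF Pol_Rf Winv_Rf])
    fix u assume "u \<in> Lam n" "int (sz u) \<le> int (sz l)"
    then show "Rf l (pt u) = 0"
      using Rf_vanish[of u] \<open>Rf l (pt l) = 0\<close> by (cases "u = l") auto
  qed
  then have "R n r l = 0" by (intro eval_inject) (simp add: Rf_def)
  then show False using is_R_R[OF r_neg l] by (simp add: is_R_def)
qed

text \<open>The tool for recognising eigenfunctions: the zeros of \<open>Rf l\<close> together with
  the degree bound leave only the value at rho + l undetermined.\<close>

lemma eq_multiple_Rf:
  assumes "Pol n (int (sz l)) F" "Winv n F"
    and "\<And>u. u \<in> Lam n \<Longrightarrow> sz u \<le> sz l \<Longrightarrow> u \<noteq> l \<Longrightarrow> F (pt u) = 0"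
  shows "F x = F (pt l) / Rf l (pt l) * Rf l x"
proof -
  have "F x - F (pt l) / Rf l (pt l) * Rf l x = 0"
  proof (rule vanishing_imp_zero[where F = "\<lambda>x. F x - F (pt l) / Rf l (pt l) * Rf l x"])
    show "Pol n (int (sz l)) (\<lambda>x. F x - F (pt l) / Rf l (pt l) * Rf l x)"
      using assms(1) Pol_Rf by (intro Pol_diff Pol_scale)
    show "Winv n (\<lambda>x. F x - F (pt l) / Rf l (pt l) * Rf l x)"
      using assms(2) Winv_Rf by (simp add: Winv_def)
    fix u assume "u \<in> Lam n" "int (sz u) \<le> int (sz l)"
    then show "F (pt u) - F (pt l) / Rf l (pt l) * Rf l (pt u) = 0"
      using assms(3) Rf_vanish Rf_nonzero by (cases "u = l") auto
  qed
  then show ?thesis by simp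
qed

end

end

section \<open>Determinants\<close>

text \<open>Rows are numbered from 1 like the variables, columns from 0 like the exponents.\<close>

definition rdet :: "nat \<Rightarrow> (nat \<Rightarrow> nat \<Rightarrow> 'a) \<Rightarrow> 'a::comm_ring_1" where
  "rdet n A = det (mat n n (\<lambda>(i, c). A (Suc i) c))"

lemma rdet_leibniz: "rdet n A = (\<Sum>p | p permutes {0..<n}. signof p * (\<Prod>i\<in>{0..<n}. A (Suc i) (p i)))"
proof -
  have "rdet n A = (\<Sum>p | p permutes {0..<n}. signof p * (\<Prod>i = 0..<n. mat n n (\<lambda>(i, c). A (Suc i) c) $$ (i, p i)))"
    unfolding rdet_def by (rule det_def'[OF mat_carrier])
  also have "\<dots> = (\<Sum>p | p permutes {0..<n}. signof p * (\<Prod>i\<in>{0..<n}. A (Suc i) (p i)))"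
  proof (rule sum.cong[OF refl])
    fix p assume "p \<in> {p. p permutes {0..<n}}"
    then have "p i < n" if "i < n" for i using permutes_in_image[of p "{0..<n}" i] that by simp
    then show "signof p * (\<Prod>i = 0..<n. mat n n (\<lambda>(i, c). A (Suc i) c) $$ (i, p i)) =
        signof p * (\<Prod>i\<in>{0..<n}. A (Suc i) (p i))" by simp
  qed
  finally show ?thesis .
qed

lemma rdet_cong:
  assumes "\<And>a c. a \<in> {1..n} \<Longrightarrow> A a c = B a c"
  shows "rdet n A = rdet n B"
  unfolding rdet_leibniz using assms by (intro sum.cong prod.cong arg_cong2[of _ _ _ _ "(*)"]) auto

lemma prod_shift_Suc: "(\<Prod>i\<in>{0..<n}. f (Suc i)) = (\<Prod>a\<in>{1..n}. f a)"
  by (rule prod.reindex_bij_witness[of _ "\<lambda>a. a - 1" Suc]) auto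

lemma sum_shift_Suc: "(\<Sum>i\<in>{0..<n}. f (Suc i)) = (\<Sum>a\<in>{1..n}. f a)"
  by (rule sum.reindex_bij_witness[of _ "\<lambda>a. a - 1" Suc]) auto

lemma rdet_scale: "rdet n (\<lambda>a c. w a * A a c) = (\<Prod>a\<in>{1..n}. w a) * rdet n A"
  unfolding rdet_leibniz prod.distrib prod_shift_Suc sum_distrib_left
  by (intro sum.cong) (simp_all add: mult_ac)

text \<open>Multilinearity in all rows at once; K collects the rows that take the first summand.
  Read from right to left, it turns a sum over shifts K into one determinant.\<close>

lemma rdet_add:
  "rdet n (\<lambda>a c. A a c + B a c) = (\<Sum>K\<in>Pow {1..n}. rdet n (\<lambda>a c. if a \<in> K then A a c else B a c))"
proof -
  have eq: "(\<Prod>i\<in>{0..<n}. A (Suc i) (p i) + B (Suc i) (p i)) =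
      (\<Sum>K\<in>Pow {1..n}. \<Prod>i\<in>{0..<n}. if Suc i \<in> K then A (Suc i) (p i) else B (Suc i) (p i))" for p
  proof -
    have "(\<Prod>i\<in>{0..<n}. A (Suc i) (p i) + B (Suc i) (p i)) =
        (\<Prod>a\<in>{1..n}. A a (p (a - 1)) + B a (p (a - 1)))"
      using prod_shift_Suc[of "\<lambda>a. A a (p (a - 1)) + B a (p (a - 1))" n] by simp
    also have "\<dots> = (\<Sum>K\<in>Pow {1..n}. (\<Prod>a\<in>K. A a (p (a - 1))) * (\<Prod>a\<in>{1..n} - K. B a (p (a - 1))))"
      by (rule prod_add) simp
    also have "\<dots> = (\<Sum>K\<in>Pow {1..n}. \<Prod>a\<in>{1..n}. if a \<in> K then A a (p (a - 1)) else B a (p (a - 1)))"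
    proof (rule sum.cong[OF refl])
      fix K assume "K \<in> Pow {1..n}"
      then have "{1..n} \<inter> {x. x \<in> K} = K" "{1..n} \<inter> - {x. x \<in> K} = {1..n} - K" by auto
      then show "(\<Prod>a\<in>K. A a (p (a - 1))) * (\<Prod>a\<in>{1..n} - K. B a (p (a - 1))) =
          (\<Prod>a\<in>{1..n}. if a \<in> K then A a (p (a - 1)) else B a (p (a - 1)))"
        by (subst prod.If_cases) simp_all
    qed
    finally show ?thesis unfolding prod_shift_Suc[symmetric] diff_Suc_1 .
  qed
  show ?thesis unfolding rdet_leibniz eq sum_distrib_left by (rule sum.swap)
qed

lemma rdet_permute:
  fixes n :: nat
  assumes "\<pi> permutes {1..n}"
  obtains e :: "'a::comm_ring_1" where "e * e = 1" "\<And>A :: nat \<Rightarrow> nat \<Rightarrow> 'a. rdet n (\<lambda>a. A (\<pi> a)) = e * rdet n A"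
proof -
  define p where "p i = (if i < n then \<pi> (Suc i) - 1 else i)" for i
  have in_im: "\<pi> a \<in> {1..n}" if "a \<in> {1..n}" for a
    using permutes_in_image[OF assms, of a] that by simp
  have p: "p permutes {0..<n}"
  proof (rule bij_imp_permutes)
    have "inj_on p {0..<n}"
    proof (rule inj_onI)
      fix i j assume ij: "i \<in> {0..<n}" "j \<in> {0..<n}" "p i = p j"
      then have "\<pi> (Suc i) = \<pi> (Suc j)"
        using in_im[of "Suc i"] in_im[of "Suc j"] by (auto simp: p_def)
      then show "i = j" using permutes_inj[OF assms] by (auto dest: injD)
    qed
    moreover have "p ` {0..<n} \<subseteq> {0..<n}"
    proof
      fix j assume "j \<in> p ` {0..<n}"
      then obtain i where i: "i < n" "j = \<pi> (Suc i) - 1" by (auto simp: p_def)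
      with in_im[of "Suc i"] show "j \<in> {0..<n}" by auto
    qed
    ultimately show "bij_betw p {0..<n} {0..<n}"
      by (simp add: bij_betw_def endo_inj_surj)
  qed (simp add: p_def)
  have "rdet n (\<lambda>a. A (\<pi> a)) = signof p * rdet n A" for A :: "nat \<Rightarrow> nat \<Rightarrow> 'a"
  proof -
    let ?A = "mat n n (\<lambda>(i, c). A (Suc i) c)"
    have "mat n n (\<lambda>(i, c). A (\<pi> (Suc i)) c) = mat n n (\<lambda>(i, j). ?A $$ (p i, j))"
    proof (rule eq_matI)
      fix i j assume *: "i < dim_row (mat n n (\<lambda>(i, j). ?A $$ (p i, j)))" "j < dim_col (mat n n (\<lambda>(i, j). ?A $$ (p i, j)))"
      then have "p i < n" using permutes_in_image[OF p, of i] by simp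
      moreover have "Suc (p i) = \<pi> (Suc i)" using in_im[of "Suc i"] * by (simp add: p_def)
      ultimately show "mat n n (\<lambda>(i, c). A (\<pi> (Suc i)) c) $$ (i, j) = mat n n (\<lambda>(i, j). ?A $$ (p i, j)) $$ (i, j)"
        using * by simp
    qed auto
    then show ?thesis unfolding rdet_def by (simp add: det_permute_rows[OF mat_carrier p])
  qed
  moreover have "signof p * signof p = (1::'a)"
    by (cases "evenperm p") (simp_all add: sign_def)
  ultimately show ?thesis using that by blast
qed

lemma rdet_swap:
  fixes A :: "nat \<Rightarrow> nat \<Rightarrow> 'a::comm_ring_1"
  assumes "a \<in> {1..n}" "b \<in> {1..n}" "a \<noteq> b"
  shows "rdet n (\<lambda>x. A (Transposition.transpose a b x)) = - rdet n A"
proof -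
  let ?A = "mat n n (\<lambda>(i, c). A (Suc i) c)"
  have ab: "a - 1 < n" "b - 1 < n" "a - 1 \<noteq> b - 1" using assms by auto
  have "mat n n (\<lambda>(i, c). A (Transposition.transpose a b (Suc i)) c) = swaprows (a - 1) (b - 1) ?A"
    using assms ab by (intro eq_matI) (auto simp: Transposition.transpose_def)
  then show ?thesis unfolding rdet_def using det_swaprows[OF ab mat_carrier] by simp
qed

lemma rdet_equal_rows:
  fixes A :: "nat \<Rightarrow> nat \<Rightarrow> 'a::comm_ring_1"
  assumes "a \<in> {1..n}" "b \<in> {1..n}" "a \<noteq> b" "\<And>c. A a c = A b c"
  shows "rdet n A = 0"
  unfolding rdet_def
proof (rule det_identical_rows[OF mat_carrier])
  show "a - 1 \<noteq> b - 1" "a - 1 < n" "b - 1 < n" using assms by auto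
  then show "row (mat n n (\<lambda>(i, c). A (Suc i) c)) (a - 1) = row (mat n n (\<lambda>(i, c). A (Suc i) c)) (b - 1)"
    using assms by (intro eq_vecI) auto
qed

lemma rdet_zero_iff:
  fixes A :: "nat \<Rightarrow> nat \<Rightarrow> 'a::field"
  shows "rdet n A = 0 \<longleftrightarrow> (\<exists>v. (\<exists>c<n. v c \<noteq> 0) \<and> (\<forall>a\<in>{1..n}. (\<Sum>c<n. A a c * v c) = 0))"
proof -
  let ?A = "mat n n (\<lambda>(i, c). A (Suc i) c)"
  have mult: "?A *\<^sub>v w = 0\<^sub>v n \<longleftrightarrow> (\<forall>a\<in>{1..n}. (\<Sum>c<n. A a c * w $ c) = 0)" if "w \<in> carrier_vec n" for w
  proof -
    have "?A *\<^sub>v w = 0\<^sub>v n \<longleftrightarrow> (\<forall>i<n. (?A *\<^sub>v w) $ i = 0)"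
      by (auto simp: vec_eq_iff)
    also have "\<dots> \<longleftrightarrow> (\<forall>i<n. (\<Sum>c<n. A (Suc i) c * w $ c) = 0)"
      using that by (simp add: scalar_prod_def lessThan_atLeast0)
    also have "\<dots> \<longleftrightarrow> (\<forall>a\<in>{1..n}. (\<Sum>c<n. A a c * w $ c) = 0)"
    proof safe
      fix a assume "\<forall>i<n. (\<Sum>c<n. A (Suc i) c * w $ c) = 0" "a \<in> {1..n}"
      then show "(\<Sum>c<n. A a c * w $ c) = 0" by (cases a) auto
    qed auto
    finally show ?thesis .
  qed
  have "rdet n A = 0 \<longleftrightarrow> (\<exists>w. w \<in> carrier_vec n \<and> w \<noteq> 0\<^sub>v n \<and> ?A *\<^sub>v w = 0\<^sub>v n)"
    unfolding rdet_def by (rule det_0_iff_vec_prod_zero_field[OF mat_carrier])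
  also have "\<dots> \<longleftrightarrow> (\<exists>v. (\<exists>c<n. v c \<noteq> 0) \<and> (\<forall>a\<in>{1..n}. (\<Sum>c<n. A a c * v c) = 0))"
  proof
    assume "\<exists>w. w \<in> carrier_vec n \<and> w \<noteq> 0\<^sub>v n \<and> ?A *\<^sub>v w = 0\<^sub>v n"
    then obtain w where w: "w \<in> carrier_vec n" "w \<noteq> 0\<^sub>v n" "?A *\<^sub>v w = 0\<^sub>v n" by blast
    then have "\<exists>c<n. w $ c \<noteq> 0" by (auto simp: vec_eq_iff)
    with w mult[OF w(1)] show "\<exists>v. (\<exists>c<n. v c \<noteq> 0) \<and> (\<forall>a\<in>{1..n}. (\<Sum>c<n. A a c * v c) = 0)"
      by (intro exI[of _ "\<lambda>c. w $ c"]) blast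
  next
    assume "\<exists>v. (\<exists>c<n. v c \<noteq> 0) \<and> (\<forall>a\<in>{1..n}. (\<Sum>c<n. A a c * v c) = 0)"
    then obtain v where v: "\<exists>c<n. v c \<noteq> 0" "\<forall>a\<in>{1..n}. (\<Sum>c<n. A a c * v c) = 0" by blast
    then have "vec n v \<noteq> 0\<^sub>v n" by (auto simp: vec_eq_iff)
    moreover have "?A *\<^sub>v vec n v = 0\<^sub>v n" using v(2) by (subst mult) auto
    ultimately show "\<exists>w. w \<in> carrier_vec n \<and> w \<noteq> 0\<^sub>v n \<and> ?A *\<^sub>v w = 0\<^sub>v n"
      by (intro exI[of _ "vec n v"]) auto
  qed
  finally show ?thesis .
qed

text \<open>A Leibniz term takes one entry from each row and each column, so all terms obey the same
  bound. The bounds are integers since a column may have bound -1.\<close>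

lemma rdet_Pol:
  fixes A :: "nat \<Rightarrow> nat \<Rightarrow> (nat \<Rightarrow> 'k::comm_ring_1) \<Rightarrow> 'k"
  assumes "\<And>a c. a \<in> {1..m} \<Longrightarrow> c < m \<Longrightarrow> Pol n (rd a + cd c) (A a c)"
  shows "Pol n ((\<Sum>a\<in>{1..m}. rd a) + (\<Sum>c<m. cd c)) (\<lambda>x. rdet m (\<lambda>a c. A a c x))"
  unfolding rdet_leibniz
proof (rule Pol_sum, rule Pol_scale)
  fix p assume "p \<in> {p. p permutes {0..<m}}"
  then have p: "p permutes {0..<m}" by simp
  have "Pol n (\<Sum>i\<in>{0..<m}. rd (Suc i) + cd (p i)) (\<lambda>x. \<Prod>i\<in>{0..<m}. A (Suc i) (p i) x)"
  proof (rule Pol_prod)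
    fix i assume "i \<in> {0..<m}"
    then have "Suc i \<in> {1..m}" "p i < m" using permutes_in_image[OF p, of i] by auto
    then show "Pol n (rd (Suc i) + cd (p i)) (A (Suc i) (p i))" by (rule assms)
  qed simp
  moreover have "(\<Sum>i\<in>{0..<m}. cd (p i)) = (\<Sum>c<m. cd c)"
    using sum.permute[OF p, of cd] by (simp add: o_def lessThan_atLeast0)
  ultimately show "Pol n ((\<Sum>a\<in>{1..m}. rd a) + (\<Sum>c<m. cd c)) (\<lambda>x. \<Prod>i\<in>{0..<m}. A (Suc i) (p i) x)"
    by (simp add: sum.distrib sum_shift_Suc)
qed

lemma poly_eq_0_of_roots:
  fixes p :: "'a::field poly"
  assumes "\<And>i. i \<ge> m \<Longrightarrow> coeff p i = 0" "finite A" "m \<le> card A" "inj_on u A" "\<And>a. a \<in> A \<Longrightarrow> poly p (u a) = 0"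
  shows "p = 0"
proof (rule ccontr)
  assume p: "p \<noteq> 0"
  have "card A = card (u ` A)" using assms(4) by (simp add: card_image)
  also have "\<dots> \<le> card {x. poly p x = 0}"
    using assms(5) poly_roots_finite[OF p] by (intro card_mono) auto
  also have "\<dots> \<le> degree p" by (rule card_poly_roots_bound[OF p])
  also have "\<dots> < m"
  proof (rule ccontr)
    assume "\<not> degree p < m"
    then have "coeff p (degree p) = 0" by (intro assms(1)) simp
    with p show False by simp
  qed
  finally show False using assms(3) by simp
qed

lemma degree_linear_prod: "finite A \<Longrightarrow> degree (\<Prod>a\<in>A. [:u a, 1 :: 'a::idom:]) = card A"
  by (subst degree_prod_sum_eq) auto

lemma monic_linear_prod: "coeff (\<Prod>a\<in>A. [:u a, 1:]) (card A) = (1 :: 'a::idom)" if "finite A"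
proof -
  have "lead_coeff (\<Prod>a\<in>A. [:u a, 1:]) = (1::'a)" by (subst lead_coeff_prod) simp
  then show ?thesis unfolding degree_linear_prod[OF that] .
qed

lemma linear_prod_nonzero: "(\<Prod>a\<in>A. [:u a, 1:]) \<noteq> (0 :: 'a::idom poly)"
  by (cases "finite A") auto

lemma card_parity: "card {a \<in> {1..n::nat}. odd a} = (n + 1) div 2" "card {a \<in> {1..n}. even a} = n div 2"
proof (induction n)
  case (Suc n)
  have *: "{a \<in> {1..Suc n}. P a} = (if P (Suc n) then insert (Suc n) {a \<in> {1..n}. P a} else {a \<in> {1..n}. P a})" for P
    by (auto simp: le_Suc_eq)
  {
    case 1
    then show ?case using Suc(1) unfolding * by (auto elim!: evenE oddE)
  next
    case 2
    then show ?case using Suc(2) unfolding * by (auto elim!: evenE oddE)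
  }
qed simp_all

lemma card_cpairs:
  fixes C :: "nat set"
  assumes "finite C"
  shows "card {(i, j). i \<in> C \<and> j \<in> C \<and> i < j} = (\<Sum>l<card C. l)"
  using assms
proof (induction C rule: finite_linorder_max_induct)
  case (insert b C)
  have "{(i, j). i \<in> insert b C \<and> j \<in> insert b C \<and> i < j} =
      {(i, j). i \<in> C \<and> j \<in> C \<and> i < j} \<union> (\<lambda>i. (i, b)) ` C"
    using insert by force
  moreover have "{(i, j). i \<in> C \<and> j \<in> C \<and> i < j} \<inter> (\<lambda>i. (i, b)) ` C = {}"
    using insert by force
  moreover have "finite {(i, j). i \<in> C \<and> j \<in> C \<and> i < j}"
    by (rule finite_subset[of _ "C \<times> C"]) (use insert in auto)
  moreover have "card ((\<lambda>i. (i, b)) ` C) = card C"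
    by (rule card_image) (auto simp: inj_on_def)
  moreover have "b \<notin> C" using insert by auto
  ultimately show ?case using insert by (simp add: card_Un_disjoint)
qed auto

lemma sum_lessThan_add: "(\<Sum>c<g + h. f c) = (\<Sum>c<g. f c) + (\<Sum>l<h. f (g + l :: nat))"
  by (induction h) (auto simp: add_ac)

lemma poly_sum_coeff:
  fixes p :: "'a::comm_ring_1 poly"
  assumes "\<And>i. i \<ge> m \<Longrightarrow> coeff p i = 0"
  shows "poly p x = (\<Sum>i<m. coeff p i * x ^ i)"
proof -
  have "poly p x = (\<Sum>i\<in>{..degree p} \<union> {..<m}. coeff p i * x ^ i)"
    unfolding poly_altdef by (rule sum.mono_neutral_left) (auto simp: coeff_eq_0)
  also have "\<dots> = (\<Sum>i<m. coeff p i * x ^ i)"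
    using assms by (intro sum.mono_neutral_right) auto
  finally show ?thesis .
qed

section \<open>The matrix behind the operators and its kernel\<close>

definition pclass :: "nat \<Rightarrow> bool \<Rightarrow> nat set" where
  "pclass n b = {a \<in> {1..n}. odd a = b}"

text \<open>The rows of the matrix are indexed by the variables and come in two kinds, told apart by
  \<open>rowH\<close>. The entries \<open>colent\<close> are chosen such that, once the rows for the shifted and the
  unshifted variable are added up with their weights, the leading terms cancel in the last
  \<open>pcard n b\<close> columns. The exponent offset \<open>cshift n b\<close> makes this work for both parities of \<open>n\<close>.\<close>

definition pcard :: "nat \<Rightarrow> bool \<Rightarrow> nat" where "pcard n b = card (pclass n b)"
definition qcard :: "nat \<Rightarrow> bool \<Rightarrow> nat" where "qcard n b = n - pcard n b"
definition cshift :: "nat \<Rightarrow> bool \<Rightarrow> nat" where "cshift n b = of_bool (b = even n)"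

definition rowH :: "bool \<Rightarrow> nat set \<Rightarrow> nat \<Rightarrow> bool" where
  "rowH b K a \<longleftrightarrow> (odd a = b) = (a \<in> K)"

definition colent :: "nat \<Rightarrow> bool \<Rightarrow> nat \<Rightarrow> bool \<Rightarrow> 'k \<Rightarrow> 'k::comm_ring_1" where
  "colent n b c H u =
    (if c < qcard n b then (if H then u ^ c else 0)
     else (if H then u ^ (c - qcard n b + cshift n b) else - (u ^ (c - qcard n b))))"

lemma pcard_le: "pcard n b \<le> n"
  unfolding pcard_def pclass_def by (rule order.trans[OF card_mono[of "{1..n}"]]) auto

lemma qcard_pcard: "qcard n b + pcard n b = n"
  using pcard_le by (simp add: qcard_def)

lemma pcard_eq: "pcard n b = (if b then (n + 1) div 2 else n div 2)"
  using card_parity[of n] unfolding pcard_def pclass_def by (cases b) simp_all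

text \<open>For Y of degree below \<open>pcard n b\<close>, the product of Y with the offset power
  has degree below \<open>qcard n b + of_bool b\<close>. It can leave the degree range of X, by one,
  only if b holds.\<close>

lemma pcard_cshift: "pcard n b + cshift n b = qcard n b + of_bool b"
  unfolding qcard_def pcard_eq cshift_def by (cases b; cases "even n") (auto elim!: evenE oddE)

lemma pclass_Not: "pclass n (\<not> b) = {1..n} - pclass n b"
  by (auto simp: pclass_def)

lemma finite_pclass [simp]: "finite (pclass n b)"
  by (simp add: pclass_def)

text \<open>Rows of the first kind come from the elements of K in the class \<open>b\<close> and
  from the elements of the other class outside K. The additive form avoids truncated
  subtraction.\<close>

lemma card_rowH:
  assumes "K \<subseteq> {1..n}"
  shows "card {a \<in> {1..n}. rowH b K a} + card (K - pclass n b) = qcard n b + card (K \<inter> pclass n b)"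
proof -
  have eq: "{a \<in> {1..n}. rowH b K a} = (K \<inter> pclass n b) \<union> (pclass n (\<not> b) - K)"
    using assms by (auto simp: rowH_def pclass_def)
  have fin: "finite K" by (rule finite_subset[OF assms]) simp
  have "card {a \<in> {1..n}. rowH b K a} = card (K \<inter> pclass n b) + card (pclass n (\<not> b) - K)"
    unfolding eq by (rule card_Un_disjoint) (use fin in \<open>auto simp: pclass_def\<close>)
  moreover have "card (pclass n (\<not> b) - K) + card (K - pclass n b) = card (pclass n (\<not> b))"
  proof -
    have "pclass n (\<not> b) = (pclass n (\<not> b) - K) \<union> (K - pclass n b)" using assms by (auto simp: pclass_def)
    then have "card (pclass n (\<not> b)) = card ((pclass n (\<not> b) - K) \<union> (K - pclass n b))" by simp
    also have "\<dots> = card (pclass n (\<not> b) - K) + card (K - pclass n b)"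
      by (rule card_Un_disjoint) (use fin in auto)
    finally show ?thesis by simp
  qed
  moreover have "card (pclass n (\<not> b)) = qcard n b"
    unfolding pclass_Not qcard_def pcard_def by (subst card_Diff_subset) (auto simp: pclass_def)
  ultimately show ?thesis by simp
qed

lemma sum_colent:
  fixes v :: "nat \<Rightarrow> 'k::field" and X Y :: "'k poly"
  assumes X: "\<And>i. i \<ge> qcard n b \<Longrightarrow> coeff X i = 0" and Y: "\<And>i. i \<ge> pcard n b \<Longrightarrow> coeff Y i = 0"
    and v: "\<And>c. v c = (if c < qcard n b then coeff X c else coeff Y (c - qcard n b))"
  shows "(\<Sum>c<n. colent n b c H u * v c) =
    (if H then poly X u + u ^ cshift n b * poly Y u else - poly Y u)"
proof -
  have "(\<Sum>c<n. colent n b c H u * v c) =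
      (\<Sum>c<qcard n b. colent n b c H u * v c) + (\<Sum>l<pcard n b. colent n b (qcard n b + l) H u * v (qcard n b + l))"
    using sum_lessThan_add[of _ "qcard n b" "pcard n b"] by (simp add: qcard_pcard)
  then show ?thesis
    by (simp add: colent_def v poly_sum_coeff[OF X] poly_sum_coeff[OF Y] sum_distrib_left sum_negf
        power_add mult_ac)
qed

text \<open>A kernel vector amounts to a pair of polynomials \<open>X\<close>, \<open>Y\<close> of bounded degrees.\<close>

lemma rdet_colent_zero_iff:
  fixes u :: "nat \<Rightarrow> 'k::field"
  shows "rdet n (\<lambda>a c. colent n b c (H a) (u a)) = 0 \<longleftrightarrow>
    (\<exists>X Y. (X \<noteq> 0 \<or> Y \<noteq> 0) \<and> (\<forall>i\<ge>qcard n b. coeff X i = 0) \<and> (\<forall>i\<ge>pcard n b. coeff Y i = 0) \<and>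
      (\<forall>a\<in>{1..n}. if H a then poly X (u a) + u a ^ cshift n b * poly Y (u a) = 0 else poly Y (u a) = 0))"
  unfolding rdet_zero_iff
proof
  assume "\<exists>v. (\<exists>c<n. v c \<noteq> 0) \<and> (\<forall>a\<in>{1..n}. (\<Sum>c<n. colent n b c (H a) (u a) * v c) = 0)"
  then obtain v where v: "\<exists>c<n. v c \<noteq> 0" "\<forall>a\<in>{1..n}. (\<Sum>c<n. colent n b c (H a) (u a) * v c) = 0" by blast
  define X where "X = (\<Sum>c<qcard n b. monom (v c) c)"
  define Y where "Y = (\<Sum>l<pcard n b. monom (v (qcard n b + l)) l)"
  have cX: "coeff X i = (if i < qcard n b then v i else 0)" for i
    by (simp add: X_def coeff_sum sum.delta)
  have cY: "coeff Y i = (if i < pcard n b then v (qcard n b + i) else 0)" for i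
    by (simp add: Y_def coeff_sum sum.delta)
  define v' where "v' c = (if c < qcard n b then coeff X c else coeff Y (c - qcard n b))" for c
  have v': "v' c = v c" if "c < n" for c
    using that qcard_pcard[of n b] by (auto simp: v'_def cX cY)
  have sum: "(\<Sum>c<n. colent n b c (H a) (u a) * v c) =
      (if H a then poly X (u a) + u a ^ cshift n b * poly Y (u a) else - poly Y (u a))" for a
  proof -
    have "(\<Sum>c<n. colent n b c (H a) (u a) * v c) = (\<Sum>c<n. colent n b c (H a) (u a) * v' c)"
      by (rule sum.cong) (auto simp: v')
    also have "\<dots> = (if H a then poly X (u a) + u a ^ cshift n b * poly Y (u a) else - poly Y (u a))"
      by (rule sum_colent[where X = X and Y = Y]) (auto simp: cX cY v'_def)
    finally show ?thesis .
  qed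
  have "X \<noteq> 0 \<or> Y \<noteq> 0"
  proof (rule ccontr)
    assume "\<not> (X \<noteq> 0 \<or> Y \<noteq> 0)"
    then have "v' c = 0" for c by (simp add: v'_def)
    with v' v(1) show False by auto
  qed
  moreover have "if H a then poly X (u a) + u a ^ cshift n b * poly Y (u a) = 0 else poly Y (u a) = 0"
    if "a \<in> {1..n}" for a
    using bspec[OF v(2) that] sum[of a] by (cases "H a") auto
  ultimately show "\<exists>X Y. (X \<noteq> 0 \<or> Y \<noteq> 0) \<and> (\<forall>i\<ge>qcard n b. coeff X i = 0) \<and> (\<forall>i\<ge>pcard n b. coeff Y i = 0) \<and>
      (\<forall>a\<in>{1..n}. if H a then poly X (u a) + u a ^ cshift n b * poly Y (u a) = 0 else poly Y (u a) = 0)"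
    by (intro exI[of _ X] exI[of _ Y] conjI ballI) (auto simp: cX cY)
next
  assume "\<exists>X Y. (X \<noteq> 0 \<or> Y \<noteq> 0) \<and> (\<forall>i\<ge>qcard n b. coeff X i = 0) \<and> (\<forall>i\<ge>pcard n b. coeff Y i = 0) \<and>
      (\<forall>a\<in>{1..n}. if H a then poly X (u a) + u a ^ cshift n b * poly Y (u a) = 0 else poly Y (u a) = 0)"
  then obtain X Y where XY: "X \<noteq> 0 \<or> Y \<noteq> 0" "\<And>i. i \<ge> qcard n b \<Longrightarrow> coeff X i = 0" "\<And>i. i \<ge> pcard n b \<Longrightarrow> coeff Y i = 0"
    and z: "\<And>a. a \<in> {1..n} \<Longrightarrow> if H a then poly X (u a) + u a ^ cshift n b * poly Y (u a) = 0 else poly Y (u a) = 0"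
    by blast
  define v where "v c = (if c < qcard n b then coeff X c else coeff Y (c - qcard n b))" for c
  have "(\<Sum>c<n. colent n b c (H a) (u a) * v c) = 0" if "a \<in> {1..n}" for a
    using z[OF that] by (subst sum_colent[OF XY(2,3) v_def]) (auto split: if_splits)
  moreover have "\<exists>c<n. v c \<noteq> 0"
  proof (rule ccontr)
    assume "\<not> (\<exists>c<n. v c \<noteq> 0)"
    then have v0: "v c = 0" if "c < n" for c using that by blast
    have "coeff X i = 0" for i
      using v0[of i] XY(2)[of i] qcard_pcard[of n b] by (cases "i < qcard n b") (auto simp: v_def)
    moreover have "coeff Y i = 0" for i
      using v0[of "qcard n b + i"] XY(3)[of i] qcard_pcard[of n b] by (cases "i < pcard n b") (auto simp: v_def)
    ultimately show False using XY(1) by (auto simp: poly_eq_iff)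
  qed
  ultimately show "\<exists>v. (\<exists>c<n. v c \<noteq> 0) \<and> (\<forall>a\<in>{1..n}. (\<Sum>c<n. colent n b c (H a) (u a) * v c) = 0)"
    by blast
qed

text \<open>Write g, h, s for \<open>qcard\<close>, \<open>pcard\<close>, \<open>cshift\<close>, and
  let (X, Y) be a kernel pair. With g rows of kind H, the other h rows force Y = 0, and then X = 0.
  With g + 1 such rows, X + u^s Y has degree at most g and g + 1 roots, so it vanishes; its
  coefficient in degree g is that of Y in degree h - 1. Hence Y loses one degree, and the remaining
  h - 1 rows force it to vanish.\<close>

lemma rdet_colent_nonzero:
  fixes u :: "nat \<Rightarrow> 'k::field"
  assumes "qcard n b \<le> card {a \<in> {1..n}. H a}" "card {a \<in> {1..n}. H a} \<le> qcard n b + of_bool b"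
    and "inj_on u {a \<in> {1..n}. H a}" "inj_on u {a \<in> {1..n}. \<not> H a}"
  shows "rdet n (\<lambda>a c. colent n b c (H a) (u a)) \<noteq> 0"
proof
  let ?A = "{a \<in> {1..n}. H a}" and ?B = "{a \<in> {1..n}. \<not> H a}"
  let ?g = "qcard n b" and ?h = "pcard n b" and ?s = "cshift n b"
  assume "rdet n (\<lambda>a c. colent n b c (H a) (u a)) = 0"
  then obtain X Y where XY: "X \<noteq> 0 \<or> Y \<noteq> 0" "\<And>i. i \<ge> ?g \<Longrightarrow> coeff X i = 0" "\<And>i. i \<ge> ?h \<Longrightarrow> coeff Y i = 0"
    and z: "\<And>a. a \<in> {1..n} \<Longrightarrow> if H a then poly X (u a) + u a ^ ?s * poly Y (u a) = 0 else poly Y (u a) = 0"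
    unfolding rdet_colent_zero_iff by blast
  have card: "card ?A + card ?B = n"
  proof -
    have "card (?A \<union> ?B) = card ?A + card ?B" by (rule card_Un_disjoint) auto
    moreover have "?A \<union> ?B = {1..n}" by auto
    ultimately show ?thesis by simp
  qed
  have Y0: "X = 0" if "Y = 0"
  proof (rule poly_eq_0_of_roots[OF XY(2), where A = ?A and u = u])
    fix a assume "a \<in> ?A"
    then show "poly X (u a) = 0" using z[of a] that by simp
  qed (use assms(1,3) in auto)
  have "Y = 0"
  proof (cases "card ?A = ?g")
    case True
    then show ?thesis
      using z assms(4) card qcard_pcard[of n b] by (intro poly_eq_0_of_roots[OF XY(3), where A = ?B and u = u]) auto
  next
    case False
    with assms(1,2) have cA: "card ?A = Suc ?g" and b: "of_bool b = (1::nat)" by (cases b; simp)+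
    define Z where "Z = X + monom 1 ?s * Y"
    have cZ: "coeff Z i = coeff X i + (if ?s \<le> i then coeff Y (i - ?s) else 0)" for i
      by (simp add: Z_def coeff_monom_mult)
    have hs: "?h + ?s = Suc ?g" using pcard_cshift[of n b] b by simp
    have "Z = 0"
    proof (rule poly_eq_0_of_roots[where m = "Suc ?g" and p = Z and A = ?A and u = u])
      fix i assume "i \<ge> Suc ?g"
      then show "coeff Z i = 0" using XY(2,3) hs by (simp add: cZ)
    next
      fix a assume "a \<in> ?A"
      then show "poly Z (u a) = 0" using z[of a] by (simp add: Z_def poly_monom)
    qed (use cA assms(3) in auto)
    have "coeff Y i = 0" if "i \<ge> ?h - 1" for i
    proof (cases "i = ?h - 1 \<and> ?h \<noteq> 0")
      case True
      with hs have "?s + i = ?g" by auto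
      then have "coeff X (?s + i) = 0" using XY(2)[of "?s + i"] by simp
      with cZ[of "?s + i"] \<open>Z = 0\<close> show ?thesis by simp
    next
      case False
      then show ?thesis using that XY(3)[of i] by auto
    qed
    moreover have "card ?B \<ge> ?h - 1" using card qcard_pcard[of n b] cA by simp
    ultimately show ?thesis
      using z assms(4) by (intro poly_eq_0_of_roots[where m = "?h - 1" and p = Y and A = ?B and u = u]) auto
  qed
  with Y0 XY(1) show False by auto
qed

text \<open>Outside this range there is an explicit kernel pair, whatever the nodes are. With too
  few rows of kind H, X has their nodes as roots and Y = 0. With too many, Y has the other nodes as
  roots, and X = - u^s Y still obeys its degree bound.\<close>

lemma rdet_colent_nonzeroD:
  fixes u :: "nat \<Rightarrow> 'k::field"
  assumes nz: "rdet n (\<lambda>a c. colent n b c (H a) (u a)) \<noteq> 0"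
  shows "qcard n b \<le> card {a \<in> {1..n}. H a}" "card {a \<in> {1..n}. H a} \<le> qcard n b + of_bool b"
proof -
  let ?A = "{a \<in> {1..n}. H a}" and ?B = "{a \<in> {1..n}. \<not> H a}"
  let ?g = "qcard n b" and ?h = "pcard n b" and ?s = "cshift n b"
  let ?P = "\<lambda>A. \<Prod>a\<in>A. [:- u a, 1:]"
  have card: "card ?A + card ?B = n"
  proof -
    have "card (?A \<union> ?B) = card ?A + card ?B" by (rule card_Un_disjoint) auto
    moreover have "?A \<union> ?B = {1..n}" by auto
    ultimately show ?thesis by simp
  qed
  have root: "poly (?P A) (u a) = 0" if "a \<in> A" "finite A" for A a
    using that by (auto simp: poly_prod)
  show "?g \<le> card ?A"
  proof (rule ccontr)
    assume *: "\<not> ?g \<le> card ?A"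
    have "coeff (?P ?A) i = 0" if "i \<ge> ?g" for i
      using * that by (intro coeff_eq_0) (simp add: degree_linear_prod)
    then have "rdet n (\<lambda>a c. colent n b c (H a) (u a)) = 0"
      unfolding rdet_colent_zero_iff using root[of _ ?A] linear_prod_nonzero[of "\<lambda>a. - u a" ?A]
      by (intro exI[of _ "?P ?A"] exI[of _ 0]) auto
    with nz show False by simp
  qed
  show "card ?A \<le> ?g + of_bool b"
  proof (rule ccontr)
    assume *: "\<not> card ?A \<le> ?g + of_bool b"
    then have lt: "card ?B + of_bool b < ?h" using card qcard_pcard[of n b] by simp
    have Y: "coeff (?P ?B) i = 0" if "i \<ge> ?h" for i
      using lt that by (intro coeff_eq_0) (simp add: degree_linear_prod)
    have X: "coeff (- (monom 1 ?s * ?P ?B)) i = 0" if "i \<ge> ?g" for i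
    proof -
      have "card ?B < i - ?s" using lt that pcard_cshift[of n b] by simp
      then show ?thesis by (simp add: coeff_monom_mult coeff_eq_0 degree_linear_prod)
    qed
    have "rdet n (\<lambda>a c. colent n b c (H a) (u a)) = 0"
      unfolding rdet_colent_zero_iff using X Y root[of _ ?B] linear_prod_nonzero[of "\<lambda>a. - u a" ?B]
      by (intro exI[of _ "- (monom 1 ?s * ?P ?B)"] exI[of _ "?P ?B"]) (auto simp: poly_monom)
    with nz show False by simp
  qed
qed

section \<open>Vandermonde products and symmetric functions of the parity classes\<close>

definition cpairs :: "nat \<Rightarrow> (nat \<times> nat) set" where
  "cpairs n = {(i, j). 1 \<le> i \<and> i < j \<and> j \<le> n \<and> even (i + j)}"

definition vandermonde :: "nat \<Rightarrow> (nat \<Rightarrow> 'k) \<Rightarrow> 'k::comm_ring_1" where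
  "vandermonde n z = (\<Prod>(i, j)\<in>cpairs n. z i - z j)"

lemma finite_cpairs [simp]: "finite (cpairs n)"
  by (rule finite_subset[of _ "{1..n} \<times> {1..n}"]) (auto simp: cpairs_def)

text \<open>The degree of the two Vandermonde products together, in the shape in which the column
  degrees of the determinant produce it.\<close>

lemma card_cpairs_eq: "card (cpairs n) = (\<Sum>c<qcard n b. c) + (\<Sum>l<pcard n b. l)"
proof -
  let ?Q = "\<lambda>C. {(i, j). i \<in> C \<and> j \<in> C \<and> i < j}"
  have fin: "finite (?Q (pclass n c))" for c
    by (rule finite_subset[of _ "pclass n c \<times> pclass n c"]) auto
  have "cpairs n = ?Q (pclass n (\<not> b)) \<union> ?Q (pclass n b)"
    unfolding cpairs_def pclass_def by (cases b) auto
  moreover have "?Q (pclass n (\<not> b)) \<inter> ?Q (pclass n b) = {}" by (auto simp: pclass_def)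
  ultimately have "card (cpairs n) = card (?Q (pclass n (\<not> b))) + card (?Q (pclass n b))"
    using fin by (simp add: card_Un_disjoint)
  moreover have "card (pclass n (\<not> b)) = qcard n b"
    unfolding pclass_Not qcard_def pcard_def by (subst card_Diff_subset) (auto simp: pclass_def)
  ultimately show ?thesis by (simp add: card_cpairs pcard_def)
qed

lemma vandermonde_nonzero:
  fixes z :: "nat \<Rightarrow> 'k::idom"
  assumes "\<And>i j. 1 \<le> i \<Longrightarrow> i < j \<Longrightarrow> j \<le> n \<Longrightarrow> even (i + j) \<Longrightarrow> z i \<noteq> z j"
  shows "vandermonde n z \<noteq> 0"
proof -
  have "(case t of (i, j) \<Rightarrow> z i - z j) \<noteq> 0" if "t \<in> cpairs n" for t
    using assms that by (auto simp: cpairs_def)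
  then show ?thesis unfolding vandermonde_def by (simp add: prod_zero_iff)
qed

text \<open>The index k is the power of t in the product of the z_a + t, so this is the elementary
  symmetric polynomial of degree |A| - k.\<close>

definition esym :: "nat set \<Rightarrow> nat \<Rightarrow> (nat \<Rightarrow> 'k) \<Rightarrow> 'k::comm_ring_1" where
  "esym A k z = coeff (\<Prod>a\<in>A. [:z a, 1:]) k"

lemma Pol_esym:
  assumes "finite A" "A \<subseteq> {1..n}"
  shows "Pol n (int (card A) - int k) (esym A k :: (nat \<Rightarrow> 'k::comm_ring_1) \<Rightarrow> 'k)"
  using assms
proof (induction A arbitrary: k rule: finite_induct)
  case empty
  then show ?case by (cases k) (auto simp: esym_def intro: Pol_const)
next
  case (insert x A)
  have eq: "esym (insert x A) k = (\<lambda>z :: nat \<Rightarrow> 'k. z x * esym A k z + (case k of 0 \<Rightarrow> 0 | Suc k \<Rightarrow> esym A k z))"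
    using insert.hyps by (cases k) (simp_all add: esym_def coeff_pCons fun_eq_iff)
  have "Pol n (int (card (insert x A)) - int k) (\<lambda>z :: nat \<Rightarrow> 'k. z x * esym A k z)"
    using insert by (intro Pol_mult'[OF Pol_Var[OF order.refl] insert.IH]) auto
  moreover have "Pol n (int (card (insert x A)) - int k) (\<lambda>z :: nat \<Rightarrow> 'k. case k of 0 \<Rightarrow> 0 | Suc k \<Rightarrow> esym A k z)"
  proof (cases k)
    case (Suc k')
    have "Pol n (int (card A) - int k') (esym A k' :: (nat \<Rightarrow> 'k) \<Rightarrow> 'k)" using insert.prems by (intro insert.IH) auto
    then show ?thesis using insert.hyps Suc by (simp add: algebra_simps)
  qed simp
  ultimately show ?case unfolding eq by (rule Pol_add)
qed

lemma esym_card: "finite A \<Longrightarrow> esym A (card A) z = (1::'k::idom)"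
  unfolding esym_def by (rule monic_linear_prod)

lemma esym_gt: "finite A \<Longrightarrow> card A < k \<Longrightarrow> esym A k z = (0::'k::idom)"
  unfolding esym_def by (intro coeff_eq_0) (simp add: degree_linear_prod)

lemma bij_pclass: "\<pi> \<in> W n \<Longrightarrow> bij_betw \<pi> (pclass n b) (pclass n b)"
proof (rule bij_betw_imageI)
  assume \<pi>: "\<pi> \<in> W n"
  note p = W_permutes[OF \<pi>]
  show inj: "inj_on \<pi> (pclass n b)"
    by (rule inj_on_subset[OF permutes_inj[OF p]]) simp
  have "\<pi> ` pclass n b \<subseteq> pclass n b"
    using W_parity[OF \<pi>] permutes_in_image[OF p] by (auto simp: pclass_def)
  then show "\<pi> ` pclass n b = pclass n b"
    using inj by (intro endo_inj_surj) auto
qed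

lemma Winv_esym: "Winv n (esym (pclass n b) k :: (nat \<Rightarrow> 'k::comm_ring_1) \<Rightarrow> 'k)"
  unfolding Winv_def esym_def
proof safe
  fix \<pi> and x :: "nat \<Rightarrow> 'k" assume "\<pi> \<in> W n"
  from prod.reindex_bij_betw[OF bij_pclass[OF this, of b], of "\<lambda>a. [:x a, 1:]"]
  show "coeff (\<Prod>a\<in>pclass n b. [:x (\<pi> a), 1:]) k = coeff (\<Prod>a\<in>pclass n b. [:x a, 1:]) k" by simp
qed

section \<open>The difference operators\<close>

lemma same_lead_mult_power:
  "same_lead n (int i) F (\<lambda>x. x a ^ i) \<Longrightarrow> same_lead n (int j) G (\<lambda>x. x a ^ j) \<Longrightarrow>
    same_lead n (int (i + j)) (\<lambda>x. F x * G x) (\<lambda>x. x a ^ (i + j))"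
  using same_lead_mult[of n "int i" F "\<lambda>x. x a ^ i" "int j" G "\<lambda>x. x a ^ j"] by (simp add: power_add)

lemma same_lead_shift_power: "a \<in> {1..n} \<Longrightarrow> same_lead n (int i) (\<lambda>x. (x a + b) ^ i) (\<lambda>x. x a ^ i)"
  using same_lead_power[OF same_lead_Var, of a n i b] by simp

lemma same_lead_imp_Pol:
  assumes "same_lead n d F H"
  shows "Pol n d F"
proof -
  have "Pol n d (\<lambda>x. (F x - H x) + H x)"
    using assms unfolding same_lead_def by (intro Pol_add) (auto intro: Pol_mono)
  then show ?thesis by simp
qed

lemma Pol_0_const:
  assumes "Pol n 0 F"
  shows "F x = F y"
proof (rule mspan_cong[OF assms[unfolded Pol_def]])
  fix m i assume "m \<in> {m. Poly_Mapping.keys m \<subseteq> {1..n} \<and> int (monom_deg m) \<le> 0}" "i \<in> Poly_Mapping.keys m"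
  then have "monom_deg m = 0" and i: "i \<in> Poly_Mapping.keys m" by auto
  moreover have "Poly_Mapping.lookup m i \<le> monom_deg m"
    unfolding monom_deg_def using i by (intro member_le_sum[where f = "Poly_Mapping.lookup m"]) auto
  ultimately show "x i = y i" by (simp add: in_keys_iff)
qed

context semisym
begin

text \<open>If a is in K and a + 1 is not, their nodes coincide exactly when z_a = z_(a+1) + r,
  whatever the parity of a. In the opposite case the condition is z_(a+1) = z_a + r, which is the
  wall at the reflected points.\<close>

definition node :: "nat set \<Rightarrow> nat \<Rightarrow> (nat \<Rightarrow> 'k) \<Rightarrow> 'k" where
  "node K a z = (if odd a then z a else if a \<in> K then z a - r else z a + r)"

definition node_det :: "bool \<Rightarrow> nat set \<Rightarrow> (nat \<Rightarrow> 'k) \<Rightarrow> 'k" where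
  "node_det b K z = rdet n (\<lambda>a c. colent n b c (rowH b K a) (node K a z))"

text \<open>Its factor at a = n prevents the last component from being lowered below 0; the other
  factors are there for the symmetry under W.\<close>

definition weight :: "nat set \<Rightarrow> (nat \<Rightarrow> 'k) \<Rightarrow> 'k" where
  "weight K z = (\<Prod>a\<in>K. if even (n + a) then z a else 1)"

definition down :: "nat set \<Rightarrow> (nat \<Rightarrow> 'k) \<Rightarrow> nat \<Rightarrow> 'k" where
  "down K z i = z i - of_bool (i \<in> K)"

text \<open>Up to the Vandermonde product \<open>vandermonde\<close>, this is a difference operator whose
  eigenfunctions are the \<open>R\<^sub>\<lambda>\<close>, with eigenvalues \<open>\<Prod>\<^sub>a (\<rho>\<^sub>a + \<lambda>\<^sub>a + t)\<close>, the product ranging over one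
  parity class. The sum over \<open>K\<close> is the Laplace-type expansion of a single determinant, from
  which one sees that the operator does not raise degrees.\<close>

definition shift_op :: "bool \<Rightarrow> 'k \<Rightarrow> ((nat \<Rightarrow> 'k) \<Rightarrow> 'k) \<Rightarrow> (nat \<Rightarrow> 'k) \<Rightarrow> 'k" where
  "shift_op b t f z = (\<Sum>K\<in>Pow {1..n}. weight K z * (\<Prod>a\<in>pclass n b - K. z a + t) * node_det b K z * f (down K z))"

text \<open>The coefficient of t^k in \<open>shift_op\<close>. On \<open>Rf l\<close> its eigenvalue
  is an elementary symmetric polynomial of rho + l, whose degree is chosen through k.\<close>

definition op_coeff :: "bool \<Rightarrow> nat \<Rightarrow> ((nat \<Rightarrow> 'k) \<Rightarrow> 'k) \<Rightarrow> (nat \<Rightarrow> 'k) \<Rightarrow> 'k" where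
  "op_coeff b k f z = (\<Sum>K\<in>Pow {1..n}. weight K z * esym (pclass n b - K) k z * node_det b K z * f (down K z))"

text \<open>The row of a variable inside K plus its row outside K, each with its share of the
  weights and of the monomial m.\<close>

definition entry :: "bool \<Rightarrow> 'k \<Rightarrow> (nat \<Rightarrow>\<^sub>0 nat) \<Rightarrow> nat \<Rightarrow> nat \<Rightarrow> (nat \<Rightarrow> 'k) \<Rightarrow> 'k" where
  "entry b t m a c z =
    (if even (n + a) then z a else 1) * (z a - 1) ^ Poly_Mapping.lookup m a
      * colent n b c (odd a = b) (if odd a then z a else z a - r)
    + (if odd a = b then z a + t else 1) * z a ^ Poly_Mapping.lookup m a
      * colent n b c (odd a \<noteq> b) (if odd a then z a else z a + r)"

lemma shift_op_monomial:
  assumes "Poly_Mapping.keys m \<subseteq> {1..n}"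
  shows "shift_op b t (mval m) z = rdet n (\<lambda>a c. entry b t m a c z)"
  unfolding entry_def rdet_add shift_op_def
proof (rule sum.cong[OF refl])
  fix K assume K: "K \<in> Pow {1..n}"
  let ?m = "Poly_Mapping.lookup m"
  define w where "w a = (if a \<in> K then if even (n + a) then z a else 1 else if odd a = b then z a + t else 1)
      * down K z a ^ ?m a" for a
  have "rdet n (\<lambda>a c. if a \<in> K
      then (if even (n + a) then z a else 1) * (z a - 1) ^ ?m a
        * colent n b c (odd a = b) (if odd a then z a else z a - r)
      else (if odd a = b then z a + t else 1) * z a ^ ?m a
        * colent n b c (odd a \<noteq> b) (if odd a then z a else z a + r)) =
    rdet n (\<lambda>a c. w a * colent n b c (rowH b K a) (node K a z))"
    by (rule rdet_cong) (simp add: w_def rowH_def node_def down_def)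
  also have "\<dots> = (\<Prod>a\<in>{1..n}. w a) * node_det b K z" unfolding rdet_scale node_det_def ..
  also have "(\<Prod>a\<in>{1..n}. w a) = weight K z * (\<Prod>a\<in>pclass n b - K. z a + t) * mval m (down K z)"
  proof -
    have 1: "{1..n} \<inter> {x. x \<in> K} = K" "{1..n} \<inter> - {x. x \<in> K} = {1..n} - K"
      "{1..n} \<inter> K = K" "{1..n} \<inter> - K = {1..n} - K" using K by auto
    have 2: "(\<Prod>a\<in>{1..n} - K. if odd a = b then z a + t else 1) = (\<Prod>a\<in>pclass n b - K. z a + t)"
      by (rule prod.mono_neutral_cong_right) (auto simp: pclass_def)
    show ?thesis
      unfolding w_def prod.distrib weight_def by (subst prod.If_cases) (simp_all add: 1 2 mval_superset[OF _ assms])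
  qed
  finally show "weight K z * (\<Prod>a\<in>pclass n b - K. z a + t) * node_det b K z * mval m (down K z) =
    rdet n (\<lambda>a c. if a \<in> K
      then (if even (n + a) then z a else 1) * (z a - 1) ^ ?m a
        * colent n b c (odd a = b) (if odd a then z a else z a - r)
      else (if odd a = b then z a + t else 1) * z a ^ ?m a
        * colent n b c (odd a \<noteq> b) (if odd a then z a else z a + r))"
    by (simp add: mult_ac)
qed

text \<open>In the first \<open>qcard n b\<close> columns one of the two summands is zero. In the
  others both have the same leading monomial with opposite signs: \<open>cshift n b\<close> is 1
  exactly if the weight is missing in the rows of class \<open>b\<close> and present in the other
  rows. So one degree is lost there.\<close>

lemma Pol_entry:
  assumes a: "a \<in> {1..n}"
  shows "Pol n ((int (Poly_Mapping.lookup m a) + (if odd a = b then 1 - int (cshift n b) else 0)) +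
      (if c < qcard n b then int c else int (c - qcard n b) + int (cshift n b) - 1)) (entry b t m a c)"
proof -
  let ?k = "Poly_Mapping.lookup m a" and ?s = "cshift n b" and ?l = "c - qcard n b"
  define \<sigma> where "\<sigma> z = (if odd a then z a else z a - r)" for z :: "nat \<Rightarrow> 'k"
  define \<upsilon> where "\<upsilon> z = (if odd a then z a else z a + r)" for z :: "nat \<Rightarrow> 'k"
  define w where "w z = (if even (n + a) then z a else 1)" for z :: "nat \<Rightarrow> 'k"
  have \<sigma>: "same_lead n (int i) (\<lambda>z. \<sigma> z ^ i) (\<lambda>z. z a ^ i)" for i
    using same_lead_shift_power[OF a, of i 0] same_lead_shift_power[OF a, of i "- r"]
    by (cases "odd a") (simp_all add: \<sigma>_def)
  have \<upsilon>: "same_lead n (int i) (\<lambda>z. \<upsilon> z ^ i) (\<lambda>z. z a ^ i)" for i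
    using same_lead_shift_power[OF a, of i 0] same_lead_shift_power[OF a, of i r]
    by (cases "odd a") (simp_all add: \<upsilon>_def)
  have k1: "same_lead n (int ?k) (\<lambda>z. (z a - 1) ^ ?k) (\<lambda>z. z a ^ ?k)"
    using same_lead_shift_power[OF a, of ?k "- 1"] by simp
  have k0: "same_lead n (int ?k) (\<lambda>z. z a ^ ?k) (\<lambda>z. z a ^ ?k)"
    using same_lead_shift_power[OF a, of ?k 0] by simp
  have zt: "same_lead n (int 1) (\<lambda>z. z a + t) (\<lambda>z. z a ^ 1)"
    using same_lead_shift_power[OF a, of 1 t] by simp
  define e where "e = (if even (n + a) then 1 else 0 :: nat)"
  have w: "same_lead n (int e) w (\<lambda>z. z a ^ e)"
    using same_lead_shift_power[OF a, of 1 0] same_lead_shift_power[OF a, of 0 0]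
    by (cases "even (n + a)") (simp_all add: w_def[abs_def] e_def)
  show ?thesis
  proof (cases "odd a = b")
    case True
    have esym: "e + ?s = 1"
      using True by (cases "even n"; cases "odd a"; cases b) (simp_all add: e_def cshift_def)
    show ?thesis
    proof (cases "c < qcard n b")
      case c: True
      have "same_lead n (int (e + ?k + c)) (\<lambda>z. w z * (z a - 1) ^ ?k * \<sigma> z ^ c) (\<lambda>z. z a ^ (e + ?k + c))"
        by (intro same_lead_mult_power w k1 \<sigma>)
      moreover have "entry b t m a c = (\<lambda>z. w z * (z a - 1) ^ ?k * \<sigma> z ^ c)"
        using True c by (auto simp: entry_def colent_def w_def \<sigma>_def fun_eq_iff)
      ultimately have "Pol n (int (e + ?k + c)) (entry b t m a c)" by (metis same_lead_imp_Pol)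
      then show ?thesis using True c esym by (elim Pol_mono) auto
    next
      case c: False
      have "same_lead n (int (e + ?k + (?l + ?s))) (\<lambda>z. w z * (z a - 1) ^ ?k * \<sigma> z ^ (?l + ?s))
          (\<lambda>z. z a ^ (e + ?k + (?l + ?s)))"
        by (intro same_lead_mult_power w k1 \<sigma>)
      moreover have "same_lead n (int (1 + ?k + ?l)) (\<lambda>z. (z a + t) * z a ^ ?k * \<upsilon> z ^ ?l) (\<lambda>z. z a ^ (1 + ?k + ?l))"
        by (intro same_lead_mult_power zt k0 \<upsilon>)
      moreover have eq: "e + ?k + (?l + ?s) = 1 + ?k + ?l" using esym by simp
      ultimately have "Pol n (int (1 + ?k + ?l) - 1)
          (\<lambda>z. w z * (z a - 1) ^ ?k * \<sigma> z ^ (?l + ?s) - (z a + t) * z a ^ ?k * \<upsilon> z ^ ?l)"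
        unfolding eq by (intro same_lead_diff)
      moreover have "entry b t m a c = (\<lambda>z. w z * (z a - 1) ^ ?k * \<sigma> z ^ (?l + ?s) - (z a + t) * z a ^ ?k * \<upsilon> z ^ ?l)"
        using True c by (auto simp: entry_def colent_def w_def \<sigma>_def \<upsilon>_def fun_eq_iff)
      ultimately have "Pol n (int (1 + ?k + ?l) - 1) (entry b t m a c)" by simp
      then show ?thesis using True c by (elim Pol_mono) auto
    qed
  next
    case False
    have esym: "e = ?s"
      using False by (cases "even n"; cases "odd a"; cases b) (simp_all add: e_def cshift_def)
    show ?thesis
    proof (cases "c < qcard n b")
      case c: True
      have "same_lead n (int (?k + c)) (\<lambda>z. z a ^ ?k * \<upsilon> z ^ c) (\<lambda>z. z a ^ (?k + c))"
        by (intro same_lead_mult_power k0 \<upsilon>)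
      moreover have "entry b t m a c = (\<lambda>z. z a ^ ?k * \<upsilon> z ^ c)"
        using False c by (auto simp: entry_def colent_def w_def \<upsilon>_def fun_eq_iff)
      ultimately have "Pol n (int (?k + c)) (entry b t m a c)" by (metis same_lead_imp_Pol)
      then show ?thesis using False c by (elim Pol_mono) auto
    next
      case c: False
      have "same_lead n (int (e + ?k + ?l)) (\<lambda>z. w z * (z a - 1) ^ ?k * \<sigma> z ^ ?l) (\<lambda>z. z a ^ (e + ?k + ?l))"
        by (intro same_lead_mult_power w k1 \<sigma>)
      moreover have "same_lead n (int (?k + (?l + ?s))) (\<lambda>z. z a ^ ?k * \<upsilon> z ^ (?l + ?s)) (\<lambda>z. z a ^ (?k + (?l + ?s)))"
        by (intro same_lead_mult_power k0 \<upsilon>)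
      moreover have eq: "e + ?k + ?l = ?k + (?l + ?s)" using esym by simp
      ultimately have "Pol n (int (?k + (?l + ?s)) - 1)
          (\<lambda>z. z a ^ ?k * \<upsilon> z ^ (?l + ?s) - w z * (z a - 1) ^ ?k * \<sigma> z ^ ?l)"
        unfolding eq by (intro same_lead_diff)
      moreover have "entry b t m a c = (\<lambda>z. z a ^ ?k * \<upsilon> z ^ (?l + ?s) - w z * (z a - 1) ^ ?k * \<sigma> z ^ ?l)"
        using False c by (auto simp: entry_def colent_def w_def \<sigma>_def \<upsilon>_def fun_eq_iff)
      ultimately have "Pol n (int (?k + (?l + ?s)) - 1) (entry b t m a c)" by simp
      then show ?thesis using False c by (elim Pol_mono) auto
    qed
  qed
qed

text \<open>The excess 1 - s of the \<open>pcard n b\<close> rows of class \<open>b\<close>, s being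
  the offset, is balanced by the deficit of equally many columns. The degree of m and that of the
  Vandermonde product remain.\<close>

lemma Pol_shift_op_monomial:
  assumes "Poly_Mapping.keys m \<subseteq> {1..n}"
  shows "Pol n (int (monom_deg m) + int (card (cpairs n))) (shift_op b t (mval m))"
proof -
  let ?s = "int (cshift n b)" and ?g = "qcard n b" and ?h = "pcard n b"
  let ?rd = "\<lambda>a. int (Poly_Mapping.lookup m a) + (if odd a = b then 1 - ?s else 0)"
  let ?cd = "\<lambda>c. if c < ?g then int c else int (c - ?g) + ?s - 1"
  have "Pol n ((\<Sum>a\<in>{1..n}. ?rd a) + (\<Sum>c<n. ?cd c)) (\<lambda>z. rdet n (\<lambda>a c. entry b t m a c z))"
    by (intro rdet_Pol Pol_entry) simp
  moreover have "(\<Sum>a\<in>{1..n}. ?rd a) = int (monom_deg m) + int ?h * (1 - ?s)"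
  proof -
    have "(\<Sum>a\<in>{1..n}. if odd a = b then 1 - ?s else 0) = (\<Sum>a\<in>pclass n b. 1 - ?s)"
      by (rule sum.mono_neutral_cong_right) (auto simp: pclass_def)
    then show ?thesis
      by (simp add: sum.distrib monom_deg_superset[OF _ assms] pcard_def)
  qed
  moreover have "(\<Sum>c<n. ?cd c) = int (card (cpairs n)) - int ?h * (1 - ?s)"
  proof -
    have "(\<Sum>c<n. ?cd c) = (\<Sum>c<?g. ?cd c) + (\<Sum>l<?h. ?cd (?g + l))"
      using sum_lessThan_add[of ?cd ?g ?h] by (simp add: qcard_pcard)
    also have "(\<Sum>c<?g. ?cd c) = (\<Sum>c<?g. int c)" by (rule sum.cong) auto
    also have "(\<Sum>l<?h. ?cd (?g + l)) = (\<Sum>l<?h. int l + (?s - 1))" by (rule sum.cong) auto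
    also have "\<dots> = (\<Sum>l<?h. int l) + int ?h * (?s - 1)" by (simp add: sum.distrib)
    finally show ?thesis unfolding card_cpairs_eq[of n b] by (simp add: algebra_simps)
  qed
  moreover have "shift_op b t (mval m) = (\<lambda>z. rdet n (\<lambda>a c. entry b t m a c z))"
    using shift_op_monomial[OF assms] by (simp add: fun_eq_iff)
  ultimately show ?thesis by simp
qed

lemma Pol_shift_op:
  assumes "Pol n d f"
  shows "Pol n (d + int (card (cpairs n))) (shift_op b t f)"
  using assms unfolding Pol_def
proof induction
  case mspan_zero
  then show ?case by (simp add: shift_op_def mspan.mspan_zero)
next
  case (mspan_step f m c)
  have "Pol n (d + int (card (cpairs n))) (\<lambda>z. c * shift_op b t (mval m) z)"
    using mspan_step.hyps by (intro Pol_scale Pol_mono[OF Pol_shift_op_monomial]) auto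
  from Pol_add[OF mspan_step.IH[folded Pol_def] this]
  have "Pol n (d + int (card (cpairs n))) (\<lambda>z. shift_op b t f z + c * shift_op b t (mval m) z)" .
  moreover have "shift_op b t (\<lambda>x. f x + c * mval m x) = (\<lambda>z. shift_op b t f z + c * shift_op b t (mval m) z)"
    by (simp add: shift_op_def fun_eq_iff algebra_simps sum.distrib sum_distrib_left)
  ultimately show ?case unfolding Pol_def by simp
qed

section \<open>Symmetry, and division by the Vandermonde product\<close>

lemma node_det_permute:
  assumes \<pi>: "\<pi> \<in> W n"
  shows "node_det b K (\<lambda>i. z (\<pi> i)) =
    rdet n (\<lambda>a. (\<lambda>a c. colent n b c (rowH b (\<pi> ` K) a) (node (\<pi> ` K) a z)) (\<pi> a))"
proof -
  have "\<pi> a \<in> \<pi> ` K \<longleftrightarrow> a \<in> K" for a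
    using permutes_inj[OF W_permutes[OF \<pi>]] by (simp add: inj_image_mem_iff)
  then show ?thesis
    unfolding node_det_def by (intro rdet_cong) (simp add: rowH_def node_def W_parity[OF \<pi>])
qed

lemma node_det_permute':
  assumes "\<pi> \<in> W n" "\<And>A. rdet n (\<lambda>a. A (\<pi> a)) = e * rdet n A"
  shows "node_det b K (\<lambda>i. z (\<pi> i)) = e * node_det b (\<pi> ` K) z"
  using node_det_permute[OF assms(1), of b K z]
    assms(2)[of "\<lambda>a c. colent n b c (rowH b (\<pi> ` K) a) (node (\<pi> ` K) a z)"]
  unfolding node_det_def[of b "\<pi> ` K" z] by (rule trans)

lemma shift_op_permute:
  assumes \<pi>: "\<pi> \<in> W n" and f: "Winv n f"
    and e: "\<And>K. node_det b K (\<lambda>i. z (\<pi> i)) = e * node_det b (\<pi> ` K) z"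
  shows "shift_op b t f (\<lambda>i. z (\<pi> i)) = e * shift_op b t f z"
proof -
  note p = W_permutes[OF \<pi>]
  have inj: "inj_on \<pi> A" for A by (rule inj_on_subset[OF permutes_inj[OF p]]) simp
  let ?h = "\<lambda>K. weight K z * (\<Prod>a\<in>pclass n b - K. z a + t) * node_det b K z * f (down K z)"
  have "shift_op b t f (\<lambda>i. z (\<pi> i)) = (\<Sum>K\<in>Pow {1..n}. e * ?h (\<pi> ` K))"
    unfolding shift_op_def
  proof (rule sum.cong[OF refl])
    fix K assume "K \<in> Pow {1..n}"
    have "weight (\<pi> ` K) z = weight K (\<lambda>i. z (\<pi> i))"
      unfolding weight_def by (subst prod.reindex[OF inj]) (simp add: W_parity[OF \<pi>])
    moreover have "(\<Prod>a\<in>pclass n b - \<pi> ` K. z a + t) = (\<Prod>a\<in>pclass n b - K. z (\<pi> a) + t)"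
    proof -
      have "pclass n b - \<pi> ` K = \<pi> ` (pclass n b - K)"
        using bij_betw_imp_surj_on[OF bij_pclass[OF \<pi>, of b]] image_set_diff[OF permutes_inj[OF p], of "pclass n b" K] by simp
      then show ?thesis by (simp add: prod.reindex[OF inj])
    qed
    moreover have "f (down K (\<lambda>i. z (\<pi> i))) = f (down (\<pi> ` K) z)"
    proof -
      have "down K (\<lambda>i. z (\<pi> i)) = (\<lambda>i. down (\<pi> ` K) z (\<pi> i))"
        using permutes_inj[OF p] by (simp add: down_def fun_eq_iff inj_image_mem_iff)
      then show ?thesis using Winv_permute[OF f \<pi>] by simp
    qed
    ultimately show "weight K (\<lambda>i. z (\<pi> i)) * (\<Prod>a\<in>pclass n b - K. z (\<pi> a) + t) * node_det b K (\<lambda>i. z (\<pi> i)) *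
        f (down K (\<lambda>i. z (\<pi> i))) = e * ?h (\<pi> ` K)"
      by (simp add: e mult_ac)
  qed
  also have "\<dots> = (\<Sum>K\<in>Pow {1..n}. e * ?h K)"
    using sum.reindex_bij_betw[OF bij_betw_Pow[OF permutes_imp_bij[OF p]], of "\<lambda>K. e * ?h K"] .
  finally show ?thesis by (simp add: shift_op_def sum_distrib_left)
qed

text \<open>Transposing two equal coordinates fixes the point but changes the sign of the
  value.\<close>

lemma shift_op_zero_on_cpairs:
  assumes "Winv n f" "(i, j) \<in> cpairs n" "x i = x j"
  shows "shift_op b t f x = 0"
proof -
  let ?\<pi> = "Transposition.transpose i j"
  from assms(2) have ij: "i \<in> {1..n}" "j \<in> {1..n}" "i \<noteq> j" "even (i + j)" by (auto simp: cpairs_def)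
  then have \<pi>: "?\<pi> \<in> W n" by (intro transpose_in_W)
  have "rdet n (\<lambda>a. A (?\<pi> a)) = (- 1) * rdet n A" for A :: "nat \<Rightarrow> nat \<Rightarrow> 'k"
    using rdet_swap[OF ij(1-3), of A] by simp
  from node_det_permute'[OF \<pi> this] have "node_det b K (\<lambda>i. x (?\<pi> i)) = (- 1) * node_det b (?\<pi> ` K) x" for K .
  from shift_op_permute[OF \<pi> assms(1) this] have "shift_op b t f (\<lambda>i. x (?\<pi> i)) = - shift_op b t f x" by simp
  moreover have "(\<lambda>i. x (?\<pi> i)) = x"
    using assms(3) by (auto simp: Transposition.transpose_def fun_eq_iff)
  ultimately show ?thesis by simp
qed

lemma shift_op_divisible:
  assumes "Pol n d f" "Winv n f"
  obtains g where "Pol n d g" "\<And>z. shift_op b t f z = vandermonde n z * g z"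
proof -
  have "\<exists>G. Pol n (d + int (card (cpairs n)) - int (card (cpairs n))) G \<and>
      (\<forall>x. shift_op b t f x = (\<Prod>(i, j)\<in>cpairs n. x i - x j) * G x)"
    by (rule Pol_divide_vandermonde[OF finite_cpairs _ Pol_shift_op[OF assms(1)]])
      (use shift_op_zero_on_cpairs[OF assms(2)] in \<open>auto simp: cpairs_def\<close>)
  with that show ?thesis by (auto simp: vandermonde_def)
qed

text \<open>The number of rows of kind H measures the imbalance of K between the two classes. This
  balance controls all later sums over K.\<close>

lemma node_det_nonzeroD:
  assumes "node_det b K z \<noteq> 0" "K \<subseteq> {1..n}"
  shows "card (K - pclass n b) \<le> card (K \<inter> pclass n b)" "card (K \<inter> pclass n b) \<le> card (K - pclass n b) + of_bool b"
  using rdet_colent_nonzeroD[OF assms(1)[unfolded node_det_def]] card_rowH[OF assms(2), of b] by auto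

lemma down_empty [simp]: "down {} z = z"
  by (simp add: down_def fun_eq_iff)

text \<open>The operator as a polynomial in t: identities valid for all t in the infinite field
  become identities between coefficients.\<close>

definition op_poly :: "bool \<Rightarrow> ((nat \<Rightarrow> 'k) \<Rightarrow> 'k) \<Rightarrow> (nat \<Rightarrow> 'k) \<Rightarrow> 'k poly" where
  "op_poly b f z = (\<Sum>K\<in>Pow {1..n}. Polynomial.smult (weight K z * node_det b K z * f (down K z)) (\<Prod>a\<in>pclass n b - K. [:z a, 1:]))"

lemma shift_op_eq_poly: "shift_op b t f z = poly (op_poly b f z) t"
  unfolding shift_op_def op_poly_def poly_sum by (rule sum.cong) (auto simp: poly_prod mult_ac)

lemma op_coeff_eq_coeff: "op_coeff b k f z = coeff (op_poly b f z) k"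
  unfolding op_coeff_def op_poly_def coeff_sum by (rule sum.cong) (auto simp: esym_def mult_ac)

text \<open>A set K that meets the class leaves too few factors z_a + t, and a nonempty K that
  avoids it is unbalanced. Only K = {} contributes.\<close>

lemma op_coeff_top: "op_coeff b (pcard n b) f z = node_det b {} z * f z"
proof -
  have "weight K z * esym (pclass n b - K) (pcard n b) z * node_det b K z * f (down K z) = 0"
    if K: "K \<in> Pow {1..n}" "K \<noteq> {}" for K
  proof (cases "K \<inter> pclass n b = {}")
    case False
    then have "card (pclass n b - K) < pcard n b"
      unfolding pcard_def by (intro psubset_card_mono) auto
    then show ?thesis by (simp add: esym_gt)
  next
    case True
    have "node_det b K z = 0"
    proof (rule ccontr)
      assume "node_det b K z \<noteq> 0"
      from node_det_nonzeroD(1)[OF this] K True have "card (K - pclass n b) = 0" by simp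
      moreover have "finite K" using K by (auto intro: finite_subset)
      ultimately show False using K True by auto
    qed
    then show ?thesis by simp
  qed
  then have "op_coeff b (pcard n b) f z = (\<Sum>K\<in>{{}}. weight K z * esym (pclass n b - K) (pcard n b) z * node_det b K z * f (down K z))"
    unfolding op_coeff_def by (intro sum.mono_neutral_right) auto
  also have "\<dots> = node_det b {} z * f z"
    using esym_card[OF finite_pclass[of n b], of z] by (simp add: weight_def down_def pcard_def)
  finally show ?thesis .
qed

lemma node_det_empty_nonzero:
  assumes "\<And>i j. 1 \<le> i \<Longrightarrow> i < j \<Longrightarrow> j \<le> n \<Longrightarrow> even (i + j) \<Longrightarrow> z i \<noteq> z j"
  shows "node_det b {} z \<noteq> 0"
  unfolding node_det_def
proof (rule rdet_colent_nonzero)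
  show "qcard n b \<le> card {a \<in> {1..n}. rowH b {} a}" "card {a \<in> {1..n}. rowH b {} a} \<le> qcard n b + of_bool b"
    using card_rowH[of "{}" n b] by auto
  have inj: "i = j" if "i \<in> {1..n}" "j \<in> {1..n}" "even (i + j)" "node {} i z = node {} j z" for i j
  proof -
    have "odd i = odd j" using that by auto
    then have "z i = z j" using that(4) by (simp add: node_def split: if_splits)
    then show ?thesis
      using assms[of i j] assms[of j i] that by (cases i j rule: linorder_cases) auto
  qed
  show "inj_on (\<lambda>a. node {} a z) {a \<in> {1..n}. rowH b {} a}"
    by (rule inj_onI, rule inj) (auto simp: rowH_def)
  show "inj_on (\<lambda>a. node {} a z) {a \<in> {1..n}. \<not> rowH b {} a}"
    by (rule inj_onI, rule inj) (auto simp: rowH_def)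
qed

text \<open>No determinant is evaluated: applied to the constant 1, the operator yields the
  Vandermonde product times a function of degree 0, for every t. The highest coefficient in t is
  \<open>node_det b {}\<close>.\<close>

lemma node_det_empty_vandermonde:
  obtains c where "c \<noteq> 0" "\<And>z. node_det b {} z = c * vandermonde n z"
proof -
  define z0 :: "nat \<Rightarrow> 'k" where "z0 = of_nat"
  have V0: "vandermonde n z0 \<noteq> 0" by (rule vandermonde_nonzero) (simp add: z0_def)
  have S0: "node_det b {} z0 \<noteq> 0" by (rule node_det_empty_nonzero) (simp add: z0_def)
  have "node_det b {} z * vandermonde n z0 = node_det b {} z0 * vandermonde n z" for z
  proof -
    have "poly (Polynomial.smult (vandermonde n z0) (op_poly b (\<lambda>_. 1) z)) t = poly (Polynomial.smult (vandermonde n z) (op_poly b (\<lambda>_. 1) z0)) t" for t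
    proof -
      obtain g where g: "Pol n 0 g" "\<And>z. shift_op b t (\<lambda>_. 1) z = vandermonde n z * g z"
        using shift_op_divisible[of 0 "\<lambda>_. 1" b t] Pol_const[of 0 n 1] by (auto simp: Winv_def)
      have "g z = g z0" by (rule Pol_0_const[OF g(1)])
      then show ?thesis by (simp flip: shift_op_eq_poly add: g(2))
    qed
    then have "Polynomial.smult (vandermonde n z0) (op_poly b (\<lambda>_. 1) z) = Polynomial.smult (vandermonde n z) (op_poly b (\<lambda>_. 1) z0)"
      by (simp flip: poly_eq_poly_eq_iff add: fun_eq_iff)
    then have "coeff (Polynomial.smult (vandermonde n z0) (op_poly b (\<lambda>_. 1) z)) (pcard n b) =
        coeff (Polynomial.smult (vandermonde n z) (op_poly b (\<lambda>_. 1) z0)) (pcard n b)" by simp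
    then show ?thesis by (simp flip: op_coeff_eq_coeff add: op_coeff_top mult_ac)
  qed
  then have "node_det b {} z = (node_det b {} z0 / vandermonde n z0) * vandermonde n z" for z
    using V0 by (metis nonzero_mult_div_cancel_right times_divide_eq_left)
  moreover have "node_det b {} z0 / vandermonde n z0 \<noteq> 0" using V0 S0 by simp
  ultimately show ?thesis using that by blast
qed

lemma Pol_node_det_empty: "Pol n (int (card (cpairs n))) (node_det b {})"
proof -
  obtain c where c: "\<And>z. node_det b {} z = c * vandermonde n z" by (rule node_det_empty_vandermonde[of b]) (rule that)
  have "Pol n (\<Sum>t\<in>cpairs n. 1) (\<lambda>z. \<Prod>t\<in>cpairs n. z (fst t) - z (snd t) :: 'k)"
    by (intro Pol_prod[OF finite_cpairs] Pol_diff Pol_Var) (auto simp: cpairs_def)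
  then have "Pol n (int (card (cpairs n))) (\<lambda>z. c * vandermonde n z)"
    by (intro Pol_scale) (simp add: vandermonde_def case_prod_beta)
  moreover have "node_det b {} = (\<lambda>z. c * vandermonde n z)" using c by (simp add: fun_eq_iff)
  ultimately show ?thesis by simp
qed

text \<open>Numerator and denominator acquire the same sign under W, so the quotient is invariant
  where the denominator is not zero, and by density everywhere.\<close>

lemma shift_op_quotient:
  assumes f: "Pol n d f" "Winv n f"
  obtains g where "Pol n d g" "Winv n g" "\<And>z. shift_op b t f z = node_det b {} z * g z"
proof -
  obtain g where g: "Pol n d g" "\<And>z. shift_op b t f z = vandermonde n z * g z" by (rule shift_op_divisible[OF f, of b t]) (rule that)
  obtain c where c: "c \<noteq> 0" "\<And>z. node_det b {} z = c * vandermonde n z" by (rule node_det_empty_vandermonde[of b]) (rule that)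
  define g' where "g' z = (1 / c) * g z" for z
  have g': "Pol n d g'" "\<And>z. shift_op b t f z = node_det b {} z * g' z"
    unfolding g'_def by (rule Pol_scale[OF g(1)]) (simp add: g(2) c)
  have "g' (\<lambda>i. z (\<pi> i)) - g' z = 0" if \<pi>: "\<pi> \<in> W n" for \<pi> z
  proof (rule Pol_density[of n d "\<lambda>z. g' (\<lambda>i. z (\<pi> i)) - g' z" _ "node_det b {}" of_nat])
    show "Pol n d (\<lambda>z. g' (\<lambda>i. z (\<pi> i)) - g' z)"
      by (intro Pol_diff g' Pol_permute[OF g'(1) W_permutes[OF \<pi>]])
    show "node_det b {} of_nat \<noteq> 0" by (rule node_det_empty_nonzero) simp
    fix z :: "nat \<Rightarrow> 'k" assume nz: "node_det b {} z \<noteq> 0"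
    obtain e :: 'k where e: "e * e = 1" "\<And>A. rdet n (\<lambda>a. A (\<pi> a)) = e * rdet n A"
      by (rule rdet_permute[OF W_permutes[OF \<pi>]]) (rule that)
    have *: "node_det b K (\<lambda>i. z (\<pi> i)) = e * node_det b (\<pi> ` K) z" for K
      by (rule node_det_permute'[OF \<pi> e(2)])
    have "e * node_det b {} z * g' (\<lambda>i. z (\<pi> i)) = e * node_det b {} z * g' z"
      using shift_op_permute[OF \<pi> f(2) *, of t] *[of "{}"] unfolding g'(2) by (simp add: mult_ac)
    moreover have "e \<noteq> 0" using e(1) by auto
    ultimately show "g' (\<lambda>i. z (\<pi> i)) - g' z = 0" using nz by simp
  qed (rule Pol_node_det_empty)
  then have "Winv n g'" by (simp add: Winv_def)
  with g' that show ?thesis by blast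
qed

text \<open>Indices of opposite parity, one inside K and one outside, give rows of the same
  kind.\<close>

lemma node_det_equal_nodes:
  assumes "a \<in> {1..n}" "a' \<in> {1..n}" "a \<in> K" "a' \<notin> K" "odd a \<noteq> odd a'" "node K a z = node K a' z"
  shows "node_det b K z = 0"
  unfolding node_det_def
proof (rule rdet_equal_rows[of a n a'])
  fix c
  have "rowH b K a = rowH b K a'" using assms by (auto simp: rowH_def)
  then show "colent n b c (rowH b K a) (node K a z) = colent n b c (rowH b K a') (node K a' z)"
    using assms(6) by simp
qed (use assms in auto)

end

section \<open>The binomial formula\<close>

lemma Winv_diff: "Winv n F \<Longrightarrow> Winv n G \<Longrightarrow> Winv n (\<lambda>x. F x - G x)"
  by (simp add: Winv_def)

lemma Winv_scale: "Winv n F \<Longrightarrow> Winv n (\<lambda>x. c * F x)"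
  by (simp add: Winv_def)

section \<open>Moving tuples by index sets, and an order on tuples\<close>

lemma Lam_I_adjacent:
  assumes "\<And>i. 1 \<le> i \<Longrightarrow> i < n \<Longrightarrow> l (Suc i) \<le> l i" "\<And>i. i \<notin> {1..n} \<Longrightarrow> l i = 0"
  shows "l \<in> Lam n"
proof -
  have "l (i + k) \<le> l i" if "1 \<le> i" "i + k \<le> n" for i k
    using that
  proof (induction k)
    case (Suc k)
    then have "l (Suc (i + k)) \<le> l (i + k)" by (intro assms(1)) auto
    with Suc show ?case by simp
  qed simp
  from this[of _ "_ - _"] have "l j \<le> l i" if "1 \<le> i" "i \<le> j" "j \<le> n" for i j
    using that by (metis le_add_diff_inverse)
  then show ?thesis using assms(2) by (simp add: Lam_def)
qed

text \<open>Only the right ends of runs of consecutive elements of K are critical. A descent there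
  makes the last entry of the run positive, and monotonicity carries this to the whole run.\<close>

lemma Lam_minus:
  assumes u: "u \<in> Lam n" and K: "K \<subseteq> {1..n}" and adj: "\<And>a. a \<in> K \<Longrightarrow> Suc a \<notin> K \<Longrightarrow> u (Suc a) < u a"
  shows "(\<lambda>i. u i - ind K i) \<in> Lam n" "\<And>a. a \<in> K \<Longrightarrow> 1 \<le> u a"
proof -
  show pos: "1 \<le> u a" if "a \<in> K" for a
    using that
  proof (induction "n - a" arbitrary: a rule: less_induct)
    case less
    show ?case
    proof (cases "Suc a \<in> K")
      case True
      have a: "1 \<le> a" "Suc a \<le> n" using K less.prems True by auto
      then have "n - Suc a < n - a" by simp
      from less.hyps[OF this True] have "1 \<le> u (Suc a)" .
      also have "\<dots> \<le> u a" using a by (intro Lam_antimono[OF u]) auto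
      finally show ?thesis .
    next
      case False
      then show ?thesis using adj[OF less.prems] by simp
    qed
  qed
  show "(\<lambda>i. u i - ind K i) \<in> Lam n"
  proof (rule Lam_I_adjacent)
    fix i assume i: "1 \<le> i" "i < n"
    have "u (Suc i) \<le> u i" using i by (intro Lam_antimono[OF u]) auto
    then show "u (Suc i) - ind K (Suc i) \<le> u i - ind K i"
      using adj[of i] by (cases "i \<in> K"; cases "Suc i \<in> K") (auto simp: ind_def)
  qed (use Lam_outside[OF u] in auto)
qed

lemma odd_size_ind: "odd_size n (ind K) = card (K \<inter> pclass n True)"
proof -
  have "odd_size n (ind K) = (\<Sum>i\<in>pclass n True. of_bool (i \<in> K))"
    unfolding odd_size_def ind_def pclass_def by (intro sum.cong) auto
  also have "\<dots> = card (pclass n True \<inter> K)"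
    by (simp add: of_bool_def sum.If_cases)
  finally show ?thesis by (simp add: Int_commute)
qed

text \<open>In \<open>key\<close>, index 0 carries the sum of the even components with reversed sign (truncated
  subtraction is harmless, as these components are bounded by \<open>odd_size\<close>). The reversal is needed
  because, for odd \<open>m\<close>, the recursion leading to \<open>v + 1\<^bsub>{1..m}\<^esub>\<close> also involves \<open>v + 1\<^sub>K\<close> for sets
  \<open>K\<close> with one even element more than \<open>{1..m}\<close>.\<close>

definition key :: "nat \<Rightarrow> (nat \<Rightarrow> nat) \<Rightarrow> nat \<Rightarrow> nat" where
  "key n v p = (if p = 0 then n * odd_size n v - (\<Sum>i\<in>pclass n False. v i) else v p)"

definition key_list :: "nat \<Rightarrow> nat list" where
  "key_list n = filter odd [1..<Suc n] @ [0] @ filter even [1..<Suc n]"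

text \<open>\<open>lexn\<close> compares lists of one fixed length, where the lexicographic order is
  well-founded.\<close>

definition key_less :: "nat \<Rightarrow> ((nat \<Rightarrow> nat) \<times> (nat \<Rightarrow> nat)) set" where
  "key_less n = inv_image (lexn less_than (length (key_list n))) (\<lambda>v. map (key n v) (key_list n))"

lemma wf_key_less: "wf (key_less n)"
  unfolding key_less_def by (intro wf_inv_image wf_lexn wf_less_than)

lemma key_lessI:
  assumes "key_list n = xs @ p # ys" "\<And>x. x \<in> set xs \<Longrightarrow> key n v x = key n w x" "key n v p < key n w p"
  shows "(v, w) \<in> key_less n"
  unfolding key_less_def lexn_conv in_inv_image mem_Collect_eq case_prod_conv
proof (intro conjI exI)
  show "map (key n v) (key_list n) = map (key n v) xs @ key n v p # map (key n v) ys"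
    unfolding assms(1) by simp
  have "map (key n v) xs = map (key n w) xs" using assms(2) by simp
  then show "map (key n w) (key_list n) = map (key n v) xs @ key n w p # map (key n w) ys"
    unfolding assms(1) by simp
qed (use assms(3) in auto)

lemma filter_upt_split:
  assumes "P p" "1 \<le> p" "p \<le> n"
  obtains xs ys where "filter P [1..<Suc n] = xs @ p # ys" "\<And>x. x \<in> set xs \<Longrightarrow> 1 \<le> x \<and> x < p \<and> P x"
proof -
  have "[1..<Suc n] = [1..<p] @ p # [Suc p..<Suc n]"
    using assms by (metis le_Suc_eq le_imp_less_Suc upt_add_eq_append upt_conv_Cons le_add_diff_inverse less_imp_le)
  then have "filter P [1..<Suc n] = filter P [1..<p] @ p # filter P [Suc p..<Suc n]"
    using assms(1) by simp
  moreover have "1 \<le> x \<and> x < p \<and> P x" if "x \<in> set (filter P [1..<p])" for x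
    using that by auto
  ultimately show ?thesis using that by blast
qed

lemma card_Int_initial:
  assumes "m \<le> n"
  shows "card ({1..m} \<inter> pclass n True) = (m + 1) div 2" "card ({1..m} \<inter> pclass n False) = m div 2"
proof -
  have "{1..m} \<inter> pclass n True = {a \<in> {1..m}. odd a}" "{1..m} \<inter> pclass n False = {a \<in> {1..m}. even a}"
    using assms by (auto simp: pclass_def)
  then show "card ({1..m} \<inter> pclass n True) = (m + 1) div 2" "card ({1..m} \<inter> pclass n False) = m div 2"
    using card_parity[of m] by simp_all
qed

lemma least_missing:
  assumes "K \<inter> pclass n c \<noteq> {1..m} \<inter> pclass n c" "card (K \<inter> pclass n c) \<le> card ({1..m} \<inter> pclass n c)"
  obtains a where "a \<in> {1..m}" "a \<in> pclass n c" "a \<notin> K" "\<And>x. x \<in> pclass n c \<Longrightarrow> x < a \<Longrightarrow> x \<in> K"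
proof -
  have "\<exists>a. a \<in> {1..m} \<and> a \<in> pclass n c \<and> a \<notin> K"
  proof (rule ccontr)
    assume "\<not> ?thesis"
    then have "{1..m} \<inter> pclass n c \<subseteq> K \<inter> pclass n c" by blast
    from card_seteq[OF _ this assms(2)] assms(1) show False by simp
  qed
  then have ex: "(LEAST a. a \<in> {1..m} \<and> a \<in> pclass n c \<and> a \<notin> K) \<in> {1..m} \<and>
      (LEAST a. a \<in> {1..m} \<and> a \<in> pclass n c \<and> a \<notin> K) \<in> pclass n c \<and>
      (LEAST a. a \<in> {1..m} \<and> a \<in> pclass n c \<and> a \<notin> K) \<notin> K" (is "?a \<in> _ \<and> _")
    by (rule LeastI_ex)
  have "x \<in> K" if "x \<in> pclass n c" "x < ?a" for x
  proof (rule ccontr)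
    assume "x \<notin> K"
    moreover have "x \<in> {1..m}" using that ex by (auto simp: pclass_def)
    ultimately show False using not_less_Least[OF that(2)] that(1) by blast
  qed
  with ex that show ?thesis by blast
qed

text \<open>If the odd parts differ, the least odd index missing from K decides. If they agree, a
  surplus even element raises the even sum and so lowers the key at 0; without surplus the least
  missing even index decides. Membership in \<open>Lam n\<close> bounds the even sum, so that the
  truncated difference really drops.\<close>

lemma key_less_initial:
  assumes v: "(\<lambda>i. v i + ind K i) \<in> Lam n" and K: "K \<subseteq> {1..n}" "K \<noteq> {1..m}" and m: "m \<le> n"
    and odd_le: "card (K \<inter> pclass n True) \<le> (m + 1) div 2"
    and even_cond: "card (K \<inter> pclass n True) = (m + 1) div 2 \<Longrightarrow>
      card (K \<inter> pclass n False) = m div 2 \<or> card (K \<inter> pclass n False) = Suc (m div 2)"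
  shows "(\<lambda>i. v i + ind K i, \<lambda>i. v i + ind {1..m} i) \<in> key_less n" (is "(?f, ?g) \<in> _")
proof (cases "K \<inter> pclass n True = {1..m} \<inter> pclass n True")
  case False
  then obtain a where a: "a \<in> {1..m}" "a \<in> pclass n True" "a \<notin> K" "\<And>x. x \<in> pclass n True \<Longrightarrow> x < a \<Longrightarrow> x \<in> K"
    by (rule least_missing) (use odd_le card_Int_initial[OF m] in auto)
  obtain xs ys where xs: "filter odd [1..<Suc n] = xs @ a # ys" "\<And>x. x \<in> set xs \<Longrightarrow> 1 \<le> x \<and> x < a \<and> odd x"
    using filter_upt_split[of odd a n] a by (auto simp: pclass_def)
  show ?thesis
  proof (rule key_lessI)
    show "key_list n = xs @ a # (ys @ [0] @ filter even [1..<Suc n])"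
      unfolding key_list_def xs(1) by (simp only: append.simps append_assoc)
    show "key n ?f a < key n ?g a" using a by (auto simp: key_def ind_def)
    fix x assume "x \<in> set xs"
    then have x: "1 \<le> x" "x < a" "odd x" using xs(2) by auto
    moreover from x a(1) m have "x \<in> pclass n True" "x \<in> {1..m}" by (auto simp: pclass_def)
    ultimately show "key n ?f x = key n ?g x" using a(4)[of x] by (auto simp: key_def ind_def)
  qed
next
  case True
  then have codd: "card (K \<inter> pclass n True) = (m + 1) div 2" using card_Int_initial[OF m] by simp
  have odd_eq: "key n ?f x = key n ?g x" if "x \<in> set (filter odd [1..<Suc n])" for x
  proof -
    have x: "x \<in> pclass n True" using that by (auto simp: pclass_def)
    have "x \<in> K \<longleftrightarrow> x \<in> K \<inter> pclass n True" using x by blast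
    also have "\<dots> \<longleftrightarrow> x \<in> {1..m}" unfolding True using x by blast
    finally show ?thesis using x by (auto simp: key_def ind_def pclass_def)
  qed
  have sz: "odd_size n ?f = odd_size n ?g"
    unfolding odd_size_add odd_size_ind True ..
  have ev: "(\<Sum>i\<in>pclass n False. v i + ind L i) = (\<Sum>i\<in>pclass n False. v i) + card (L \<inter> pclass n False)" for L
  proof -
    have "(\<Sum>i\<in>pclass n False. ind L i) = card (pclass n False \<inter> L)"
      unfolding ind_def by (simp add: of_bool_def sum.If_cases)
    then show ?thesis by (simp add: sum.distrib Int_commute)
  qed
  show ?thesis
  proof (cases "card (K \<inter> pclass n False) = m div 2")
    case False
    with even_cond[OF codd] have card: "card (K \<inter> pclass n False) = Suc (m div 2)" by simp
    have le: "(\<Sum>i\<in>pclass n False. ?f i) \<le> n * odd_size n ?f"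
    proof -
      have "(\<Sum>i\<in>pclass n False. ?f i) \<le> (\<Sum>i\<in>pclass n False. odd_size n ?f)"
      proof (rule sum_mono)
        fix i assume i: "i \<in> pclass n False"
        then have i': "1 \<le> i" "i \<le> n" by (auto simp: pclass_def)
        have "?f i \<le> ?f 1" using i' by (intro Lam_antimono[OF v]) auto
        also have "?f 1 \<le> odd_size n ?f"
          unfolding odd_size_def using i' by (intro member_le_sum[where f = ?f]) auto
        finally show "?f i \<le> odd_size n ?f" .
      qed
      also have "\<dots> = card (pclass n False) * odd_size n ?f" by simp
      also have "\<dots> \<le> n * odd_size n ?f" using pcard_le[of n False] by (simp add: pcard_def)
      finally show ?thesis .
    qed
    show ?thesis
    proof (rule key_lessI)
      show "key_list n = filter odd [1..<Suc n] @ 0 # filter even [1..<Suc n]"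
        by (simp add: key_list_def)
      show "key n ?f 0 < key n ?g 0"
        using le card card_Int_initial(2)[OF m] unfolding key_def sz ev by simp
    qed (rule odd_eq)
  next
    case ceven: True
    have "K \<inter> pclass n False \<noteq> {1..m} \<inter> pclass n False"
    proof
      assume *: "K \<inter> pclass n False = {1..m} \<inter> pclass n False"
      have "K = (K \<inter> pclass n True) \<union> (K \<inter> pclass n False)" using K by (auto simp: pclass_def)
      also have "\<dots> = {1..m}" unfolding * True using m by (auto simp: pclass_def)
      finally show False using K by simp
    qed
    then obtain a where a: "a \<in> {1..m}" "a \<in> pclass n False" "a \<notin> K" "\<And>x. x \<in> pclass n False \<Longrightarrow> x < a \<Longrightarrow> x \<in> K"
      by (rule least_missing) (use ceven card_Int_initial[OF m] in auto)
    obtain xs ys where xs: "filter even [1..<Suc n] = xs @ a # ys" "\<And>x. x \<in> set xs \<Longrightarrow> 1 \<le> x \<and> x < a \<and> even x"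
      using filter_upt_split[of even a n] a by (auto simp: pclass_def)
    show ?thesis
    proof (rule key_lessI)
      show "key_list n = (filter odd [1..<Suc n] @ [0] @ xs) @ a # ys"
        unfolding key_list_def xs(1) by (simp only: append.simps append_assoc)
      show "key n ?f a < key n ?g a" using a by (auto simp: key_def ind_def)
      fix x assume "x \<in> set (filter odd [1..<Suc n] @ [0] @ xs)"
      then consider "x \<in> set (filter odd [1..<Suc n])" | "x = 0" | "x \<in> set xs" by auto
      then show "key n ?f x = key n ?g x"
      proof cases
        case 1
        then show ?thesis by (rule odd_eq)
      next
        case 2
        then show ?thesis unfolding key_def sz ev using ceven card_Int_initial(2)[OF m] by simp
      next
        case 3
        then have x: "1 \<le> x" "x < a" "even x" using xs(2) by auto
        moreover from x a(1) m have "x \<in> pclass n False" "x \<in> {1..m}" by (auto simp: pclass_def)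
        ultimately show ?thesis using a(4)[of x] by (auto simp: key_def ind_def)
      qed
    qed
  qed
qed

section \<open>The eigenvalue equation\<close>

locale binomial_setting = semisym n r for n :: nat and r :: "'k::field_char_0" +
  fixes \<alpha> :: 'k
  assumes r_nonzero: "r \<noteq> 0"
    and alpha: "\<forall>a b :: nat. \<alpha> \<noteq> - of_nat a - of_nat b * (2 * r)"
begin

definition npt :: "(nat \<Rightarrow> nat) \<Rightarrow> nat \<Rightarrow> 'k" where
  "npt v i = - \<alpha> - pt v i"

lemma combination_nonzero:
  assumes "a \<noteq> 0"
  shows "of_nat a * r + of_nat b \<noteq> 0"
proof (cases "b = 0")
  case True
  then show ?thesis using assms r_nonzero by simp
next
  case False
  then show ?thesis by (intro nonneg_combination_nonzero[OF r_neg]) simp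
qed

lemma pt_diff:
  assumes "u \<in> Lam n" "1 \<le> i" "i < j" "j \<le> n"
  shows "pt u i - pt u j = of_nat (j - i) * r + of_nat (u i - u j)"
proof -
  have 1: "n - i = (n - j) + (j - i)" using assms by simp
  have "u j \<le> u i" using assms(2,3) by (intro Lam_antimono[OF assms(1)]) auto
  then have 2: "u i = u j + (u i - u j)" by simp
  have "pt u i = of_nat ((n - j) + (j - i)) * r + of_nat (u j + (u i - u j))"
    unfolding rho_plus_def rho_def using 1 2 by argo
  then show ?thesis by (simp only: rho_plus_def rho_def of_nat_add distrib_right) simp
qed

lemma pt_neq:
  assumes "u \<in> Lam n" "1 \<le> i" "i < j" "j \<le> n"
  shows "pt u i \<noteq> pt u j"
proof
  assume "pt u i = pt u j"
  then have "of_nat (j - i) * r + of_nat (u i - u j) = 0" using pt_diff[OF assms] by simp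
  moreover have "j - i \<noteq> 0" using assms by simp
  ultimately show False using combination_nonzero by blast
qed

lemma pt_Suc:
  assumes "i < n" "u (Suc i) = u i"
  shows "pt u i = pt u (Suc i) + r"
proof -
  have "n - i = Suc (n - Suc i)" using assms(1) by simp
  then show ?thesis
    unfolding rho_plus_def rho_def assms(2) by (simp only: of_nat_Suc distrib_right) simp
qed

text \<open>Without a descent at a < n the rows a and a + 1 of the determinant agree; at a = n the
  coordinate is 0 and the weight vanishes.\<close>

lemma pt_boundary:
  assumes u: "u \<in> Lam n" and K: "K \<subseteq> {1..n}" and nz: "weight K (pt u) * node_det b K (pt u) \<noteq> 0"
    and a: "a \<in> K" "Suc a \<notin> K"
  shows "u (Suc a) < u a"
proof (rule ccontr)
  assume "\<not> u (Suc a) < u a"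
  moreover have "u (Suc a) \<le> u a" using a K by (intro Lam_antimono[OF u]) auto
  ultimately have eq: "u (Suc a) = u a" by simp
  have an: "1 \<le> a" "a \<le> n" using a K by auto
  show False
  proof (cases "a = n")
    case True
    then have "u a = 0" using eq Lam_outside[OF u, of "Suc a"] by simp
    then have "pt u a = 0" using True by (simp add: rho_plus_def rho_def)
    then have "weight K (pt u) = 0"
      unfolding weight_def using a True finite_subset[OF K] by (intro prod_zero) auto
    with nz show False by simp
  next
    case False
    then have "a < n" using an by simp
    from pt_Suc[OF this eq] have "node K a (pt u) = node K (Suc a) (pt u)"
      using a by (simp add: node_def)
    then have "node_det b K (pt u) = 0" using a an \<open>a < n\<close> by (intro node_det_equal_nodes[of a "Suc a"]) auto
    with nz show False by simp
  qed
qed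

lemma down_pt:
  assumes "\<And>a. a \<in> K \<Longrightarrow> 1 \<le> u a"
  shows "down K (pt u) = pt (\<lambda>i. u i - ind K i)"
proof
  fix i show "down K (pt u) i = pt (\<lambda>i. u i - ind K i) i"
    using assms[of i] by (cases "i \<in> K") (auto simp: down_def rho_plus_def ind_def of_nat_diff)
qed

text \<open>Triangularity: a nonempty balanced K contains an odd index, so an admissible shift
  lowers the size strictly and leads to a zero of \<open>Rf l\<close>. Only K = {} survives.\<close>

lemma shift_op_Rf_pt:
  assumes l: "l \<in> Lam n" and u: "u \<in> Lam n" "sz u \<le> sz l"
  shows "shift_op b t (Rf l) (pt u) = node_det b {} (pt u) * (\<Prod>a\<in>pclass n b. pt u a + t) * Rf l (pt u)"
proof -
  let ?h = "\<lambda>K. weight K (pt u) * (\<Prod>a\<in>pclass n b - K. pt u a + t) * node_det b K (pt u) * Rf l (down K (pt u))"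
  have "?h K = 0" if K: "K \<subseteq> {1..n}" "K \<noteq> {}" for K
  proof (cases "weight K (pt u) * node_det b K (pt u) = 0")
    case False
    let ?u = "\<lambda>i. u i - ind K i"
    note adj = pt_boundary[OF u(1) K(1) False]
    note Lam = Lam_minus[OF u(1) K(1) adj]
    have fin: "finite K" by (rule finite_subset[OF K(1)]) simp
    have "node_det b K (pt u) \<noteq> 0" using False by simp
    note d = node_det_nonzeroD[OF this K(1)]
    have "card (K \<inter> pclass n True) \<noteq> 0"
    proof
      assume *: "card (K \<inter> pclass n True) = 0"
      have eq: "K - pclass n False = K \<inter> pclass n True" "K - pclass n True = K \<inter> pclass n False"
        using K(1) by (auto simp: pclass_def)
      have "card (K \<inter> pclass n False) = 0"
      proof (cases b)
        case True
        then show ?thesis using d(1) * eq by simp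
      next
        case False
        then show ?thesis using d(2) * eq by simp
      qed
      with * fin have "K \<inter> pclass n True = {}" "K \<inter> pclass n False = {}" by auto
      moreover have "K = (K \<inter> pclass n True) \<union> (K \<inter> pclass n False)" using K(1) by (auto simp: pclass_def)
      ultimately show False using K(2) by simp
    qed
    moreover have "sz u = sz ?u + card (K \<inter> pclass n True)"
    proof -
      have "u = (\<lambda>i. ?u i + ind K i)" using Lam(2) by (force simp: ind_def fun_eq_iff)
      then have "sz u = sz (\<lambda>i. ?u i + ind K i)" by simp
      then show ?thesis unfolding odd_size_add odd_size_ind .
    qed
    ultimately have "sz ?u < sz l" using u(2) by linarith
    then have "Rf l (pt ?u) = 0" using Lam(1) by (intro Rf_vanish[OF l]) auto
    then show ?thesis by (simp add: down_pt[OF Lam(2)])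
  qed auto
  then have "shift_op b t (Rf l) (pt u) = (\<Sum>K\<in>{{}}. ?h K)"
    unfolding shift_op_def by (intro sum.mono_neutral_right) auto
  then show ?thesis by (simp add: weight_def mult_ac)
qed

text \<open>After division by \<open>node_det b {}\<close> the result is an invariant polynomial
  within the degree bound of \<open>Rf l\<close>, and by triangularity it inherits the zeros of
  \<open>Rf l\<close>; so it is a multiple.\<close>

theorem shift_op_Rf:
  assumes l: "l \<in> Lam n"
  shows "shift_op b t (Rf l) z = node_det b {} z * Rf l z * (\<Prod>a\<in>pclass n b. pt l a + t)"
proof -
  obtain g where g: "Pol n (int (sz l)) g" "Winv n g" "\<And>z. shift_op b t (Rf l) z = node_det b {} z * g z"
    by (rule shift_op_quotient[OF Pol_Rf[OF l] Winv_Rf[OF l], of b t]) (rule that)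
  have g_pt: "g (pt u) = (\<Prod>a\<in>pclass n b. pt u a + t) * Rf l (pt u)" if "u \<in> Lam n" "sz u \<le> sz l" for u
  proof -
    have "node_det b {} (pt u) \<noteq> 0" using pt_neq[OF that(1)] by (intro node_det_empty_nonzero)
    then show ?thesis using shift_op_Rf_pt[OF l that, of b t] unfolding g(3) by simp
  qed
  have "g z = g (pt l) / Rf l (pt l) * Rf l z"
    by (rule eq_multiple_Rf[OF l g(1,2)]) (simp add: g_pt Rf_vanish[OF l])
  also have "\<dots> = (\<Prod>a\<in>pclass n b. pt l a + t) * Rf l z"
    using g_pt[OF l] Rf_nonzero[OF l] by simp
  finally show ?thesis by (simp add: g(3) mult_ac)
qed

lemma op_coeff_Rf:
  assumes l: "l \<in> Lam n"
  shows "op_coeff b k (Rf l) z = node_det b {} z * Rf l z * esym (pclass n b) k (pt l)"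
proof -
  have "poly (op_poly b (Rf l) z) t =
      poly (Polynomial.smult (node_det b {} z * Rf l z) (\<Prod>a\<in>pclass n b. [:pt l a, 1:])) t" for t
    unfolding shift_op_eq_poly[symmetric] shift_op_Rf[OF l] by (simp add: poly_prod)
  then have "op_poly b (Rf l) z = Polynomial.smult (node_det b {} z * Rf l z) (\<Prod>a\<in>pclass n b. [:pt l a, 1:])"
    by (simp flip: poly_eq_poly_eq_iff add: fun_eq_iff)
  then show ?thesis unfolding op_coeff_eq_coeff esym_def by simp
qed

section \<open>The recursion at the reflected points\<close>

lemma npt_boundary:
  assumes v: "v \<in> Lam n" and K: "K \<subseteq> {1..n}" and nz: "node_det b K (npt v) \<noteq> 0"
  shows "(\<lambda>i. v i + ind K i) \<in> Lam n"
proof (rule Lam_I_adjacent)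
  fix i assume i: "1 \<le> i" "i < n"
  have le: "v (Suc i) \<le> v i" using i by (intro Lam_antimono[OF v]) auto
  show "v (Suc i) + ind K (Suc i) \<le> v i + ind K i"
  proof (cases "Suc i \<in> K \<and> i \<notin> K \<and> v (Suc i) = v i")
    case True
    have "pt v i = pt v (Suc i) + r" using True i by (intro pt_Suc) auto
    then have "node K (Suc i) (npt v) = node K i (npt v)"
      using True by (simp add: node_def npt_def)
    then have "node_det b K (npt v) = 0" using True i by (intro node_det_equal_nodes[of "Suc i" i]) auto
    with nz show ?thesis by simp
  qed (use le in \<open>auto simp: ind_def\<close>)
next
  fix i assume "i \<notin> {1..n}"
  then show "v i + ind K i = 0" using K Lam_outside[OF v, of i] by (auto simp: ind_def)
qed

lemma down_npt: "down K (npt v) = npt (\<lambda>i. v i + ind K i)"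
  by (auto simp: down_def npt_def rho_plus_def ind_def fun_eq_iff)

text \<open>Here the hypothesis on alpha enters: for n - a = 2 q the factor is -alpha - 2 q r -
  v_a.\<close>

lemma weight_npt_nonzero:
  assumes "m \<le> n"
  shows "weight {1..m} (npt v) \<noteq> 0"
proof -
  have "npt v a \<noteq> 0" if a: "a \<in> {1..m}" "even (n + a)" for a
  proof
    assume *: "npt v a = 0"
    have "even (n - a)" using a assms by auto
    then obtain q where q: "n - a = 2 * q" by blast
    have "- \<alpha> = of_nat (v a) + of_nat q * (2 * r)"
      using * by (simp add: npt_def rho_plus_def rho_def q algebra_simps)
    then have "- (- \<alpha>) = - (of_nat (v a) + of_nat q * (2 * r))" by (rule arg_cong)
    then have "\<alpha> = - of_nat (v a) - of_nat q * (2 * r)" by simp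
    with alpha show False by blast
  qed
  then show ?thesis unfolding weight_def by (simp add: prod_zero_iff)
qed

text \<open>Within one kind of rows the nodes are distinct. For i < j of opposite parity, i lies in
  {1..m} and j does not, and up to sign the nodes differ by \<open>pt v i - pt v j + r\<close>, in
  which r occurs at least twice.\<close>

lemma node_det_npt_nonzero:
  assumes v: "v \<in> Lam n" and m: "m \<le> n"
  shows "node_det (odd m) {1..m} (npt v) \<noteq> 0"
  unfolding node_det_def
proof (rule rdet_colent_nonzero)
  let ?K = "{1..m}" and ?b = "odd m"
  let ?N = "\<lambda>a. node ?K a (npt v)"
  have eq: "{1..m} - pclass n True = {1..m} \<inter> pclass n False" "{1..m} - pclass n False = {1..m} \<inter> pclass n True"
    using m by (auto simp: pclass_def)
  have "card {a \<in> {1..n}. rowH ?b ?K a} = qcard n ?b + of_bool ?b"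
  proof (cases "odd m")
    case True
    then show ?thesis using card_rowH[of ?K n True] card_Int_initial[OF m] m by (auto simp: eq elim!: oddE)
  next
    case False
    then show ?thesis using card_rowH[of ?K n False] card_Int_initial[OF m] m by (auto simp: eq elim!: evenE)
  qed
  then show "qcard n ?b \<le> card {a \<in> {1..n}. rowH ?b ?K a}"
    "card {a \<in> {1..n}. rowH ?b ?K a} \<le> qcard n ?b + of_bool ?b" by simp_all
  have neq: "?N i \<noteq> ?N j" if ij: "1 \<le> i" "i < j" "j \<le> n" "rowH ?b ?K i = rowH ?b ?K j" for i j
  proof (cases "odd i = odd j")
    case True
    then have "(i \<in> ?K) = (j \<in> ?K)" using ij(4) unfolding rowH_def by blast
    moreover have "npt v i \<noteq> npt v j" using pt_neq[OF v ij(1-3)] by (simp add: npt_def)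
    ultimately show ?thesis using True by (simp add: node_def)
  next
    case False
    then have "(i \<in> ?K) \<noteq> (j \<in> ?K)" using ij(4) unfolding rowH_def by blast
    then have K: "i \<in> ?K" "j \<notin> ?K" using ij by auto
    have "pt v i - pt v j + r \<noteq> 0"
    proof -
      have "pt v i - pt v j + r = of_nat (Suc (j - i)) * r + of_nat (v i - v j)"
        unfolding pt_diff[OF v ij(1-3)] by (simp add: algebra_simps)
      then show ?thesis using combination_nonzero[of "Suc (j - i)" "v i - v j"] by simp
    qed
    then have "npt v i \<noteq> npt v j + r" "npt v i - r \<noteq> npt v j"
      by (auto simp: npt_def algebra_simps)
    moreover have "?N i = (if odd i then npt v i else npt v i - r)"
      using K(1) by (simp only: node_def if_True)
    moreover have "?N j = (if odd j then npt v j else npt v j + r)"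
      using K(2) by (simp only: node_def if_False)
    ultimately show ?thesis using False by (cases "odd i") simp_all
  qed
  have inj: "i = j" if "i \<in> {1..n}" "j \<in> {1..n}" "rowH ?b ?K i = rowH ?b ?K j" "?N i = ?N j" for i j
    using neq[of i j] neq[of j i] that by (cases i j rule: linorder_cases) auto
  show "inj_on ?N {a \<in> {1..n}. rowH ?b ?K a}"
    by (rule inj_onI, rule inj) auto
  show "inj_on ?N {a \<in> {1..n}. \<not> rowH ?b ?K a}"
    by (rule inj_onI, rule inj) auto
qed

text \<open>A column {1..m} of maximal length is removed from w, and the eigenvalue equation at the
  resulting v is solved for the term with shift {1..m}; all other terms belong to smaller tuples.
  The polynomial does not depend on l. No division by R_l(-rho_alpha) occurs, as its nonvanishing is
  deduced from this lemma.\<close>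

lemma Rf_npt_polynomial:
  assumes "w \<in> Lam n"
  shows "\<exists>\<Psi>. Pol n (int (sz w)) \<Psi> \<and> Winv n \<Psi> \<and> (\<forall>l\<in>Lam n. Rf l (npt w) = \<Psi> (pt l) * Rf l (npt (\<lambda>_. 0)))"
  using assms
proof (induction w rule: wf_induct_rule[OF wf_key_less[of n]])
  case (1 w)
  show ?case
  proof (cases "w = (\<lambda>_. 0)")
    case True
    then show ?thesis by (intro exI[of _ "\<lambda>_. 1"]) (auto simp: Winv_def intro: Pol_const)
  next
    case False
    then obtain i where i: "w i \<noteq> 0" by auto
    define m where "m = Max {i \<in> {1..n}. w i \<noteq> 0}"
    have "i \<in> {i \<in> {1..n}. w i \<noteq> 0}" using i Lam_outside[OF 1(2), of i] by auto
    then have m_in: "m \<in> {i \<in> {1..n}. w i \<noteq> 0}" unfolding m_def by (intro Max_in) auto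
    then have m: "m \<le> n" "1 \<le> m" "w m \<noteq> 0" by auto
    have wS0: "w (Suc m) = 0"
    proof (rule ccontr)
      assume *: "w (Suc m) \<noteq> 0"
      then have "Suc m \<in> {i \<in> {1..n}. w i \<noteq> 0}" using Lam_outside[OF 1(2), of "Suc m"] by auto
      then have "Suc m \<le> m" unfolding m_def by (intro Max_ge) auto
      then show False by simp
    qed
    define v where "v i = w i - ind {1..m} i" for i
    have K0: "{1..m} \<subseteq> {1..n}" using m by auto
    have adj: "w (Suc a) < w a" if "a \<in> {1..m}" "Suc a \<notin> {1..m}" for a
    proof -
      have "a = m" using that by auto
      with wS0 m show ?thesis by simp
    qed
    note Lamv = Lam_minus[OF 1(2) K0 adj]
    have v: "v \<in> Lam n" using Lamv(1) unfolding v_def .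
    have w_eq: "(\<lambda>i. v i + ind {1..m} i) = w"
      using Lamv(2) by (force simp: v_def ind_def fun_eq_iff)
    define b where "b = odd m"
    define kk where "kk = (m + 1) div 2"
    let ?K0 = "{1..m}"
    have kk: "card (?K0 \<inter> pclass n b) = kk" "card (?K0 \<inter> pclass n True) = kk"
      using card_Int_initial[OF m(1)] unfolding b_def kk_def
      by (cases "odd m"; auto elim!: oddE evenE)+
    have kk_le: "kk \<le> pcard n b"
      unfolding kk(1)[symmetric] pcard_def by (intro card_mono) auto
    have szw: "sz w = sz v + kk"
      using odd_size_add[of n v "ind ?K0"] unfolding w_eq odd_size_ind kk .
    \<comment> \<open>This coefficient has an eigenvalue of degree kk, the difference of the sizes
      of w and v. The symmetric factor is then 1 for the shift {1..m} and 0 for shifts with more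
      than kk elements in the class.\<close>
    let ?k = "pcard n b - kk"
    define cf where "cf K = weight K (npt v) * esym (pclass n b - K) ?k (npt v) * node_det b K (npt v)" for K
    have rec: "(\<Sum>K\<in>Pow {1..n}. cf K * Rf l (npt (\<lambda>i. v i + ind K i))) =
        node_det b {} (npt v) * esym (pclass n b) ?k (pt l) * Rf l (npt v)" if "l \<in> Lam n" for l
      using op_coeff_Rf[OF that, of b ?k "npt v"] unfolding op_coeff_def down_npt cf_def by (simp add: mult_ac)
    have esym_K: "card (K \<inter> pclass n b) \<le> kk" if "cf K \<noteq> 0" for K
    proof (rule ccontr)
      assume "\<not> card (K \<inter> pclass n b) \<le> kk"
      then have "card (pclass n b - K) < ?k"
        using card_Diff_subset_Int[of "pclass n b" K] card_mono[of "pclass n b" "K \<inter> pclass n b"]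
        unfolding pcard_def by (auto simp: Int_commute)
      then have "esym (pclass n b - K) ?k (npt v) = 0" by (intro esym_gt) auto
      with that show False by (simp add: cf_def)
    qed
    have cf0: "cf ?K0 \<noteq> 0"
    proof -
      have "card (pclass n b - ?K0) = ?k"
        using card_Diff_subset_Int[of "pclass n b" ?K0] kk(1) by (simp add: pcard_def Int_commute)
      then have "esym (pclass n b - ?K0) ?k (npt v) = 1"
        using esym_card[of "pclass n b - ?K0" "npt v"] by simp
      then show ?thesis
        using weight_npt_nonzero[OF m(1), of v] node_det_npt_nonzero[OF v m(1)] by (simp add: cf_def b_def)
    qed
    have small: "(\<lambda>i. v i + ind K i, w) \<in> key_less n \<and> (\<lambda>i. v i + ind K i) \<in> Lam n \<and>
        card (K \<inter> pclass n True) \<le> kk" if K: "K \<subseteq> {1..n}" "K \<noteq> ?K0" "cf K \<noteq> 0" for K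
    proof -
      have node_det: "node_det b K (npt v) \<noteq> 0" using K(3) by (auto simp: cf_def)
      note d = node_det_nonzeroD[OF node_det K(1)]
      have eq: "K - pclass n False = K \<inter> pclass n True" "K - pclass n True = K \<inter> pclass n False"
        using K(1) by (auto simp: pclass_def)
      have Lam: "(\<lambda>i. v i + ind K i) \<in> Lam n" by (rule npt_boundary[OF v K(1) node_det])
      have le: "card (K \<inter> pclass n True) \<le> kk"
        and ev: "card (K \<inter> pclass n True) = kk \<Longrightarrow>
          card (K \<inter> pclass n False) = m div 2 \<or> card (K \<inter> pclass n False) = Suc (m div 2)"
      proof -
        show "card (K \<inter> pclass n True) \<le> kk"
          using esym_K[OF K(3)] d by (cases b) (auto simp: eq)
        assume *: "card (K \<inter> pclass n True) = kk"
        show "card (K \<inter> pclass n False) = m div 2 \<or> card (K \<inter> pclass n False) = Suc (m div 2)"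
          using d * unfolding b_def kk_def by (cases "odd m") (auto simp: eq elim!: oddE evenE)
      qed
      have "(\<lambda>i. v i + ind K i, \<lambda>i. v i + ind ?K0 i) \<in> key_less n"
        using key_less_initial[OF Lam K(1,2) m(1)] le ev unfolding kk_def by blast
      with Lam le show ?thesis unfolding w_eq by blast
    qed
    have "\<exists>\<Psi>. Pol n (int (sz w)) \<Psi> \<and> Winv n \<Psi> \<and>
        (\<forall>l\<in>Lam n. cf K * Rf l (npt (\<lambda>i. v i + ind K i)) = \<Psi> (pt l) * Rf l (npt (\<lambda>_. 0)))"
      if K: "K \<in> Pow {1..n} - {?K0}" for K
    proof (cases "cf K = 0")
      case True
      then show ?thesis by (intro exI[of _ "\<lambda>_. 0"]) (auto simp: Winv_def)
    next
      case False
      from K have K': "K \<subseteq> {1..n}" "K \<noteq> ?K0" by auto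
      note s = small[OF K' False]
      from 1(1)[of "\<lambda>i. v i + ind K i"] s obtain \<Psi> where \<Psi>: "Pol n (int (sz (\<lambda>i. v i + ind K i))) \<Psi>" "Winv n \<Psi>"
        "\<And>l. l \<in> Lam n \<Longrightarrow> Rf l (npt (\<lambda>i. v i + ind K i)) = \<Psi> (pt l) * Rf l (npt (\<lambda>_. 0))" by blast
      have "sz (\<lambda>i. v i + ind K i) \<le> sz w"
        using s unfolding odd_size_add odd_size_ind szw by simp
      then have "Pol n (int (sz w)) (\<lambda>x. cf K * \<Psi> x)"
        using \<Psi>(1) by (intro Pol_scale Pol_mono[OF \<Psi>(1)]) simp
      then show ?thesis using \<Psi> by (intro exI[of _ "\<lambda>x. cf K * \<Psi> x"]) (auto simp: Winv_def)
    qed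
    then have "\<exists>\<Phi>. \<forall>K\<in>Pow {1..n} - {?K0}. Pol n (int (sz w)) (\<Phi> K) \<and> Winv n (\<Phi> K) \<and>
        (\<forall>l\<in>Lam n. cf K * Rf l (npt (\<lambda>i. v i + ind K i)) = \<Phi> K (pt l) * Rf l (npt (\<lambda>_. 0)))"
      by (intro bchoice ballI)
    then obtain \<Phi> where all: "\<forall>K\<in>Pow {1..n} - {?K0}. Pol n (int (sz w)) (\<Phi> K) \<and> Winv n (\<Phi> K) \<and>
        (\<forall>l\<in>Lam n. cf K * Rf l (npt (\<lambda>i. v i + ind K i)) = \<Phi> K (pt l) * Rf l (npt (\<lambda>_. 0)))" ..
    then have \<Phi>: "Pol n (int (sz w)) (\<Phi> K)" "Winv n (\<Phi> K)"
      if "K \<in> Pow {1..n} - {?K0}" for K using that by blast+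
    have \<Phi>3: "cf K * Rf l (npt (\<lambda>i. v i + ind K i)) = \<Phi> K (pt l) * Rf l (npt (\<lambda>_. 0))"
      if "K \<in> Pow {1..n} - {?K0}" "l \<in> Lam n" for K l using all that by blast
    have "(v, w) \<in> key_less n"
    proof -
      have "(\<lambda>i. v i + ind {} i, \<lambda>i. v i + ind ?K0 i) \<in> key_less n"
        using m v by (intro key_less_initial) (auto simp: ind_def)
      then show ?thesis unfolding w_eq by (simp add: ind_def)
    qed
    from 1(1)[OF this v] obtain \<Psi> where \<Psi>: "Pol n (int (sz v)) \<Psi>" "Winv n \<Psi>"
      "\<And>l. l \<in> Lam n \<Longrightarrow> Rf l (npt v) = \<Psi> (pt l) * Rf l (npt (\<lambda>_. 0))" by blast
    define \<Theta> where "\<Theta> x = (1 / cf ?K0) * (node_det b {} (npt v) * (esym (pclass n b) ?k x * \<Psi> x) - (\<Sum>K\<in>Pow {1..n} - {?K0}. \<Phi> K x))" for x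
    have "Pol n (int (sz w)) \<Theta>"
    proof -
      have "Pol n (int (card (pclass n b)) - int ?k) (esym (pclass n b) ?k :: (nat \<Rightarrow> 'k) \<Rightarrow> 'k)"
        by (rule Pol_esym) (auto simp: pclass_def)
      then have "Pol n (int (sz w)) (\<lambda>x. esym (pclass n b) ?k x * \<Psi> x)"
        using \<Psi>(1) kk_le unfolding szw by (elim Pol_mult') (auto simp: pcard_def)
      then show ?thesis unfolding \<Theta>_def
        by (intro Pol_scale Pol_diff Pol_sum \<Phi>(1))
    qed
    moreover have "Winv n \<Theta>"
      using Winv_permute[OF Winv_esym[of n b ?k, where 'k = 'k]] Winv_permute[OF \<Psi>(2)] Winv_permute[OF \<Phi>(2)]
      unfolding Winv_def \<Theta>_def by simp
    moreover have "Rf l (npt w) = \<Theta> (pt l) * Rf l (npt (\<lambda>_. 0))" if l: "l \<in> Lam n" for l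
    proof -
      have "(\<Sum>K\<in>Pow {1..n}. cf K * Rf l (npt (\<lambda>i. v i + ind K i))) =
          cf ?K0 * Rf l (npt w) + (\<Sum>K\<in>Pow {1..n} - {?K0}. cf K * Rf l (npt (\<lambda>i. v i + ind K i)))"
        using K0 by (subst sum.remove[of _ ?K0]) (auto simp: w_eq)
      also have "(\<Sum>K\<in>Pow {1..n} - {?K0}. cf K * Rf l (npt (\<lambda>i. v i + ind K i))) =
          (\<Sum>K\<in>Pow {1..n} - {?K0}. \<Phi> K (pt l)) * Rf l (npt (\<lambda>_. 0))"
        unfolding sum_distrib_right using \<Phi>3 l by (intro sum.cong) auto
      finally have "cf ?K0 * Rf l (npt w) =
          (node_det b {} (npt v) * (esym (pclass n b) ?k (pt l) * \<Psi> (pt l)) - (\<Sum>K\<in>Pow {1..n} - {?K0}. \<Phi> K (pt l))) * Rf l (npt (\<lambda>_. 0))"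
        unfolding rec[OF l] \<Psi>(3)[OF l] by (simp add: algebra_simps)
      then have "1 / cf ?K0 * (cf ?K0 * Rf l (npt w)) = \<Theta> (pt l) * Rf l (npt (\<lambda>_. 0))"
        unfolding \<Theta>_def by (simp only: mult.assoc)
      then show ?thesis using cf0 by simp
    qed
    ultimately show ?thesis by blast
  qed
qed

section \<open>Interchanging the two tuples, and the binomial formula\<close>

definition Rrefl :: "(nat \<Rightarrow> nat) \<Rightarrow> (nat \<Rightarrow> 'k) \<Rightarrow> 'k" where
  "Rrefl l x = Rf l (\<lambda>i. - 1 * x i + - \<alpha>)"

lemma Rrefl_pt: "Rrefl l (pt w) = Rf l (npt w)"
proof -
  have "(\<lambda>i. - 1 * pt w i + - \<alpha>) = npt w" by (simp add: npt_def fun_eq_iff)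
  then show ?thesis by (simp only: Rrefl_def)
qed

lemma Pol_Rrefl: "l \<in> Lam n \<Longrightarrow> Pol n (int (sz l)) (Rrefl l)"
  unfolding Rrefl_def by (intro Pol_affine Pol_Rf)

lemma Winv_Rrefl: "l \<in> Lam n \<Longrightarrow> Winv n (Rrefl l)"
  unfolding Winv_def Rrefl_def using Winv_permute[OF Winv_Rf, of l _ "\<lambda>i. - 1 * _ i + - \<alpha>"] by blast

text \<open>A zero here would force zeros at all -rho_alpha - w, so the reflected polynomial would
  vanish identically.\<close>

lemma Rf_npt_nonzero:
  assumes l: "l \<in> Lam n"
  shows "Rf l (npt (\<lambda>_. 0)) \<noteq> 0"
proof
  assume *: "Rf l (npt (\<lambda>_. 0)) = 0"
  have "Rrefl l x = 0" for x
  proof (rule vanishing_imp_zero[OF Pol_Rrefl[OF l] Winv_Rrefl[OF l]])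
    fix u assume "u \<in> Lam n"
    from Rf_npt_polynomial[OF this] l * show "Rrefl l (pt u) = 0" unfolding Rrefl_pt by auto
  qed
  from this[of "\<lambda>i. - \<alpha> - pt l i"] have "Rf l (pt l) = 0" by (simp add: Rrefl_def)
  with Rf_nonzero[OF l] show False by simp
qed

text \<open>The part of the coefficient that is free of l; it exhibits the right-hand side at rho +
  w as a kernel symmetric in l and w.\<close>

definition \<kappa> :: "(nat \<Rightarrow> nat) \<Rightarrow> 'k" where
  "\<kappa> u = (- 1) ^ sz u / (Rf u (pt u) * Rf u (npt (\<lambda>_. 0)))"

abbreviation Le :: "nat \<Rightarrow> (nat \<Rightarrow> nat) set" where
  "Le N \<equiv> {u \<in> Lam n. sz u \<le> N}"

text \<open>\<open>Rf u\<close> vanishes at rho + w if u is larger than w, so the range of the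
  symmetric kernel may be fixed by either of the two tuples.\<close>

lemma kernel_truncate:
  assumes w: "w \<in> Lam n" and N: "sz w \<le> N"
  shows "(\<Sum>u\<in>Le N. c u * Rf u (pt w)) = (\<Sum>u\<in>Le (sz w). c u * Rf u (pt w))"
proof (rule sum.mono_neutral_right)
  show "finite (Le N)" by (rule finite_Lam_le)
  show "Le (sz w) \<subseteq> Le N" using N by auto
  show "\<forall>u\<in>Le N - Le (sz w). c u * Rf u (pt w) = 0"
  proof
    fix u assume "u \<in> Le N - Le (sz w)"
    then have "u \<in> Lam n" "sz w < sz u" by auto
    then show "c u * Rf u (pt w) = 0" using w by (subst Rf_vanish) auto
  qed
qed

lemma Pol_Winv_kernel:
  "Pol n (int N) (\<lambda>x. \<Sum>u\<in>Le N. c u * Rf u x)" "Winv n (\<lambda>x. \<Sum>u\<in>Le N. c u * Rf u x)"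
proof -
  show "Pol n (int N) (\<lambda>x. \<Sum>u\<in>Le N. c u * Rf u x)"
    by (intro Pol_sum Pol_scale) (auto intro: Pol_mono[OF Pol_Rf])
  show "Winv n (\<lambda>x. \<Sum>u\<in>Le N. c u * Rf u x)"
    unfolding Winv_def using Winv_permute[OF Winv_Rf] by (auto intro!: sum.cong)
qed

text \<open>The difference of the two sides at \<open>z = \<rho> + w\<close> is a polynomial in \<open>w\<close> of degree less than \<open>|l|\<close>
  (the leading terms agree) and, by \<open>Rf_npt_polynomial\<close>, a polynomial in \<open>l\<close> of degree at most
  \<open>|w|\<close>; this allows an induction on \<open>|l|\<close>.\<close>

theorem binomial_formula:
  assumes "l \<in> Lam n"
  shows "Rrefl l z / Rf l (npt (\<lambda>_. 0)) = (\<Sum>u\<in>Le (sz l). \<kappa> u * Rf u (pt l) * Rf u z)"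
  using assms
proof (induction "sz l" arbitrary: l z rule: less_induct)
  case less
  note l = less.prems
  let ?n0 = "npt (\<lambda>_. 0)" and ?N = "sz l"
  define E where "E x = (1 / Rf l ?n0) * Rrefl l x - (\<Sum>u\<in>Le ?N. \<kappa> u * Rf u (pt l) * Rf u x)" for x
  have "E z = 0"
  proof (rule vanishing_imp_zero[of "int ?N - 1" E])
    show "Winv n E"
      unfolding E_def by (intro Winv_diff Winv_scale Winv_Rrefl l Pol_Winv_kernel(2))
    show "Pol n (int ?N - 1) E"
    proof -
      \<comment> \<open>Among the u of full size only u = l contributes, with coefficient (-1)^|l| /
        R_l(-rho_alpha), which matches the leading part of the left-hand side.\<close>
      have top: "\<kappa> u * Rf u (pt l) * Rf u x = 0" if "u \<in> Le ?N" "sz u = ?N" "u \<noteq> l" for u x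
        using Rf_vanish[of u l] that l by auto
      have "E = (\<lambda>x. (1 / Rf l ?n0) * (Rrefl l x - (- 1) ^ ?N * Rf l x)
          - (\<Sum>u\<in>{u \<in> Lam n. sz u < ?N}. \<kappa> u * Rf u (pt l) * Rf u x))"
      proof
        fix x
        have fin: "finite {u \<in> Lam n. sz u < ?N}"
          by (rule finite_subset[OF _ finite_Lam_le[of n ?N]]) auto
        have "(\<Sum>u\<in>Le ?N. \<kappa> u * Rf u (pt l) * Rf u x) =
            (\<Sum>u\<in>insert l {u \<in> Lam n. sz u < ?N}. \<kappa> u * Rf u (pt l) * Rf u x)"
          by (rule sum.mono_neutral_right[OF finite_Lam_le]) (use l top in force)+
        also have "\<dots> = \<kappa> l * Rf l (pt l) * Rf l x + (\<Sum>u\<in>{u \<in> Lam n. sz u < ?N}. \<kappa> u * Rf u (pt l) * Rf u x)"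
          using fin by simp
        also have "\<kappa> l * Rf l (pt l) = (- 1) ^ ?N / Rf l ?n0"
          using Rf_nonzero[OF l] by (simp add: \<kappa>_def)
        finally show "E x = (1 / Rf l ?n0) * (Rrefl l x - (- 1) ^ ?N * Rf l x)
          - (\<Sum>u\<in>{u \<in> Lam n. sz u < ?N}. \<kappa> u * Rf u (pt l) * Rf u x)"
          unfolding E_def by (simp add: diff_divide_distrib)
      qed
      moreover have "Pol n (int ?N - 1) (\<lambda>x. Rrefl l x - (- 1) ^ ?N * Rf l x)"
        unfolding Rrefl_def by (rule Pol_affine_same_lead[OF Pol_Rf[OF l]])
      moreover have "Pol n (int ?N - 1) (\<lambda>x. \<Sum>u\<in>{u \<in> Lam n. sz u < ?N}. \<kappa> u * Rf u (pt l) * Rf u x)"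
        by (intro Pol_sum Pol_scale) (auto intro: Pol_mono[OF Pol_Rf])
      ultimately show ?thesis by (simp only: Pol_diff Pol_scale)
    qed
    fix w assume w: "w \<in> Lam n" "int (sz w) \<le> int ?N - 1"
    then have lt: "sz w < ?N" by simp
    from Rf_npt_polynomial[OF w(1)] obtain \<Psi> where \<Psi>: "Pol n (int (sz w)) \<Psi>" "Winv n \<Psi>"
      "\<And>l. l \<in> Lam n \<Longrightarrow> Rrefl l (pt w) = \<Psi> (pt l) * Rf l ?n0" unfolding Rrefl_pt by blast
    \<comment> \<open>The roles are exchanged: w is fixed and rho + l is the argument. F is to
      vanish at rho + l although |l| > |w|, by interpolation from the tuples of size at most
      |w|.\<close>
    define F where "F x = \<Psi> x - (\<Sum>u\<in>Le (sz w). \<kappa> u * Rf u (pt w) * Rf u x)" for x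
    have F_pt: "F (pt k) = Rrefl k (pt w) / Rf k ?n0 - (\<Sum>u\<in>Le (sz w). \<kappa> u * Rf u (pt w) * Rf u (pt k))"
      if "k \<in> Lam n" for k
      using \<Psi>(3)[OF that] Rf_npt_nonzero[OF that] by (simp add: F_def)
    have "F (pt l) = 0"
    proof (rule vanishing_imp_zero[of "int (sz w)" F])
      show "Pol n (int (sz w)) F" unfolding F_def by (intro Pol_diff \<Psi>(1) Pol_Winv_kernel(1))
      show "Winv n F"
        unfolding F_def by (intro Winv_diff \<Psi>(2) Pol_Winv_kernel(2))
      fix k assume k: "k \<in> Lam n" "int (sz k) \<le> int (sz w)"
      have "(\<Sum>u\<in>Le (sz w). \<kappa> u * Rf u (pt w) * Rf u (pt k)) = (\<Sum>u\<in>Le (sz k). \<kappa> u * Rf u (pt w) * Rf u (pt k))"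
        using k by (intro kernel_truncate) auto
      also have "\<dots> = (\<Sum>u\<in>Le (sz k). \<kappa> u * Rf u (pt k) * Rf u (pt w))"
        by (intro sum.cong) simp_all
      \<comment> \<open>Since |k| \<le> |w| < |l|, the induction hypothesis for k is available,
        evaluated at rho + w.\<close>
      also have "\<dots> = Rrefl k (pt w) / Rf k ?n0"
        using less.hyps[of k "pt w"] k lt by simp
      finally show "F (pt k) = 0" unfolding F_pt[OF k(1)] by simp
    qed
    have "(\<Sum>u\<in>Le ?N. \<kappa> u * Rf u (pt l) * Rf u (pt w)) = (\<Sum>u\<in>Le (sz w). \<kappa> u * Rf u (pt l) * Rf u (pt w))"
      using w lt by (intro kernel_truncate) auto
    also have "\<dots> = (\<Sum>u\<in>Le (sz w). \<kappa> u * Rf u (pt w) * Rf u (pt l))"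
      by (intro sum.cong) simp_all
    finally show "E (pt w) = 0"
      using \<open>F (pt l) = 0\<close> unfolding F_pt[OF l] E_def by simp
  qed
  then show ?case by (simp add: E_def)
qed

end

theorem theorem7p3:
  fixes n :: nat and r \<alpha> :: "'k::field_char_0" and l :: "nat \<Rightarrow> nat"
  assumes "n \<ge> 1"
    and "\<forall>q::rat. q < 0 \<longrightarrow> r \<noteq> of_rat q"
    and "r \<noteq> 0"
    and "\<forall>a b :: nat. \<alpha> \<noteq> - of_nat a - of_nat b * (2 * r)"
    and "l \<in> Lam n"
  shows "Const (1 / eval (neg_rho_shift n r \<alpha>) (R n r l))
           * subst (\<lambda>i. Const (- \<alpha>) - Var i) (R n r l)
       = Sum_any (\<lambda>u.
           Const ((- 1) ^ odd_size n u
                  * (eval (rho_plus n r l) (R n r u) / eval (rho_plus n r u) (R n r u))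
                  * (1 / eval (neg_rho_shift n r \<alpha>) (R n r u)))
           * R n r u when u \<in> Lam n)"
proof (rule eval_inject)
  fix x :: "nat \<Rightarrow> 'k"
  interpret binomial_setting n r \<alpha>
    using assms by unfold_locales auto
  have ng0: "neg_rho_shift n r \<alpha> = npt (\<lambda>_. 0)"
    by (simp add: neg_rho_shift_def npt_def rho_plus_def fun_eq_iff)
  let ?c = "\<lambda>u. (- 1) ^ odd_size n u
      * (eval (rho_plus n r l) (R n r u) / eval (rho_plus n r u) (R n r u))
      * (1 / eval (neg_rho_shift n r \<alpha>) (R n r u))"
  have c: "?c u = \<kappa> u * Rf u (pt l)" for u
    by (simp add: \<kappa>_def Rf_def ng0)
  \<comment> \<open>The support is finite because R_u(rho + l) = 0 for every u of size above
    |l|.\<close>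
  have "{u. (Const (?c u) * R n r u when u \<in> Lam n) \<noteq> 0} \<subseteq> Le (sz l)"
  proof
    fix u assume "u \<in> {u. (Const (?c u) * R n r u when u \<in> Lam n) \<noteq> 0}"
    then have u: "u \<in> Lam n" and "Const (?c u) * R n r u \<noteq> 0"
      by (auto simp only: mem_Collect_eq when_def split: if_splits)
    then have "?c u \<noteq> 0" by (metis Const_def mult_zero_left single_zero)
    then have "Rf u (pt l) \<noteq> 0" unfolding c by simp
    then have "sz u \<le> sz l" using Rf_vanish[OF u assms(5)] by fastforce
    with u show "u \<in> Le (sz l)" by simp
  qed
  from Sum_any.expand_superset[OF finite_Lam_le this]
  have "eval x (Sum_any (\<lambda>u. Const (?c u) * R n r u when u \<in> Lam n)) =
      (\<Sum>u\<in>Le (sz l). eval x (Const (?c u) * R n r u when u \<in> Lam n))"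
    by (simp only: eval_sum)
  also have "\<dots> = (\<Sum>u\<in>Le (sz l). \<kappa> u * Rf u (pt l) * Rf u x)"
    by (rule sum.cong) (simp_all only: c eval_mult eval_Const Rf_def mem_Collect_eq when_simps)
  also have "\<dots> = Rrefl l x / Rf l (npt (\<lambda>_. 0))"
    by (rule binomial_formula[OF assms(5), symmetric])
  also have "\<dots> = eval x (Const (1 / eval (neg_rho_shift n r \<alpha>) (R n r l))
      * subst (\<lambda>i. Const (- \<alpha>) - Var i) (R n r l))"
  proof -
    have "(\<lambda>i. - 1 * x i + - \<alpha>) = (\<lambda>i. - \<alpha> - x i)" by (simp add: fun_eq_iff)
    then have "Rrefl l x = eval (\<lambda>i. - \<alpha> - x i) (R n r l)" by (simp only: Rrefl_def Rf_def)
    then show ?thesis by (simp add: Rf_def ng0)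
  qed
  finally show "eval x (Const (1 / eval (neg_rho_shift n r \<alpha>) (R n r l))
      * subst (\<lambda>i. Const (- \<alpha>) - Var i) (R n r l)) =
    eval x (Sum_any (\<lambda>u. Const (?c u) * R n r u when u \<in> Lam n))" ..
qed

end
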